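(* Let $\gamma\ge1$ and let $\mathcal{B}$ be a nonempty finite set of complex numbers with $\operatorname{Re}(b)\ge\gamma$ for all $b\in\mathcal{B}$; set $\theta_b(z)=1/(z+b)$. Let $G_\gamma=\{z\in\mathbb{C}:|z-1/(2\gamma)|<1/(2\gamma)\}$ and let $H$ be a bounded, open, mildly regular subset of $\{z\in\mathbb{C}:\operatorname{Re}(z)>0\}$ with $H\supset G_\gamma$. Fix a positive integer $m$ and $s>0$, let $X=C^m_{\mathbb{C}}(\bar H)$, $Y=C_{\mathbb{C}}(\bar H)$, and define $\Lambda_s:X\to X$ and $L_s:Y\to Y$ by the same formula $$(\Lambda_sf)(z)=\sum_{b\in\mathcal{B}}\frac{1}{|z+b|^{2s}}f(\theta_b(z)).$$ Then $r(\Lambda_s)>0$ and $r(\Lambda_s)=r(L_s)$, where $r$ denotes spectral radius; the essential spectral radius satisfies $\rho(\Lambda_s)\le(\gamma^2+1)^{-m}r(\Lambda_s)$; there exists $v_s\in X$ with $v_s(z)>0$ for all $z\in\bar H$ and $\Lambda_sv_s=r v_s$, where $r=r(\Lambda_s)$; there exists $r_1<r$ such that $|\xi|\le r_1$ for every $\xi\in\sigma(\Lambda_s)\setminus\{r\}$; $r$ is an isolated point of $\sigma(\Lambda_s)$ and an eigenvalue of algebraic multiplicity one; and for every $u\in X$ with $u(z)>0$ for all $z\in\bar H$ there is a real number $s_u>0$ such that $\lim_{k\to\infty}(r^{-1}\Lambda_s)^k(u)=s_uv_s$, with convergence in the norm of $X$.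
   Context: A bounded open set $H\subset\mathbb{R}^n$ is mildly regular if there exist $\eta>0$ and $M\ge1$ such that whenever $x,y\in H$ and $\|x-y\|<\eta$, there is a Lipschitz map $\psi:[0,1]\to H$ with $\psi(0)=x$, $\psi(1)=y$ and $\int_0^1\|\psi'(t)\|\,dt\le M\|x-y\|$. We identify $\mathbb{C}=\mathbb{R}^2$. $C^m_{\mathbb{C}}(\bar H)$ is the complex Banach space of complex-valued $C^m$ maps on $H$ all of whose partial derivatives $D^\beta f$ of order $|\beta|\le m$ extend continuously to $\bar H$, with norm $\|f\|=\sup\{|D^\beta f(x)|:x\in H,|\beta|\le m\}$; $C_{\mathbb{C}}(\bar H)$ is the space of continuous complex functions on $\bar H$ with sup norm. $\sigma(\cdot)$ denotes spectrum, $r(L)=\lim_k\|L^k\|^{1/k}$, and $\rho(\cdot)$ denotes the essential spectral radius. *)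

theory Defs
  imports "HOL-Analysis.Analysis"
begin

(* C is identified with R^2: coordinates Re, Im.  Functions on closure H are
   represented as maps complex => complex that vanish outside closure H. *)

definition mildly_regular :: "complex set \<Rightarrow> bool" where
  "mildly_regular H \<longleftrightarrow> (\<exists>\<eta>>0. \<exists>M\<ge>1. \<forall>x\<in>H. \<forall>y\<in>H. norm (x - y) < \<eta> \<longrightarrow>
     (\<exists>\<psi> :: real \<Rightarrow> complex. (\<exists>C. C-lipschitz_on {0..1} \<psi>) \<and> \<psi> ` {0..1} \<subseteq> H \<and>
        \<psi> 0 = x \<and> \<psi> 1 = y \<and>
        integral {0..1} (\<lambda>t. norm (vector_derivative \<psi> (at t))) \<le> M * norm (x - y)))"

definition pdir :: "complex \<Rightarrow> (complex \<Rightarrow> complex) \<Rightarrow> complex \<Rightarrow> complex" where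
  "pdir e f z = vector_derivative (\<lambda>t::real. f (z + of_real t * e)) (at 0)"

fun Dlist :: "complex list \<Rightarrow> (complex \<Rightarrow> complex) \<Rightarrow> complex \<Rightarrow> complex" where
  "Dlist [] f = f"
| "Dlist (e # es) f = pdir e (Dlist es f)"

definition Dmi :: "nat \<times> nat \<Rightarrow> (complex \<Rightarrow> complex) \<Rightarrow> complex \<Rightarrow> complex" where
  "Dmi \<beta> f = ((pdir 1) ^^ (fst \<beta>)) (((pdir \<i>) ^^ (snd \<beta>)) f)"

definition Cm_on :: "nat \<Rightarrow> complex set \<Rightarrow> (complex \<Rightarrow> complex) \<Rightarrow> bool" where
  "Cm_on m H f \<longleftrightarrow>
     (\<forall>es e. set es \<subseteq> {1, \<i>} \<and> length es < m \<and> e \<in> {1, \<i>} \<longrightarrow>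
        (\<forall>z\<in>H. (\<lambda>t::real. Dlist es f (z + of_real t * e)) differentiable (at 0))) \<and>
     (\<forall>es. set es \<subseteq> {1, \<i>} \<and> length es \<le> m \<longrightarrow> continuous_on H (Dlist es f))"

definition CmSpace :: "complex set \<Rightarrow> nat \<Rightarrow> (complex \<Rightarrow> complex) set" where
  "CmSpace H m = {f. Cm_on m H f \<and>
     (\<forall>\<beta>. fst \<beta> + snd \<beta> \<le> m \<longrightarrow>
        (\<exists>g. continuous_on (closure H) g \<and> (\<forall>z\<in>H. g z = Dmi \<beta> f z))) \<and>
     continuous_on (closure H) f \<and> (\<forall>z. z \<notin> closure H \<longrightarrow> f z = 0)}"

definition Cm_norm :: "complex set \<Rightarrow> nat \<Rightarrow> (complex \<Rightarrow> complex) \<Rightarrow> real" where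
  "Cm_norm H m f = (SUP p \<in> {(\<beta>, z). fst \<beta> + snd \<beta> \<le> m \<and> z \<in> H}. cmod (Dmi (fst p) f (snd p)))"

definition CSpace :: "complex set \<Rightarrow> (complex \<Rightarrow> complex) set" where
  "CSpace H = {f. continuous_on (closure H) f \<and> (\<forall>z. z \<notin> closure H \<longrightarrow> f z = 0)}"

definition sup_norm :: "complex set \<Rightarrow> (complex \<Rightarrow> complex) \<Rightarrow> real" where
  "sup_norm H f = (SUP z \<in> closure H. cmod (f z))"

definition bounded_op :: "(complex \<Rightarrow> complex) set \<Rightarrow> ((complex \<Rightarrow> complex) \<Rightarrow> real)
    \<Rightarrow> ((complex \<Rightarrow> complex) \<Rightarrow> (complex \<Rightarrow> complex)) \<Rightarrow> bool" where
  "bounded_op S N T \<longleftrightarrow> (\<forall>f\<in>S. T f \<in> S) \<and>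
     (\<forall>f\<in>S. \<forall>g\<in>S. T (\<lambda>z. f z + g z) = (\<lambda>z. T f z + T g z)) \<and>
     (\<forall>f\<in>S. \<forall>c. T (\<lambda>z. c * f z) = (\<lambda>z. c * T f z)) \<and>
     (\<exists>C. \<forall>f\<in>S. N (T f) \<le> C * N f)"

definition op_norm :: "(complex \<Rightarrow> complex) set \<Rightarrow> ((complex \<Rightarrow> complex) \<Rightarrow> real) \<Rightarrow> ((complex \<Rightarrow> complex) \<Rightarrow> (complex \<Rightarrow> complex)) \<Rightarrow> real" where
  "op_norm S N T = (SUP f \<in> {f\<in>S. N f \<le> 1}. N (T f))"

definition spec_rad :: "(complex \<Rightarrow> complex) set \<Rightarrow> ((complex \<Rightarrow> complex) \<Rightarrow> real) \<Rightarrow> ((complex \<Rightarrow> complex) \<Rightarrow> (complex \<Rightarrow> complex)) \<Rightarrow> real" where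
  "spec_rad S N T = lim (\<lambda>k. root k (op_norm S N (T ^^ k)))"

definition spectrum_op :: "(complex \<Rightarrow> complex) set \<Rightarrow> ((complex \<Rightarrow> complex) \<Rightarrow> real) \<Rightarrow> ((complex \<Rightarrow> complex) \<Rightarrow> (complex \<Rightarrow> complex)) \<Rightarrow> complex set" where
  "spectrum_op S N T = {\<mu>. \<not> (\<exists>R. bounded_op S N R \<and>
      (\<forall>f\<in>S. R (\<lambda>z. \<mu> * f z - T f z) = f) \<and>
      (\<forall>f\<in>S. (\<lambda>z. \<mu> * R f z - T (R f) z) = f))}"

definition compact_op :: "(complex \<Rightarrow> complex) set \<Rightarrow> ((complex \<Rightarrow> complex) \<Rightarrow> real) \<Rightarrow> ((complex \<Rightarrow> complex) \<Rightarrow> (complex \<Rightarrow> complex)) \<Rightarrow> bool" where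
  "compact_op S N K \<longleftrightarrow> bounded_op S N K \<and>
     (\<forall>(F :: nat \<Rightarrow> complex \<Rightarrow> complex) (C::real). (\<forall>n. F n \<in> S \<and> N (F n) \<le> C) \<longrightarrow>
        (\<exists>(\<sigma> :: nat \<Rightarrow> nat) g. strict_mono \<sigma> \<and> g \<in> S \<and>
           (\<lambda>n. N (\<lambda>z. K (F (\<sigma> n)) z - g z)) \<longlonglongrightarrow> 0))"

definition ess_norm :: "(complex \<Rightarrow> complex) set \<Rightarrow> ((complex \<Rightarrow> complex) \<Rightarrow> real) \<Rightarrow> ((complex \<Rightarrow> complex) \<Rightarrow> (complex \<Rightarrow> complex)) \<Rightarrow> real" where
  "ess_norm S N T = Inf {op_norm S N (\<lambda>f z. T f z - K f z) | K. compact_op S N K}"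

definition ess_spec_rad :: "(complex \<Rightarrow> complex) set \<Rightarrow> ((complex \<Rightarrow> complex) \<Rightarrow> real) \<Rightarrow> ((complex \<Rightarrow> complex) \<Rightarrow> (complex \<Rightarrow> complex)) \<Rightarrow> real" where
  "ess_spec_rad S N T = lim (\<lambda>k. root k (ess_norm S N (T ^^ k)))"

definition Lam :: "complex set \<Rightarrow> real \<Rightarrow> complex set \<Rightarrow> (complex \<Rightarrow> complex) \<Rightarrow> complex \<Rightarrow> complex" where
  "Lam B s H f = (\<lambda>z. if z \<in> closure H
      then (\<Sum>b\<in>B. complex_of_real (1 / (cmod (z + b) powr (2 * s))) * f (1 / (z + b)))
      else 0)"

end

(* Compositions of k of the maps 1 / (z + b) have the form z |-> a + kappa / (z + d) with Re d >= gamma, carry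
   the weight |kappa|^s |z + d|^(-2s), and satisfy |kappa| <= const * (gamma^2 + 1)^(-k). Weights are therefore
   log-Lipschitz with a constant independent of the word. Dividing the iterates of a function by those of the
   constant 1 gives an inhomogeneous Markov chain on the closed disc, and a Doeblin estimate makes these
   quotients converge exponentially fast to a constant, the value of a positive functional. Expressed through
   Wirtinger derivatives, the derivatives of weighted branches are explicit, and a Lasota-Yorke induction on the order
   of differentiation lifts the decay on the kernel of the functional from the sup norm to the C^m norm. This
   yields the eigenfunction, and a Neumann series on the kernel yields the resolvent. For the essential
   spectral radius, f is replaced on the image of each branch by a Taylor polynomial of degree m - 1: this leaves
   an operator of finite rank and a remainder of the size of the m-th power of the contraction. *)

theory Submission
  imports Defs
begin

section \<open>Iterated partial derivatives\<close>

text \<open>The eigenfunction is not known beforehand, so the operator cannot be normalised by it.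
  Dividing by \<open>mass n\<close>, the iterate of the constant 1, costs only that the transition
  probabilities change with n, and all constants are uniform in n. The eigenvalue is then read off
  as \<open>ell (L one)\<close>, and the eigenfunction comes last, as the sum of a geometric series.
  Oscillations are measured only on the closed disc D: every branch sends \<open>closure H\<close>
  into it, its diameter is at most 1, and it is convex, so that derivative bounds give Lipschitz
  bounds there. A single map 1 / (z + b) need not contract strictly when \<gamma> = 1. The rate
  (\<gamma>^2 + 1)^(-1) per letter appears only when letters are taken in pairs, hence the constants
  \<open>inverse (rate\<^sup>2)\<close>. Wirtinger derivatives are used because |z + d|^(-2 s)
  splits formally into a holomorphic and an antiholomorphic factor, so that the two derivatives act
  on separate factors. They return to real partial derivatives at the cost of a factor 2 per
  order.\<close>

lemma mvt_affine:
  fixes \<phi> :: "real \<Rightarrow> complex"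
  assumes d: "\<And>t. t \<in> closed_segment 0 k \<Longrightarrow> (\<phi> has_vector_derivative \<phi>' t) (at t)"
    and b: "\<And>t. t \<in> closed_segment 0 k \<Longrightarrow> cmod (\<phi>' t - a) \<le> e"
  shows "cmod (\<phi> k - \<phi> 0 - of_real k * a) \<le> e * \<bar>k\<bar>"
proof -
  have "norm ((\<phi> k - of_real k * a) - (\<phi> 0 - of_real 0 * a)) \<le> e * norm (k - 0)"
  proof (rule differentiable_bound[where S = "closed_segment 0 k" and f' = "\<lambda>t h. h *\<^sub>R (\<phi>' t - a)"])
    fix t assume t: "t \<in> closed_segment 0 k"
    have "((\<lambda>k. \<phi> k - of_real k * a) has_vector_derivative (\<phi>' t - a)) (at t)"
      by (auto intro!: derivative_eq_intros d[OF t])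
    then show "((\<lambda>k. \<phi> k - of_real k * a) has_derivative (\<lambda>h. h *\<^sub>R (\<phi>' t - a))) (at t within closed_segment 0 k)"
      unfolding has_vector_derivative_def by (rule has_derivative_at_withinI)
    show "onorm (\<lambda>h. h *\<^sub>R (\<phi>' t - a)) \<le> e"
      using b[OF t] by (intro onorm_bound) (auto simp: mult.commute[of e] intro!: mult_left_mono intro: order_trans[OF norm_ge_zero])
  qed auto
  then show ?thesis by (simp add: algebra_simps)
qed

text \<open>\<open>pdir\<close> looks at parameter 0 only; translating the parameter turns it into
  the derivative at every point of the line, as mean value arguments need.\<close>

lemma pdir_has_vector_derivative:
  assumes "(\<lambda>t::real. u (w + of_real t0 * e + of_real t * e)) differentiable (at 0)"
  shows "((\<lambda>t::real. u (w + of_real t * e)) has_vector_derivative pdir e u (w + of_real t0 * e)) (at t0)"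
proof -
  let ?g = "\<lambda>t::real. u (w + of_real t0 * e + of_real t * e)"
  have "(?g has_vector_derivative pdir e u (w + of_real t0 * e)) (at 0)"
    using assms unfolding pdir_def by (simp add: vector_derivative_works)
  then have g: "(?g has_vector_derivative pdir e u (w + of_real t0 * e)) (at (t0 - t0))" by simp
  have "((\<lambda>t. t - t0) has_vector_derivative 1) (at t0)"
    by (auto intro!: derivative_eq_intros)
  from vector_diff_chain_at[OF this g]
  have "(?g \<circ> (\<lambda>t. t - t0) has_vector_derivative pdir e u (w + of_real t0 * e)) (at t0)" by simp
  moreover have "?g \<circ> (\<lambda>t. t - t0) = (\<lambda>t. u (w + of_real t * e))"
    by (auto simp: fun_eq_iff algebra_simps)
  ultimately show ?thesis by simp
qed

lemma pdir_mvt: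
  assumes "\<And>t. t \<in> closed_segment 0 k \<Longrightarrow> (\<lambda>\<tau>::real. u (w + of_real t * e + of_real \<tau> * e)) differentiable (at 0)"
    and "\<And>t. t \<in> closed_segment 0 k \<Longrightarrow> cmod (pdir e u (w + of_real t * e) - a) \<le> \<epsilon>"
  shows "cmod (u (w + of_real k * e) - u w - of_real k * a) \<le> \<epsilon> * \<bar>k\<bar>"
  using mvt_affine[of k "\<lambda>t. u (w + of_real t * e)" "\<lambda>t. pdir e u (w + of_real t * e)" a \<epsilon>]
    pdir_has_vector_derivative assms by simp

lemma abs_le_closed_segment_0: "t \<in> closed_segment 0 k \<Longrightarrow> \<bar>t\<bar> \<le> \<bar>k::real\<bar>"
  by (auto simp: closed_segment_eq_real_ivl split: if_splits)

text \<open>\<open>Cm_on\<close> speaks of axis derivatives only. The increment from z to y is taken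
  along a horizontal and then a vertical leg; on each leg the axis derivative stays within
  \<epsilon>/2 of its value at z.\<close>

lemma continuous_partials_has_derivative:
  assumes H: "open H" and z: "z \<in> H"
    and d: "\<And>z e. z \<in> H \<Longrightarrow> e \<in> {1, \<i>} \<Longrightarrow> (\<lambda>t::real. u (z + of_real t * e)) differentiable (at 0)"
    and c: "\<And>e. e \<in> {1, \<i>} \<Longrightarrow> continuous_on H (pdir e u)"
  shows "(u has_derivative (\<lambda>h. of_real (Re h) * pdir 1 u z + of_real (Im h) * pdir \<i> u z)) (at z)"
  unfolding has_derivative_at_alt
proof (intro conjI allI impI)
  show "bounded_linear (\<lambda>h. of_real (Re h) * pdir 1 u z + of_real (Im h) * pdir \<i> u z)"
    by (intro bounded_linear_add bounded_linear_compose[OF bounded_linear_mult_left]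
          bounded_linear_compose[OF bounded_linear_of_real] bounded_linear_Re bounded_linear_Im)
  fix \<epsilon> :: real assume \<epsilon>: "\<epsilon> > 0"
  have "\<exists>\<delta>>0. \<forall>w. dist w z < \<delta> \<longrightarrow> w \<in> H \<and> cmod (pdir e u w - pdir e u z) \<le> \<epsilon> / 2" if e: "e \<in> {1, \<i>}" for e
  proof -
    have "isCont (pdir e u) z" using c[OF e] H z by (simp add: continuous_on_eq_continuous_at)
    then obtain d1 where d1: "d1 > 0" "\<And>w. dist w z < d1 \<Longrightarrow> dist (pdir e u w) (pdir e u z) < \<epsilon> / 2"
      unfolding continuous_at_eps_delta using \<epsilon> by (metis half_gt_zero)
    obtain d2 where d2: "d2 > 0" "ball z d2 \<subseteq> H" using H z open_contains_ball by blast
    show ?thesis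
      using d1 d2 by (intro exI[of _ "min d1 d2"]) (auto simp: dist_norm norm_minus_commute subset_eq less_imp_le)
  qed
  from this[of 1] this[of \<i>] obtain d1 d2 where d1: "d1 > 0" "\<And>w. dist w z < d1 \<Longrightarrow> w \<in> H \<and> cmod (pdir 1 u w - pdir 1 u z) \<le> \<epsilon> / 2"
    and d2: "d2 > 0" "\<And>w. dist w z < d2 \<Longrightarrow> w \<in> H \<and> cmod (pdir \<i> u w - pdir \<i> u z) \<le> \<epsilon> / 2"
    by auto
  show "\<exists>\<delta>>0. \<forall>y. norm (y - z) < \<delta> \<longrightarrow>
      norm (u y - u z - (of_real (Re (y - z)) * pdir 1 u z + of_real (Im (y - z)) * pdir \<i> u z)) \<le> \<epsilon> * norm (y - z)"
  proof (intro exI[of _ "min d1 d2"] conjI allI impI)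
    fix y assume y: "norm (y - z) < min d1 d2"
    define h k where "h = Re (y - z)" and "k = Im (y - z)"
    have near: "dist (z + of_real t * 1) z < min d1 d2" if "t \<in> closed_segment 0 h" for t
      using abs_le_closed_segment_0[OF that] abs_Re_le_cmod[of "y - z"] y by (simp add: h_def dist_norm)
    \<comment> \<open>The vertical leg starts at the corner, yet stays within distance |y - z| of z
      because |t| is at most |k|.\<close>
    have near2: "dist (z + of_real h + of_real t * \<i>) z < min d1 d2" if "t \<in> closed_segment 0 k" for t
    proof -
      have "cmod (of_real h + of_real t * \<i>) \<le> cmod (y - z)"
        using abs_le_closed_segment_0[OF that] unfolding cmod_def h_def k_def
        by (intro real_sqrt_le_mono) (auto simp: abs_le_square_iff)
      then show ?thesis using y by (simp add: dist_norm algebra_simps)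
    qed
    have 1: "cmod (u (z + of_real h * 1) - u z - of_real h * pdir 1 u z) \<le> \<epsilon> / 2 * \<bar>h\<bar>"
      using near d1(2) by (intro pdir_mvt d) auto
    have 2: "cmod (u (z + of_real h + of_real k * \<i>) - u (z + of_real h) - of_real k * pdir \<i> u z) \<le> \<epsilon> / 2 * \<bar>k\<bar>"
      using near2 d2(2) by (intro pdir_mvt d) auto
    have yy: "z + of_real h + of_real k * \<i> = y" by (simp add: h_def k_def complex_eq_iff)
    have "cmod (u y - u z - (of_real h * pdir 1 u z + of_real k * pdir \<i> u z)) \<le>
        cmod (u (z + of_real h * 1) - u z - of_real h * pdir 1 u z) + cmod (u y - u (z + of_real h) - of_real k * pdir \<i> u z)"
      by (rule order_trans[OF _ norm_triangle_ineq]) (simp add: algebra_simps)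
    also have "\<dots> \<le> \<epsilon> / 2 * \<bar>h\<bar> + \<epsilon> / 2 * \<bar>k\<bar>" using 1 2 yy by simp
    also have "\<dots> \<le> \<epsilon> / 2 * cmod (y - z) + \<epsilon> / 2 * cmod (y - z)"
      using \<epsilon> abs_Re_le_cmod[of "y - z"] abs_Im_le_cmod[of "y - z"] unfolding h_def k_def
      by (intro add_mono mult_left_mono) auto
    finally show "norm (u y - u z - (of_real (Re (y - z)) * pdir 1 u z + of_real (Im (y - z)) * pdir \<i> u z)) \<le> \<epsilon> * norm (y - z)"
      by (simp add: h_def k_def)
  qed (use d1 d2 in auto)
qed

text \<open>The increment across e' is viewed as a function of the position along e. The mean value
  inequality is used once along e, and once along e' to estimate the derivative of that
  increment.\<close>

lemma mixed_second_difference: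
  assumes \<epsilon>: "\<epsilon> > 0" and H: "open H" and z: "z \<in> H" and e: "cmod e = 1" "cmod e' = 1"
    and d: "\<And>w. w \<in> H \<Longrightarrow> (\<lambda>t::real. u (w + of_real t * e)) differentiable (at 0)"
    and d': "\<And>w. w \<in> H \<Longrightarrow> (\<lambda>t::real. pdir e u (w + of_real t * e')) differentiable (at 0)"
    and c: "continuous_on H (pdir e' (pdir e u))"
  obtains \<delta> where "\<delta> > 0" "\<And>h. 0 < h \<Longrightarrow> h < \<delta> \<Longrightarrow>
    cmod (u (z + of_real h * e + of_real h * e') - u (z + of_real h * e) - u (z + of_real h * e') + u z
      - of_real h * (of_real h * pdir e' (pdir e u) z)) \<le> \<epsilon> * h\<^sup>2"
proof -
  have "isCont (pdir e' (pdir e u)) z" using c H z by (simp add: continuous_on_eq_continuous_at)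
  then obtain d1 where d1: "d1 > 0" "\<And>w. dist w z < d1 \<Longrightarrow> dist (pdir e' (pdir e u) w) (pdir e' (pdir e u) z) < \<epsilon>"
    unfolding continuous_at_eps_delta using \<epsilon> by blast
  obtain d2 where d2: "d2 > 0" "ball z d2 \<subseteq> H" using H z open_contains_ball by blast
  define \<delta> where "\<delta> = min d1 d2 / 2"
  have H': "w \<in> H" if "dist w z < 2 * \<delta>" for w
    using that d2 by (auto simp: \<delta>_def dist_commute subset_eq)
  have B: "cmod (pdir e' (pdir e u) w - pdir e' (pdir e u) z) \<le> \<epsilon>" if "dist w z < 2 * \<delta>" for w
    using d1(2)[of w] that by (auto simp: \<delta>_def dist_norm)
  show ?thesis
  proof (rule that)
    show "\<delta> > 0" using d1 d2 by (simp add: \<delta>_def)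
    fix h :: real assume h: "0 < h" "h < \<delta>"
    have near: "dist (z + of_real t * e + of_real t' * e') z < 2 * \<delta>"
      if "t \<in> closed_segment 0 h" "t' \<in> closed_segment 0 h" for t t'
    proof -
      have "cmod (of_real t * e + of_real t' * e') \<le> \<bar>t\<bar> + \<bar>t'\<bar>"
        by (rule order_trans[OF norm_triangle_ineq]) (simp add: norm_mult e)
      then show ?thesis using abs_le_closed_segment_0[OF that(1)] abs_le_closed_segment_0[OF that(2)] h
        by (simp add: dist_norm add.assoc)
    qed
    have z0: "0 \<in> closed_segment 0 h" "h \<in> closed_segment 0 h" by auto
    let ?\<phi> = "\<lambda>t. u (z + of_real h * e' + of_real t * e) - u (z + of_real t * e)"
    let ?a = "of_real h * pdir e' (pdir e u) z"
    have "cmod (?\<phi> h - ?\<phi> 0 - of_real h * ?a) \<le> (\<epsilon> * h) * \<bar>h\<bar>"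
    proof (rule mvt_affine)
      fix t assume t: "t \<in> closed_segment 0 h"
      show "(?\<phi> has_vector_derivative (pdir e u (z + of_real h * e' + of_real t * e) - pdir e u (z + of_real t * e))) (at t)"
        using near[OF t z0(1)] near[OF t z0(2)]
        by (intro has_vector_derivative_diff pdir_has_vector_derivative d H') (auto simp: algebra_simps)
      have "cmod (pdir e u (z + of_real t * e + of_real h * e') - pdir e u (z + of_real t * e) - ?a) \<le> \<epsilon> * \<bar>h\<bar>"
        using near[OF t] by (intro pdir_mvt d' H' B) auto
      then show "cmod (pdir e u (z + of_real h * e' + of_real t * e) - pdir e u (z + of_real t * e) - ?a) \<le> \<epsilon> * h"
        using h by (simp add: algebra_simps)
    qed
    then show "cmod (u (z + of_real h * e + of_real h * e') - u (z + of_real h * e) - u (z + of_real h * e') + u z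
      - of_real h * (of_real h * pdir e' (pdir e u) z)) \<le> \<epsilon> * h\<^sup>2"
      using h by (simp add: algebra_simps power2_eq_square)
  qed
qed

text \<open>Both mixed derivatives are approximated by the same second difference divided by h^2,
  which is symmetric in e and e'.\<close>

lemma pdir_commute:
  assumes H: "open H" and z: "z \<in> H" and e: "cmod e = 1" "cmod e' = 1"
    and d: "\<And>w. w \<in> H \<Longrightarrow> (\<lambda>t::real. u (w + of_real t * e)) differentiable (at 0)"
      "\<And>w. w \<in> H \<Longrightarrow> (\<lambda>t::real. u (w + of_real t * e')) differentiable (at 0)"
      "\<And>w. w \<in> H \<Longrightarrow> (\<lambda>t::real. pdir e u (w + of_real t * e')) differentiable (at 0)"
      "\<And>w. w \<in> H \<Longrightarrow> (\<lambda>t::real. pdir e' u (w + of_real t * e)) differentiable (at 0)"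
    and c: "continuous_on H (pdir e' (pdir e u))" "continuous_on H (pdir e (pdir e' u))"
  shows "pdir e (pdir e' u) z = pdir e' (pdir e u) z"
proof (rule ccontr)
  assume ne: "pdir e (pdir e' u) z \<noteq> pdir e' (pdir e u) z"
  \<comment> \<open>A third of the gap, so that two errors of size \<epsilon> cannot fill
    it.\<close>
  define \<epsilon> where "\<epsilon> = cmod (pdir e (pdir e' u) z - pdir e' (pdir e u) z) / 3"
  have \<epsilon>: "\<epsilon> > 0" using ne by (simp add: \<epsilon>_def)
  obtain d1 where d1: "d1 > 0" "\<And>h. 0 < h \<Longrightarrow> h < d1 \<Longrightarrow>
    cmod (u (z + of_real h * e + of_real h * e') - u (z + of_real h * e) - u (z + of_real h * e') + u z
      - of_real h * (of_real h * pdir e' (pdir e u) z)) \<le> \<epsilon> * h\<^sup>2"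
    using mixed_second_difference[OF \<epsilon> H z e d(1) d(3) c(1)] by blast
  obtain d2 where d2: "d2 > 0" "\<And>h. 0 < h \<Longrightarrow> h < d2 \<Longrightarrow>
    cmod (u (z + of_real h * e' + of_real h * e) - u (z + of_real h * e') - u (z + of_real h * e) + u z
      - of_real h * (of_real h * pdir e (pdir e' u) z)) \<le> \<epsilon> * h\<^sup>2"
    using mixed_second_difference[OF \<epsilon> H z e(2,1) d(2) d(4) c(2)] by blast
  define h where "h = min d1 d2 / 2"
  have h: "0 < h" "h < d1" "h < d2" using d1(1) d2(1) by (auto simp: h_def)
  let ?A = "u (z + of_real h * e + of_real h * e') - u (z + of_real h * e) - u (z + of_real h * e') + u z"
  have A: "u (z + of_real h * e' + of_real h * e) - u (z + of_real h * e') - u (z + of_real h * e) + u z = ?A"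
    by (simp add: algebra_simps)
  have "cmod (of_real h * (of_real h * pdir e (pdir e' u) z) - of_real h * (of_real h * pdir e' (pdir e u) z)) \<le>
    cmod (?A - of_real h * (of_real h * pdir e' (pdir e u) z)) + cmod (?A - of_real h * (of_real h * pdir e (pdir e' u) z))"
    by (rule order_trans[OF _ norm_triangle_ineq4]) (simp add: algebra_simps)
  also have "\<dots> \<le> \<epsilon> * h\<^sup>2 + \<epsilon> * h\<^sup>2"
    using d1(2)[OF h(1,2)] d2(2)[OF h(1,3)] unfolding A by (rule add_mono)
  also have "of_real h * (of_real h * pdir e (pdir e' u) z) - of_real h * (of_real h * pdir e' (pdir e u) z)
     = of_real (h\<^sup>2) * (pdir e (pdir e' u) z - pdir e' (pdir e u) z)"
    by (simp add: algebra_simps power2_eq_square)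
  finally have "h\<^sup>2 * (3 * \<epsilon>) \<le> h\<^sup>2 * (2 * \<epsilon>)"
    by (simp only: norm_mult norm_of_real) (simp add: \<epsilon>_def mult.commute)
  then show False using h(1) \<epsilon> by simp
qed

section \<open>Jets of differentiable functions\<close>

text \<open>The entries are data instead of derivatives computed from \<open>F 0 0\<close>: they
  live on the closure, beyond the points where derivatives are taken, and can be added, shifted and
  bounded like any table. p and q are the covectors dual to the chosen pair of derivations.\<close>

definition jet :: "(complex \<Rightarrow> complex) \<Rightarrow> (complex \<Rightarrow> complex) \<Rightarrow> complex set \<Rightarrow> nat \<Rightarrow> (nat \<Rightarrow> nat \<Rightarrow> complex \<Rightarrow> complex) \<Rightarrow> bool" where
  "jet p q H n F \<longleftrightarrow>
     (\<forall>i j. i + j \<le> n \<longrightarrow> continuous_on (closure H) (F i j)) \<and>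
     (\<forall>i j. i + j < n \<longrightarrow> (\<forall>z\<in>H. (F i j has_derivative (\<lambda>h. p h * F (Suc i) j z + q h * F i (Suc j) z)) (at z)))"

text \<open>The derivation a D1 + b D2 acting on the whole table. In a Wirtinger jet,
  \<open>shift e (cnj e)\<close> is the derivative in direction e.\<close>

definition shift :: "complex \<Rightarrow> complex \<Rightarrow> (nat \<Rightarrow> nat \<Rightarrow> complex \<Rightarrow> complex) \<Rightarrow> nat \<Rightarrow> nat \<Rightarrow> complex \<Rightarrow> complex" where
  "shift a b F = (\<lambda>i j z. a * F (Suc i) j z + b * F i (Suc j) z)"

abbreviation wirtinger_jet :: "complex set \<Rightarrow> nat \<Rightarrow> (nat \<Rightarrow> nat \<Rightarrow> complex \<Rightarrow> complex) \<Rightarrow> bool" where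
  "wirtinger_jet \<equiv> jet (\<lambda>h. h) cnj"

abbreviation real_jet :: "complex set \<Rightarrow> nat \<Rightarrow> (nat \<Rightarrow> nat \<Rightarrow> complex \<Rightarrow> complex) \<Rightarrow> bool" where
  "real_jet \<equiv> jet (\<lambda>h. of_real (Re h)) (\<lambda>h. of_real (Im h))"

lemma jet_continuous: "jet p q H n F \<Longrightarrow> i + j \<le> n \<Longrightarrow> continuous_on (closure H) (F i j)"
  by (simp add: jet_def)

lemma jet_has_derivative:
  "jet p q H n F \<Longrightarrow> i + j < n \<Longrightarrow> z \<in> H \<Longrightarrow>
    (F i j has_derivative (\<lambda>h. p h * F (Suc i) j z + q h * F i (Suc j) z)) (at z)"
  by (simp add: jet_def)

lemma jet_mono: "jet p q H n F \<Longrightarrow> k \<le> n \<Longrightarrow> jet p q H k F"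
  by (simp add: jet_def)

lemma jet_add:
  assumes "jet p q H n F" "jet p q H n G"
  shows "jet p q H n (\<lambda>i j z. F i j z + G i j z)"
  unfolding jet_def
proof (intro conjI allI impI ballI)
  fix i j z assume ij: "i + j < n" and z: "z \<in> H"
  have "((\<lambda>z. F i j z + G i j z) has_derivative (\<lambda>h. (p h * F (Suc i) j z + q h * F i (Suc j) z) + (p h * G (Suc i) j z + q h * G i (Suc j) z))) (at z)"
    using assms ij z by (intro has_derivative_add jet_has_derivative)
  then show "((\<lambda>z. F i j z + G i j z) has_derivative
     (\<lambda>h. p h * (F (Suc i) j z + G (Suc i) j z) + q h * (F i (Suc j) z + G i (Suc j) z))) (at z)"
    by (rule has_derivative_eq_rhs) (auto simp: algebra_simps)
qed (use assms in \<open>auto intro!: continuous_intros simp: jet_continuous\<close>)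

lemma jet_cmult:
  assumes "jet p q H n F"
  shows "jet p q H n (\<lambda>i j z. c * F i j z)"
  unfolding jet_def
proof (intro conjI allI impI ballI)
  fix i j z assume ij: "i + j < n" and z: "z \<in> H"
  have "((\<lambda>z. c * F i j z) has_derivative (\<lambda>h. c * (p h * F (Suc i) j z + q h * F i (Suc j) z))) (at z)"
    using assms ij z by (intro has_derivative_mult_right jet_has_derivative)
  then show "((\<lambda>z. c * F i j z) has_derivative (\<lambda>h. p h * (c * F (Suc i) j z) + q h * (c * F i (Suc j) z))) (at z)"
    by (rule has_derivative_eq_rhs) (auto simp: algebra_simps)
qed (use assms in \<open>auto intro!: continuous_intros simp: jet_continuous\<close>)

lemma jet_shifts:
  assumes "jet p q H (Suc n) F"
  shows "jet p q H n (\<lambda>i. F (Suc i))" "jet p q H n (\<lambda>i j. F i (Suc j))"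
  using assms unfolding jet_def by auto

lemma jet_shift: "jet p q H (Suc n) F \<Longrightarrow> jet p q H n (shift a b F)"
  unfolding shift_def by (intro jet_add jet_cmult) (simp_all add: jet_shifts)

lemma shift_commute: "shift a b (shift c d F) = shift c d (shift a b F)"
  by (simp add: shift_def fun_eq_iff algebra_simps)

lemma shift_power_commute: "shift a b ((shift c d ^^ k) F) = (shift c d ^^ k) (shift a b F)"
  by (induction k) (simp_all add: shift_commute[of a b c d])

lemma jet_shift_power: "jet p q H (n + k) F \<Longrightarrow> jet p q H n ((shift a b ^^ k) F)"
proof (induction k arbitrary: n)
  case (Suc k)
  then show ?case using Suc.IH[of "Suc n"] by (simp add: jet_shift)
qed simp

text \<open>Derivations with constant coefficients commute, so a linear change of frame turns a jet
  into a jet; \<open>basis\<close> says that both frames express the same differential.\<close>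

lemma jet_basis_change:
  assumes F: "jet p q H n F"
    and basis: "\<And>h x y. p h * x + q h * y = p' h * (a * x + b * y) + q' h * (c * x + d * y)"
  shows "jet p' q' H n (\<lambda>i j. (shift a b ^^ i) ((shift c d ^^ j) F) 0 0)"
proof -
  have G: "jet p q H (n - (i + j)) ((shift a b ^^ i) ((shift c d ^^ j) F))" if "i + j \<le> n" for i j
    using that F by (intro jet_shift_power) auto
  show ?thesis
    unfolding jet_def
  proof (intro conjI allI impI ballI)
    fix i j assume "i + j \<le> n"
    then show "continuous_on (closure H) ((shift a b ^^ i) ((shift c d ^^ j) F) 0 0)"
      using G by (intro jet_continuous) auto
  next
    fix i j z assume ij: "i + j < n" and z: "z \<in> H"
    let ?G = "(shift a b ^^ i) ((shift c d ^^ j) F)"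
    have "(?G 0 0 has_derivative (\<lambda>h. p h * ?G (Suc 0) 0 z + q h * ?G 0 (Suc 0) z)) (at z)"
      using ij z G[of i j] by (intro jet_has_derivative) auto
    then show "(?G 0 0 has_derivative (\<lambda>h. p' h * (shift a b ^^ Suc i) ((shift c d ^^ j) F) 0 0 z
        + q' h * (shift a b ^^ i) ((shift c d ^^ Suc j) F) 0 0 z)) (at z)"
      by (rule has_derivative_eq_rhs)
        (simp add: shift_power_commute[symmetric] basis fun_eq_iff, simp add: shift_def)
  qed
qed

text \<open>For the operators (D1 - i D2)/2 and (D1 + i D2)/2 the factor |a| + |b| is 1, so passing
  from real to Wirtinger derivatives loses nothing.\<close>

lemma shift_power_bound:
  assumes "\<And>i j. i + j \<le> n \<Longrightarrow> cmod (F i j z) \<le> M" "i + j + k \<le> n"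
  shows "cmod ((shift a b ^^ k) F i j z) \<le> (cmod a + cmod b) ^ k * M"
  using assms(2)
proof (induction k arbitrary: i j)
  case (Suc k)
  have "cmod ((shift a b ^^ Suc k) F i j z) \<le> cmod a * cmod ((shift a b ^^ k) F (Suc i) j z) + cmod b * cmod ((shift a b ^^ k) F i (Suc j) z)"
    by (simp add: shift_def norm_triangle_le norm_mult)
  also have "\<dots> \<le> cmod a * ((cmod a + cmod b) ^ k * M) + cmod b * ((cmod a + cmod b) ^ k * M)"
    using Suc by (intro add_mono mult_left_mono) auto
  finally show ?case by (simp add: algebra_simps)
qed (use assms(1) in simp)

abbreviation dirs :: "complex list \<Rightarrow> (nat \<Rightarrow> nat \<Rightarrow> complex \<Rightarrow> complex) \<Rightarrow> nat \<Rightarrow> nat \<Rightarrow> complex \<Rightarrow> complex" where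
  "dirs es W \<equiv> foldr (\<lambda>e. shift e (cnj e)) es W"

text \<open>Here each direction costs |e| + |cnj e| = 2. The return from Wirtinger to real
  derivatives is the source of the factors 2^m below.\<close>

lemma dirs_bound:
  assumes "\<And>i j. i + j \<le> n \<Longrightarrow> cmod (F i j z) \<le> M" "i + j + length es \<le> n" "set es \<subseteq> {1, \<i>}"
  shows "cmod (dirs es F i j z) \<le> 2 ^ length es * M"
  using assms(2,3)
proof (induction es arbitrary: i j)
  case (Cons e es)
  have e: "cmod e = 1" using Cons.prems by auto
  have "cmod (dirs (e # es) F i j z) \<le> cmod e * cmod (dirs es F (Suc i) j z) + cmod (cnj e) * cmod (dirs es F i (Suc j) z)"
    by (simp add: shift_def norm_triangle_le norm_mult)
  also have "\<dots> \<le> 1 * (2 ^ length es * M) + 1 * (2 ^ length es * M)"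
    using Cons e by (intro add_mono mult_mono) auto
  finally show ?case by (simp add: algebra_simps)
qed (use assms(1) in simp)

lemma jet_dirs: "jet p q H (n + length es) F \<Longrightarrow> jet p q H n (dirs es F)"
proof (induction es arbitrary: n)
  case (Cons e es)
  then show ?case using Cons.IH[of "Suc n"] by (simp add: jet_shift)
qed simp

lemma dirs_add: "dirs es (\<lambda>i j z. F i j z + G i j z) = (\<lambda>i j z. dirs es F i j z + dirs es G i j z)"
  by (induction es) (simp_all add: shift_def algebra_simps)

lemma dirs_cmult: "dirs es (\<lambda>i j z. c * F i j z) = (\<lambda>i j z. c * dirs es F i j z)"
  by (induction es) (simp_all add: shift_def algebra_simps)

section \<open>Real partial derivatives computed from a jet\<close>

lemma has_derivative_imp_pdir:
  assumes H: "open H" "z \<in> H" and eq: "\<And>w. w \<in> H \<Longrightarrow> f w = g w" and g: "(g has_derivative D) (at z)"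
  shows "((\<lambda>t::real. f (z + of_real t * e)) has_vector_derivative D e) (at 0)" "pdir e f z = D e"
proof -
  have f: "(f has_derivative D) (at z)"
    using has_derivative_transform_within_open[OF g H(1,2)] eq by simp
  have "((\<lambda>t::real. z + of_real t * e) has_derivative (\<lambda>t. of_real t * e)) (at 0)"
    by (auto intro!: derivative_eq_intros)
  then have "((\<lambda>t::real. f (z + of_real t * e)) has_derivative (\<lambda>t. D (of_real t * e))) (at 0)"
    using has_derivative_compose[of "\<lambda>t::real. z + of_real t * e" _ 0 UNIV f D] f by simp
  moreover have "D (of_real t * e) = t *\<^sub>R D e" for t
    using bounded_linear.linear[OF has_derivative_bounded_linear[OF f]]
    by (metis linear_cmul scaleR_conv_of_real)
  ultimately show "((\<lambda>t::real. f (z + of_real t * e)) has_vector_derivative D e) (at 0)"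
    unfolding has_vector_derivative_def by simp
  then show "pdir e f z = D e" unfolding pdir_def by (rule vector_derivative_at)
qed

lemma Dlist_jet:
  assumes H: "open H" and W: "wirtinger_jet H n W" and f: "\<And>z. z \<in> H \<Longrightarrow> W 0 0 z = f z"
    and z: "z \<in> H" and len: "length es \<le> n"
  shows "Dlist es f z = dirs es W 0 0 z"
  using len z
proof (induction es arbitrary: z)
  case (Cons e es)
  have "wirtinger_jet H (Suc 0) (dirs es W)"
    using Cons.prems by (intro jet_dirs jet_mono[OF W]) simp
  note D = jet_has_derivative[OF this, of 0 0 z]
  have "pdir e (Dlist es f) z = e * dirs es W (Suc 0) 0 z + cnj e * dirs es W 0 (Suc 0) z"
    using Cons.prems by (intro has_derivative_imp_pdir(2)[OF H _ _ D] Cons.IH) auto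
  then show ?case by (simp add: shift_def[of e "cnj e" "dirs es W"])
qed (use f in simp)

lemma Dlist_differentiable:
  assumes H: "open H" and W: "wirtinger_jet H n W" and f: "\<And>z. z \<in> H \<Longrightarrow> W 0 0 z = f z"
    and z: "z \<in> H" and len: "length es < n"
  shows "(\<lambda>t::real. Dlist es f (z + of_real t * e)) differentiable (at 0)"
proof -
  have "wirtinger_jet H (Suc 0) (dirs es W)"
    using len by (intro jet_dirs jet_mono[OF W]) simp
  note D = jet_has_derivative[OF this, of 0 0 z]
  have "((\<lambda>t::real. Dlist es f (z + of_real t * e)) has_vector_derivative
     (e * dirs es W (Suc 0) 0 z + cnj e * dirs es W 0 (Suc 0) z)) (at 0)"
    using z len by (intro has_derivative_imp_pdir(1)[OF H _ _ D] Dlist_jet[OF H W f]) auto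
  then show ?thesis by (rule differentiableI_vector)
qed

lemma Dmi_eq_Dlist: "Dmi (a, b) f = Dlist (replicate a 1 @ replicate b \<i>) f"
proof -
  have "Dlist (replicate a e @ es) f = (pdir e ^^ a) (Dlist es f)" for a e es
    by (induction a) simp_all
  from this[of a 1 "replicate b \<i>"] this[of b \<i> "[]"] show ?thesis
    by (simp add: Dmi_def)
qed

lemma Dmi_jet:
  assumes H: "open H" and W: "wirtinger_jet H m W" and f: "\<And>z. z \<in> H \<Longrightarrow> W 0 0 z = f z"
    and z: "z \<in> H" and ab: "a + b \<le> m"
  shows "Dmi (a, b) f z = dirs (replicate a 1 @ replicate b \<i>) W 0 0 z"
  using ab by (subst Dmi_eq_Dlist, intro Dlist_jet[OF H W f z]) auto

text \<open>Reduces membership to writing down Wirtinger derivatives: the table settles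
  differentiability, continuity and continuous extension at once.\<close>

lemma CmSpaceI:
  assumes H: "open H" and W: "wirtinger_jet H m W"
    and f: "\<And>z. z \<in> closure H \<Longrightarrow> f z = W 0 0 z" "\<And>z. z \<notin> closure H \<Longrightarrow> f z = 0"
  shows "f \<in> CmSpace H m"
  unfolding CmSpace_def mem_Collect_eq
proof (intro conjI allI impI)
  have f': "W 0 0 z = f z" if "z \<in> H" for z using f(1)[of z] that closure_subset[of H] by auto
  have cont: "continuous_on (closure H) (dirs es W 0 0)" if "length es \<le> m" for es
  proof -
    have "wirtinger_jet H 0 (dirs es W)"
      using that by (intro jet_dirs jet_mono[OF W]) simp
    then show ?thesis by (rule jet_continuous) simp
  qed
  show "Cm_on m H f"
    unfolding Cm_on_def
  proof (intro conjI allI impI ballI)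
    fix es assume es: "set es \<subseteq> {1, \<i>} \<and> length es \<le> m"
    have "continuous_on H (dirs es W 0 0)"
      by (rule continuous_on_subset[OF cont]) (use es closure_subset in auto)
    then show "continuous_on H (Dlist es f)"
      by (rule continuous_on_cong[THEN iffD1, rotated 2]) (use es in \<open>auto simp: Dlist_jet[OF H W f']\<close>)
  qed (auto intro!: Dlist_differentiable[OF H W f'])
  fix \<beta> :: "nat \<times> nat" assume \<beta>: "fst \<beta> + snd \<beta> \<le> m"
  show "\<exists>g. continuous_on (closure H) g \<and> (\<forall>z\<in>H. g z = Dmi \<beta> f z)"
    using \<beta> Dmi_jet[OF H W f', of _ "fst \<beta>" "snd \<beta>"]
    by (intro exI[of _ "dirs (replicate (fst \<beta>) 1 @ replicate (snd \<beta>) \<i>) W 0 0"] conjI cont) auto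
next
  show "continuous_on (closure H) f"
    by (rule continuous_on_cong[THEN iffD1, OF refl _ jet_continuous[OF W, of 0 0]]) (use f in auto)
qed (use f in auto)

section \<open>Mixed partial derivatives and their order\<close>

lemma pdir_cong:
  assumes "open H" "z \<in> H" "\<And>w. w \<in> H \<Longrightarrow> f w = g w"
  shows "pdir e f z = pdir e g z"
  unfolding pdir_def
proof (rule vector_derivative_cong_eq)
  have "((\<lambda>t::real. z + of_real t * e) \<longlongrightarrow> z + of_real 0 * e) (nhds 0)"
    by (intro tendsto_intros filterlim_ident)
  then have "eventually (\<lambda>t::real. z + of_real t * e \<in> H) (nhds 0)"
    using assms(1,2) by (simp add: topological_tendstoD)
  then show "\<forall>\<^sub>F t in nhds 0. t \<in> UNIV \<longrightarrow> f (z + of_real t * e) = g (z + of_real t * e)"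
    by (rule eventually_mono) (use assms(3) in auto)
qed auto

lemma Dlist_swap:
  assumes H: "open H" and f: "Cm_on m H f" and z: "z \<in> H" and len: "length es + 2 \<le> m"
    and es: "set es \<subseteq> {1, \<i>}" and e: "e \<in> {1, \<i>}" "e' \<in> {1, \<i>}"
  shows "Dlist (e # e' # es) f z = Dlist (e' # e # es) f z"
proof -
  have d: "(\<lambda>t::real. Dlist es f (z + of_real t * e)) differentiable (at 0)"
    if "z \<in> H" "e \<in> {1, \<i>}" "set es \<subseteq> {1, \<i>}" "length es < m" for z e es
    using f that unfolding Cm_on_def by blast
  have c: "continuous_on H (Dlist es f)" if "set es \<subseteq> {1, \<i>}" "length es \<le> m" for es
    using f that unfolding Cm_on_def by blast
  have "pdir e (pdir e' (Dlist es f)) z = pdir e' (pdir e (Dlist es f)) z"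
  proof (rule pdir_commute[OF H z])
    fix w assume w: "w \<in> H"
    show "(\<lambda>t::real. Dlist es f (w + of_real t * e)) differentiable (at 0)"
      "(\<lambda>t::real. Dlist es f (w + of_real t * e')) differentiable (at 0)"
      using d[OF w _ es] e len by auto
    show "(\<lambda>t::real. pdir e' (Dlist es f) (w + of_real t * e)) differentiable (at 0)"
      using d[OF w e(1), of "e' # es"] es e len by simp
    show "(\<lambda>t::real. pdir e (Dlist es f) (w + of_real t * e')) differentiable (at 0)"
      using d[OF w e(2), of "e # es"] es e len by simp
  next
    show "continuous_on H (pdir e (pdir e' (Dlist es f)))" "continuous_on H (pdir e' (pdir e (Dlist es f)))"
      using c[of "e # e' # es"] c[of "e' # e # es"] es e len by simp_all
  qed (use e in auto)
  then show ?thesis by simp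
qed

text \<open>\<open>Dmi\<close> keeps all derivatives along 1 outermost. A further derivative along
  \<i> is brought to its place by adjacent transpositions through the block of 1s.\<close>

lemma Dlist_move:
  assumes H: "open H" and f: "Cm_on m H f" and z: "z \<in> H" and len: "i + length es < m"
    and es: "set es \<subseteq> {1, \<i>}"
  shows "Dlist (\<i> # replicate i 1 @ es) f z = Dlist (replicate i 1 @ \<i> # es) f z"
  using len z
proof (induction i arbitrary: z)
  case (Suc i)
  have "Dlist (\<i> # 1 # replicate i 1 @ es) f z = Dlist (1 # \<i> # replicate i 1 @ es) f z"
    using Suc.prems es by (intro Dlist_swap[OF H f]) auto
  also have "\<dots> = pdir 1 (Dlist (\<i> # replicate i 1 @ es) f) z" by simp
  also have "\<dots> = pdir 1 (Dlist (replicate i 1 @ \<i> # es) f) z"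
    using Suc by (intro pdir_cong[OF H]) auto
  finally show ?case by simp
qed simp

lemma Dmi_has_derivative:
  assumes H: "open H" and f: "Cm_on m H f" and z: "z \<in> H" and ij: "i + j < m"
  shows "(Dmi (i, j) f has_derivative (\<lambda>h. of_real (Re h) * Dmi (Suc i, j) f z + of_real (Im h) * Dmi (i, Suc j) f z)) (at z)"
proof -
  let ?u = "Dlist (replicate i 1 @ replicate j \<i>) f"
  have c: "continuous_on H (Dlist es f)" if "set es \<subseteq> {1, \<i>}" "length es \<le> m" for es
    using f that unfolding Cm_on_def by blast
  have "(?u has_derivative (\<lambda>h. of_real (Re h) * pdir 1 ?u z + of_real (Im h) * pdir \<i> ?u z)) (at z)"
  proof (rule continuous_partials_has_derivative[OF H z])
    have d: "(\<lambda>t::real. Dlist es f (z + of_real t * e)) differentiable (at 0)"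
      if "z \<in> H" "e \<in> {1, \<i>}" "set es \<subseteq> {1, \<i>}" "length es < m" for z e es
      using f that unfolding Cm_on_def by blast
    fix z e assume "z \<in> H" "e \<in> {1, \<i>}"
    then show "(\<lambda>t::real. ?u (z + of_real t * e)) differentiable (at 0)"
      using ij by (intro d) (auto dest: in_set_replicate[THEN iffD1])
  next
    fix e :: complex assume "e \<in> {1, \<i>}"
    then show "continuous_on H (pdir e ?u)"
      using c[of "e # replicate i 1 @ replicate j \<i>"] ij by (auto simp: set_replicate_conv_if split: if_splits)
  qed
  moreover have "pdir \<i> ?u z = Dmi (i, Suc j) f z"
    using Dlist_move[OF H f z, of i "replicate j \<i>"] ij by (auto simp: Dmi_eq_Dlist set_replicate_conv_if split: if_splits)
  ultimately show ?thesis by (simp add: Dmi_eq_Dlist)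
qed

section \<open>Comparison of the norm with bounds on jets\<close>

lemma Cm_norm_bdd:
  assumes "bounded H" "f \<in> CmSpace H m"
  shows "bdd_above ((\<lambda>p. cmod (Dmi (fst p) f (snd p))) ` {(\<beta>, z). fst \<beta> + snd \<beta> \<le> m \<and> z \<in> H})"
proof -
  have "\<exists>M. \<forall>z\<in>H. cmod (Dmi \<beta> f z) \<le> M" if \<beta>: "fst \<beta> + snd \<beta> \<le> m" for \<beta>
  proof -
    obtain g where g: "continuous_on (closure H) g" "\<forall>z\<in>H. g z = Dmi \<beta> f z"
      using assms(2) \<beta> unfolding CmSpace_def by blast
    have "compact (g ` closure H)"
      using assms(1) g(1) by (intro compact_continuous_image) auto
    then obtain M where "\<forall>x \<in> g ` closure H. norm x \<le> M"
      using compact_imp_bounded bounded_iff by meson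
    then show ?thesis using g(2) closure_subset by (metis imageI subsetD)
  qed
  then obtain M where M: "\<And>\<beta> z. fst \<beta> + snd \<beta> \<le> m \<Longrightarrow> z \<in> H \<Longrightarrow> cmod (Dmi \<beta> f z) \<le> M \<beta>"
    by metis
  have fin: "finite {\<beta> :: nat \<times> nat. fst \<beta> + snd \<beta> \<le> m}"
    by (rule finite_subset[of _ "{..m} \<times> {..m}"]) auto
  show ?thesis
  proof (rule bdd_aboveI)
    fix x assume "x \<in> (\<lambda>p. cmod (Dmi (fst p) f (snd p))) ` {(\<beta>, z). fst \<beta> + snd \<beta> \<le> m \<and> z \<in> H}"
    then obtain \<beta> z where "fst \<beta> + snd \<beta> \<le> m" "z \<in> H" "x = cmod (Dmi \<beta> f z)" by auto
    moreover have "M \<beta> \<le> Max (M ` {\<beta> :: nat \<times> nat. fst \<beta> + snd \<beta> \<le> m})"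
      using fin calculation by (intro Max_ge) auto
    ultimately show "x \<le> Max (M ` {\<beta> :: nat \<times> nat. fst \<beta> + snd \<beta> \<le> m})"
      using M by force
  qed
qed

lemma cmod_Dmi_le_Cm_norm:
  assumes "bounded H" "f \<in> CmSpace H m" "a + b \<le> m" "z \<in> H"
  shows "cmod (Dmi (a, b) f z) \<le> Cm_norm H m f"
  unfolding Cm_norm_def
  using cSUP_upper[OF _ Cm_norm_bdd[OF assms(1,2)], of "((a, b), z)"] assms(3,4) by simp

lemma Cm_norm_least:
  assumes "H \<noteq> {}" "\<And>a b z. a + b \<le> m \<Longrightarrow> z \<in> H \<Longrightarrow> cmod (Dmi (a, b) f z) \<le> M"
  shows "Cm_norm H m f \<le> M"
  unfolding Cm_norm_def
proof (rule cSUP_least)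
  obtain z where "z \<in> H" using assms(1) by blast
  then have "((0, 0), z) \<in> {(\<beta>, z). fst \<beta> + snd \<beta> \<le> m \<and> z \<in> H}" by simp
  then show "{(\<beta>, z). fst \<beta> + snd \<beta> \<le> m \<and> z \<in> H} \<noteq> {}" by blast
qed (use assms(2) in auto)

text \<open>The converse of \<open>CmSpaceI\<close>. The continuous extensions of the real partial
  derivatives form a real jet, because mixed derivatives commute; a change of frame makes it a
  Wirtinger jet whose entries obey the same bound.\<close>

lemma CmSpace_jet:
  assumes H: "open H" "bounded H" and f: "f \<in> CmSpace H m"
  shows "\<exists>W. wirtinger_jet H m W \<and> (\<forall>z\<in>closure H. W 0 0 z = f z) \<and>
    (\<forall>i j z. i + j \<le> m \<longrightarrow> z \<in> closure H \<longrightarrow> cmod (W i j z) \<le> Cm_norm H m f)"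
proof -
  have Cm: "Cm_on m H f" using f by (simp add: CmSpace_def)
  have "\<exists>g. a + b \<le> m \<longrightarrow> continuous_on (closure H) g \<and> (\<forall>z\<in>H. g z = Dmi (a, b) f z)" for a b
    using f unfolding CmSpace_def by auto
  then obtain G where G: "\<And>a b. a + b \<le> m \<Longrightarrow> continuous_on (closure H) (G a b)"
    "\<And>a b z. a + b \<le> m \<Longrightarrow> z \<in> H \<Longrightarrow> G a b z = Dmi (a, b) f z"
    by metis
  have "real_jet H m G"
    unfolding jet_def
  proof (intro conjI allI impI ballI G)
    fix i j z assume ij: "i + j < m" and z: "z \<in> H"
    have "(G i j has_derivative (\<lambda>h. of_real (Re h) * Dmi (Suc i, j) f z + of_real (Im h) * Dmi (i, Suc j) f z)) (at z)"
      using G(2) ij by (intro has_derivative_transform_within_open[OF Dmi_has_derivative[OF H(1) Cm z ij] H(1) z]) simp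
    then show "(G i j has_derivative (\<lambda>h. of_real (Re h) * G (Suc i) j z + of_real (Im h) * G i (Suc j) z)) (at z)"
      using G(2) ij z by simp
  qed
  \<comment> \<open>The coefficients are those of (D1 - i D2)/2 and (D1 + i D2)/2.\<close>
  then have jet: "wirtinger_jet H m (\<lambda>i j. (shift (1 / 2) (- \<i> / 2) ^^ i) ((shift (1 / 2) (\<i> / 2) ^^ j) G) 0 0)"
    by (rule jet_basis_change) (auto simp: complex_eq_iff field_simps)
  have bd: "cmod (G a b z) \<le> Cm_norm H m f" if "a + b \<le> m" "z \<in> closure H" for a b z
    by (rule continuous_on_closure_norm_le[OF G(1)[OF that(1)] _ that(2)])
      (use G(2) cmod_Dmi_le_Cm_norm[OF H(2) f] that in auto)
  have bd1: "cmod ((shift (1 / 2) (\<i> / 2) ^^ k) G a b z) \<le> Cm_norm H m f"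
    if "a + b + k \<le> m" "z \<in> closure H" for a b k z
    using shift_power_bound[of m G z "Cm_norm H m f" a b k "1 / 2" "\<i> / 2"] bd that by (simp add: norm_divide)
  have eq: "G 0 0 z - f z = 0" if "z \<in> closure H" for z
  proof -
    have "cmod (G 0 0 z - f z) \<le> 0"
    proof (rule continuous_on_closure_norm_le[OF _ _ that])
      show "continuous_on (closure H) (\<lambda>z. G 0 0 z - f z)"
        using f by (intro continuous_intros G) (auto simp: CmSpace_def)
    qed (use G(2)[of 0 0] in \<open>auto simp: Dmi_def\<close>)
    then show ?thesis by simp
  qed
  show ?thesis
  proof (rule exI, intro conjI allI impI ballI, rule jet)
    fix i j :: nat and z assume "i + j \<le> m" "z \<in> closure H"
    then show "cmod ((shift (1 / 2) (- \<i> / 2) ^^ i) ((shift (1 / 2) (\<i> / 2) ^^ j) G) 0 0 z) \<le> Cm_norm H m f"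
      using shift_power_bound[of "m - j" "(shift (1 / 2) (\<i> / 2) ^^ j) G" z "Cm_norm H m f" 0 0 i "1 / 2" "- \<i> / 2"] bd1
      by (simp add: norm_divide)
  qed (use eq in auto)
qed

lemma Cm_norm_le_jet:
  assumes H: "open H" "H \<noteq> {}" and W: "wirtinger_jet H m W" and f: "\<And>z. z \<in> H \<Longrightarrow> W 0 0 z = f z"
    and M: "\<And>i j z. i + j \<le> m \<Longrightarrow> z \<in> H \<Longrightarrow> cmod (W i j z) \<le> M"
  shows "Cm_norm H m f \<le> 2 ^ m * M"
proof (rule Cm_norm_least[OF H(2)])
  fix a b z assume ab: "a + b \<le> m" and z: "z \<in> H"
  have "cmod (Dmi (a, b) f z) \<le> 2 ^ length (replicate a (1::complex) @ replicate b \<i>) * M"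
  proof -
    have "Dmi (a, b) f z = dirs (replicate a 1 @ replicate b \<i>) W 0 0 z"
      by (rule Dmi_jet[OF H(1) W]) (use f z ab in auto)
    then show ?thesis
      using dirs_bound[of "a + b" W z M 0 0 "replicate a 1 @ replicate b \<i>"] M ab z
      by (auto simp: set_replicate_conv_if)
  qed
  also have "\<dots> \<le> 2 ^ m * M"
    using ab order_trans[OF norm_ge_zero M[of 0 0, OF _ z]] by (intro mult_right_mono) auto
  finally show "cmod (Dmi (a, b) f z) \<le> 2 ^ m * M" .
qed

text \<open>By induction on the total order: the map h \<mapsto> a h + b cnj h determines a and b
  through its values at 1 and \<i>.\<close>

lemma jet_unique:
  assumes H: "open H" and W: "wirtinger_jet H m W" and V: "wirtinger_jet H m V"
    and eq: "\<And>z. z \<in> H \<Longrightarrow> W 0 0 z = V 0 0 z" and ij: "i + j \<le> m" and z: "z \<in> H"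
  shows "W i j z = V i j z"
  using ij z
proof (induction "i + j" arbitrary: i j z)
  case (Suc n)
  have step: "W (Suc a) b z = V (Suc a) b z \<and> W a (Suc b) z = V a (Suc b) z" if ab: "a + b = n" for a b
  proof -
    have lt: "a + b < m" using ab Suc by simp
    have "(W a b has_derivative (\<lambda>h. h * V (Suc a) b z + cnj h * V a (Suc b) z)) (at z)"
      by (rule has_derivative_transform_within_open[OF jet_has_derivative[OF V lt Suc.prems(2)] H Suc.prems(2)])
        (use Suc.hyps(1)[of a b] ab lt in auto)
    then have *: "(\<lambda>h. h * V (Suc a) b z + cnj h * V a (Suc b) z) = (\<lambda>h. h * W (Suc a) b z + cnj h * W a (Suc b) z)"
      using jet_has_derivative[OF W lt Suc.prems(2)] by (rule has_derivative_unique)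
    from fun_cong[OF *, of 1] fun_cong[OF *, of \<i>] show ?thesis
      by (auto simp: complex_eq_iff)
  qed
  show ?case
  proof (cases i)
    case 0
    then show ?thesis using step[of 0 n] Suc.hyps(2) by auto
  next
    case (Suc i')
    then show ?thesis using step[of i' j] Suc.hyps(2) by auto
  qed
qed (use eq in auto)

section \<open>Normed spaces of functions, compact operators and spectral radii\<close>

lemma root_tendsto_of_bounds:
  fixes a :: "nat \<Rightarrow> real"
  assumes C: "C > 0" and \<rho>: "\<rho> \<ge> 0"
  shows "(\<lambda>n. root n (C * \<rho> ^ n)) \<longlonglongrightarrow> \<rho>"
proof -
  have "(\<lambda>n. root n C * \<rho>) \<longlonglongrightarrow> 1 * \<rho>"
    by (intro tendsto_intros LIMSEQ_root_const C)
  moreover have "\<forall>\<^sub>F n in sequentially. root n C * \<rho> = root n (C * \<rho> ^ n)"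
    using eventually_gt_at_top[of 0] by eventually_elim (simp add: real_root_mult real_root_power_cancel \<rho>)
  ultimately show ?thesis using tendsto_cong by force
qed

text \<open>Fekete's argument: the limit is the infimum of the roots. \<open>ess_spec_rad\<close> is
  given by \<open>lim\<close>, which has a meaning only once convergence is known.\<close>

lemma submultiplicative_root_convergent:
  fixes a :: "nat \<Rightarrow> real"
  assumes nonneg: "\<And>n. a n \<ge> 0" and sub: "\<And>i j. i \<ge> 1 \<Longrightarrow> j \<ge> 1 \<Longrightarrow> a (i + j) \<le> a i * a j"
  shows "convergent (\<lambda>n. root n (a n))"
proof -
  define L where "L = (INF k\<in>{1..}. root k (a k))"
  have bdd: "bdd_below ((\<lambda>k. root k (a k)) ` {1..})"
    by (rule bdd_belowI[of _ 0]) (auto simp: nonneg)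
  have L0: "L \<ge> 0" unfolding L_def by (rule cINF_greatest) (auto simp: nonneg)
  have "(\<lambda>n. root n (a n)) \<longlonglongrightarrow> L"
  proof (rule order_tendstoI)
    fix y assume "y < L"
    moreover have "\<forall>\<^sub>F n in sequentially. L \<le> root n (a n)"
      using eventually_ge_at_top[of 1] unfolding L_def by eventually_elim (rule cINF_lower[OF bdd], simp)
    ultimately show "\<forall>\<^sub>F n in sequentially. y < root n (a n)" by (auto elim: eventually_mono)
  next
    fix y assume y: "L < y"
    define \<rho> where "\<rho> = (L + y) / 2"
    have \<rho>: "L < \<rho>" "\<rho> < y" "\<rho> > 0" using y L0 by (auto simp: \<rho>_def)
    \<comment> \<open>One index K with root below \<rho> controls every n: splitting off K
      repeatedly leaves an index of at most K, which the constant M covers.\<close>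
    obtain K where K: "K \<ge> 1" "root K (a K) < \<rho>"
      using cINF_less_iff[THEN iffD1, OF _ bdd, of \<rho>] \<rho> unfolding L_def by auto
    have "root K (a K) ^ K \<le> \<rho> ^ K" using K nonneg by (intro power_mono) auto
    then have aK: "a K \<le> \<rho> ^ K" using K nonneg[of K] by (simp add: real_root_pow_pos2)
    define M where "M = Max ((\<lambda>j. a j / \<rho> ^ j) ` {1..K})"
    have M: "a j \<le> M * \<rho> ^ j" if "1 \<le> j" "j \<le> K" for j
    proof -
      have "a j / \<rho> ^ j \<le> M" unfolding M_def using that by (intro Max_ge) auto
      then show ?thesis using \<rho> by (simp add: pos_divide_le_eq)
    qed
    have bound: "a n \<le> M * \<rho> ^ n" if "n \<ge> 1" for n
      using that
    proof (induction n rule: less_induct)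
      case (less n)
      show ?case
      proof (cases "n \<le> K")
        case False
        have "a (K + (n - K)) \<le> a K * a (n - K)" using False K(1) by (intro sub) auto
        also have "\<dots> \<le> \<rho> ^ K * (M * \<rho> ^ (n - K))"
          using less.IH[of "n - K"] False K aK nonneg \<rho> by (intro mult_mono) auto
        also have "\<dots> = M * \<rho> ^ (K + (n - K))" by (simp add: power_add)
        finally show ?thesis using False by simp
      qed (use M less.prems in auto)
    qed
    have M0: "M \<ge> 0" using bound[of 1] nonneg[of 1] \<rho>
      by (metis le_refl mult_less_0_iff not_le order_trans power_one_right)
    \<comment> \<open>M may vanish, but the constant under the root has to be positive, hence M +
      1.\<close>
    have "\<forall>\<^sub>F n in sequentially. root n ((M + 1) * \<rho> ^ n) < y"
      using root_tendsto_of_bounds[of "M + 1" \<rho>] M0 \<rho> by (intro order_tendstoD) auto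
    then show "\<forall>\<^sub>F n in sequentially. root n (a n) < y"
      using eventually_ge_at_top[of 1]
    proof eventually_elim
      case (elim n)
      have "a n \<le> (M + 1) * \<rho> ^ n" using bound[OF elim(2)] \<rho> by (simp add: distrib_right add_increasing2)
      then have "root n (a n) \<le> root n ((M + 1) * \<rho> ^ n)" using elim by simp
      also note elim(1)
      finally show ?case .
    qed
  qed
  then show ?thesis by (rule convergentI)
qed

text \<open>The spaces are carriers inside one function type, so the norm laws are relativised to
  S.\<close>

locale function_normed_space =
  fixes S :: "(complex \<Rightarrow> complex) set" and N :: "(complex \<Rightarrow> complex) \<Rightarrow> real"
  assumes zero_mem: "(\<lambda>z. 0) \<in> S"
    and add_mem: "\<And>f g. f \<in> S \<Longrightarrow> g \<in> S \<Longrightarrow> (\<lambda>z. f z + g z) \<in> S"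
    and cmult_mem: "\<And>f c. f \<in> S \<Longrightarrow> (\<lambda>z. c * f z) \<in> S"
    and norm_add: "\<And>f g. f \<in> S \<Longrightarrow> g \<in> S \<Longrightarrow> N (\<lambda>z. f z + g z) \<le> N f + N g"
    and norm_cmult: "\<And>f c. f \<in> S \<Longrightarrow> N (\<lambda>z. c * f z) = cmod c * N f"
begin

lemma diff_mem: "f \<in> S \<Longrightarrow> g \<in> S \<Longrightarrow> (\<lambda>z. f z - g z) \<in> S"
  using add_mem[of f "\<lambda>z. (-1) * g z"] cmult_mem[of g "-1"] by simp

lemma norm_zero: "N (\<lambda>z. 0) = 0"
  using norm_cmult[OF zero_mem, of 0] by simp

lemma norm_diff: "f \<in> S \<Longrightarrow> g \<in> S \<Longrightarrow> N (\<lambda>z. f z - g z) \<le> N f + N g"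
  using norm_add[of f "\<lambda>z. (-1) * g z"] cmult_mem[of g "-1"] norm_cmult[of g "-1"] by simp

lemma norm_nonneg: "f \<in> S \<Longrightarrow> N f \<ge> 0"
  using norm_diff[of f f] norm_zero by simp

lemma bounded_opD:
  assumes "bounded_op S N T"
  shows "f \<in> S \<Longrightarrow> T f \<in> S" "f \<in> S \<Longrightarrow> g \<in> S \<Longrightarrow> T (\<lambda>z. f z + g z) = (\<lambda>z. T f z + T g z)"
    "f \<in> S \<Longrightarrow> T (\<lambda>z. c * f z) = (\<lambda>z. c * T f z)"
    "\<exists>C\<ge>0. \<forall>f\<in>S. N (T f) \<le> C * N f"
proof -
  obtain C where C: "\<And>f. f \<in> S \<Longrightarrow> N (T f) \<le> C * N f" using assms unfolding bounded_op_def by blast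
  have "N (T f) \<le> \<bar>C\<bar> * N f" if "f \<in> S" for f
    using C[OF that] mult_right_mono[OF abs_ge_self norm_nonneg[OF that], of C] by simp
  then show "\<exists>C\<ge>0. \<forall>f\<in>S. N (T f) \<le> C * N f" by (intro exI[of _ "\<bar>C\<bar>"]) auto
qed (use assms in \<open>auto simp: bounded_op_def\<close>)

lemma bounded_op_diff:
  assumes "bounded_op S N T" "f \<in> S" "g \<in> S"
  shows "T (\<lambda>z. f z - g z) = (\<lambda>z. T f z - T g z)"
  using bounded_opD(2)[OF assms(1,2) cmult_mem[OF assms(3)], of "-1"] bounded_opD(3)[OF assms(1,3), of "-1"] by simp

lemma bounded_op_zero: "bounded_op S N T \<Longrightarrow> T (\<lambda>z. 0) = (\<lambda>z. 0)"
  using bounded_opD(3)[OF _ zero_mem, of T 0] by simp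

lemma bounded_opI:
  assumes "\<And>f. f \<in> S \<Longrightarrow> T f \<in> S" "\<And>f g. f \<in> S \<Longrightarrow> g \<in> S \<Longrightarrow> T (\<lambda>z. f z + g z) = (\<lambda>z. T f z + T g z)"
    "\<And>f c. f \<in> S \<Longrightarrow> T (\<lambda>z. c * f z) = (\<lambda>z. c * T f z)" "\<And>f. f \<in> S \<Longrightarrow> N (T f) \<le> C * N f"
  shows "bounded_op S N T"
  using assms unfolding bounded_op_def by blast

text \<open>Scaling to norm 1. Definiteness is not among the axioms of this locale, so a function of
  norm 0 is handled by the bound on T instead.\<close>

lemma op_norm_bound:
  assumes T: "bounded_op S N T" and f: "f \<in> S"
  shows "N (T f) \<le> op_norm S N T * N f"
proof -
  obtain C where C: "C \<ge> 0" "\<And>f. f \<in> S \<Longrightarrow> N (T f) \<le> C * N f" using bounded_opD(4)[OF T] by blast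
  have bdd: "bdd_above ((\<lambda>f. N (T f)) ` {f\<in>S. N f \<le> 1})"
  proof (rule bdd_aboveI)
    fix x assume "x \<in> (\<lambda>f. N (T f)) ` {f\<in>S. N f \<le> 1}"
    then obtain g where g: "g \<in> S" "N g \<le> 1" "x = N (T g)" by auto
    then show "x \<le> C" using C(2)[OF g(1)] mult_left_mono[OF g(2) C(1)] by simp
  qed
  show ?thesis
  proof (cases "N f = 0")
    case True
    then show ?thesis using C(2)[OF f] by simp
  next
    case False
    then have pos: "N f > 0" using norm_nonneg[OF f] by simp
    let ?g = "\<lambda>z. of_real (1 / N f) * f z"
    have g: "?g \<in> S" "N ?g \<le> 1" using pos by (simp_all add: norm_cmult[OF f] norm_divide cmult_mem[OF f] del: of_real_divide)
    have "N (T ?g) \<le> op_norm S N T"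
      unfolding op_norm_def using g bdd by (intro cSUP_upper) auto
    moreover have "N (T ?g) = N (T f) / N f"
      using pos by (simp add: bounded_opD(3)[OF T f] norm_cmult[OF bounded_opD(1)[OF T f]] norm_divide del: of_real_divide)
    ultimately show ?thesis using pos by (simp add: pos_divide_le_eq)
  qed
qed

lemma op_norm_le:
  assumes "C \<ge> 0" "\<And>f. f \<in> S \<Longrightarrow> N (T f) \<le> C * N f"
  shows "op_norm S N T \<le> C"
  unfolding op_norm_def
proof (rule cSUP_least)
  show "{f \<in> S. N f \<le> 1} \<noteq> {}" using zero_mem norm_zero by force
  fix f assume "f \<in> {f \<in> S. N f \<le> 1}"
  then show "N (T f) \<le> C" using assms(2)[of f] mult_left_mono[OF _ assms(1), of "N f" 1] by auto
qed

lemma op_norm_nonneg: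
  assumes "bounded_op S N T"
  shows "op_norm S N T \<ge> 0"
proof (rule ccontr)
  assume neg: "\<not> op_norm S N T \<ge> 0"
  have "N (T f) = 0" if "f \<in> S" for f
  proof -
    have "N (T f) \<le> op_norm S N T * N f" by (rule op_norm_bound[OF assms that])
    moreover have "op_norm S N T * N f \<le> 0" using neg norm_nonneg[OF that] by (simp add: mult_nonpos_nonneg)
    ultimately show ?thesis using norm_nonneg[OF bounded_opD(1)[OF assms that]] by simp
  qed
  then have "op_norm S N T = (SUP f \<in> {f\<in>S. N f \<le> 1}. 0)"
    unfolding op_norm_def by (intro SUP_cong) auto
  moreover have "{f\<in>S. N f \<le> 1} \<noteq> {}" using zero_mem norm_zero by force
  ultimately show False using neg by simp
qed

lemma op_norm_cong: "(\<And>f. f \<in> S \<Longrightarrow> T f = U f) \<Longrightarrow> op_norm S N T = op_norm S N U"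
  unfolding op_norm_def by (intro SUP_cong) auto

lemma bounded_op_comp:
  assumes T: "bounded_op S N T" and U: "bounded_op S N U"
  shows "bounded_op S N (\<lambda>f. T (U f))" "op_norm S N (\<lambda>f. T (U f)) \<le> op_norm S N T * op_norm S N U"
proof -
  have b: "N (T (U f)) \<le> op_norm S N T * op_norm S N U * N f" if "f \<in> S" for f
    using order_trans[OF op_norm_bound[OF T bounded_opD(1)[OF U that]] mult_left_mono[OF op_norm_bound[OF U that] op_norm_nonneg[OF T]]]
    by (simp add: mult.assoc)
  then show "bounded_op S N (\<lambda>f. T (U f))"
    by (intro bounded_opI) (auto simp: bounded_opD[OF T] bounded_opD[OF U])
  show "op_norm S N (\<lambda>f. T (U f)) \<le> op_norm S N T * op_norm S N U"
    by (rule op_norm_le[OF _ b]) (simp_all add: op_norm_nonneg T U)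
qed

lemma bounded_op_plus:
  assumes T: "bounded_op S N T" and U: "bounded_op S N U"
  shows "bounded_op S N (\<lambda>f z. T f z + U f z)"
proof (rule bounded_opI)
  fix f assume f: "f \<in> S"
  show "N (\<lambda>z. T f z + U f z) \<le> (op_norm S N T + op_norm S N U) * N f"
    using norm_add[OF bounded_opD(1)[OF T f] bounded_opD(1)[OF U f]] op_norm_bound[OF T f] op_norm_bound[OF U f]
    by (simp add: distrib_right)
qed (auto simp: bounded_opD[OF T] bounded_opD[OF U] algebra_simps intro: add_mem)

lemma bounded_op_minus:
  assumes T: "bounded_op S N T" and U: "bounded_op S N U"
  shows "bounded_op S N (\<lambda>f z. T f z - U f z)"
proof (rule bounded_opI)
  fix f assume f: "f \<in> S"
  show "N (\<lambda>z. T f z - U f z) \<le> (op_norm S N T + op_norm S N U) * N f"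
    using norm_diff[OF bounded_opD(1)[OF T f] bounded_opD(1)[OF U f]] op_norm_bound[OF T f] op_norm_bound[OF U f]
    by (simp add: distrib_right)
qed (auto simp: bounded_opD[OF T] bounded_opD[OF U] algebra_simps intro: diff_mem)

lemma bounded_op_power: "bounded_op S N T \<Longrightarrow> bounded_op S N (T ^^ k)"
proof (induction k)
  case 0
  show ?case by (rule bounded_opI[where C = 1]) auto
next
  case (Suc k)
  then show ?case using bounded_op_comp(1)[of T "T ^^ k"] by (simp add: comp_def)
qed

section \<open>Compact operators\<close>

lemma compact_opD:
  assumes "compact_op S N K" "\<And>n. F n \<in> S" "\<And>n. N (F n) \<le> C"
  obtains \<sigma> :: "nat \<Rightarrow> nat" and g where "strict_mono \<sigma>" "g \<in> S" "(\<lambda>n. N (\<lambda>z. K (F (\<sigma> n)) z - g z)) \<longlonglongrightarrow> 0"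
  using assms unfolding compact_op_def by blast

lemma compact_op_imp_bounded_op: "compact_op S N K \<Longrightarrow> bounded_op S N K"
  by (simp add: compact_op_def)

lemma compact_op_comp_left:
  assumes K: "compact_op S N K" and T: "bounded_op S N T"
  shows "compact_op S N (\<lambda>f. T (K f))"
  unfolding compact_op_def
proof (intro conjI allI impI)
  note bK = compact_op_imp_bounded_op[OF K]
  show "bounded_op S N (\<lambda>f. T (K f))" by (rule bounded_op_comp(1)[OF T bK])
  fix F :: "nat \<Rightarrow> complex \<Rightarrow> complex" and C assume F: "\<forall>n. F n \<in> S \<and> N (F n) \<le> C"
  obtain \<sigma> g where \<sigma>: "strict_mono (\<sigma> :: nat \<Rightarrow> nat)" and g: "g \<in> S"
    and lim: "(\<lambda>n. N (\<lambda>z. K (F (\<sigma> n)) z - g z)) \<longlonglongrightarrow> 0"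
    by (rule compact_opD[OF K, of F C]) (use F in auto)
  have mem: "K (F n) \<in> S" for n using bounded_opD(1)[OF bK] F by blast
  have "(\<lambda>n. N (\<lambda>z. T (K (F (\<sigma> n))) z - T g z)) \<longlonglongrightarrow> 0"
  proof (rule tendsto_sandwich[OF always_eventually always_eventually tendsto_const])
    show "\<forall>n. 0 \<le> N (\<lambda>z. T (K (F (\<sigma> n))) z - T g z)"
      by (auto intro!: norm_nonneg diff_mem bounded_opD(1)[OF T] mem g)
    show "\<forall>n. N (\<lambda>z. T (K (F (\<sigma> n))) z - T g z) \<le> op_norm S N T * N (\<lambda>z. K (F (\<sigma> n)) z - g z)"
      using op_norm_bound[OF T diff_mem[OF mem g]] by (simp add: bounded_op_diff[OF T mem g])
    show "(\<lambda>n. op_norm S N T * N (\<lambda>z. K (F (\<sigma> n)) z - g z)) \<longlonglongrightarrow> 0"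
      using tendsto_mult[OF tendsto_const lim, of "op_norm S N T"] by simp
  qed
  then show "\<exists>(\<sigma> :: nat \<Rightarrow> nat) h. strict_mono \<sigma> \<and> h \<in> S \<and> (\<lambda>n. N (\<lambda>z. T (K (F (\<sigma> n))) z - h z)) \<longlonglongrightarrow> 0"
    using \<sigma> bounded_opD(1)[OF T g] by blast
qed

lemma compact_op_comp_right:
  assumes K: "compact_op S N K" and T: "bounded_op S N T"
  shows "compact_op S N (\<lambda>f. K (T f))"
  unfolding compact_op_def
proof (intro conjI allI impI)
  show "bounded_op S N (\<lambda>f. K (T f))" by (rule bounded_op_comp(1)[OF compact_op_imp_bounded_op[OF K] T])
  fix F :: "nat \<Rightarrow> complex \<Rightarrow> complex" and C assume F: "\<forall>n. F n \<in> S \<and> N (F n) \<le> C"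
  have mem: "T (F n) \<in> S" for n using bounded_opD(1)[OF T] F by blast
  have "N (T (F n)) \<le> op_norm S N T * C" for n
    using F op_norm_bound[OF T, of "F n"] mult_left_mono[OF _ op_norm_nonneg[OF T], of "N (F n)" C] by force
  with mem obtain \<sigma> g where "strict_mono (\<sigma> :: nat \<Rightarrow> nat)" "g \<in> S"
    "(\<lambda>n. N (\<lambda>z. K (T (F (\<sigma> n))) z - g z)) \<longlonglongrightarrow> 0"
    by (rule compact_opD[OF K, of "\<lambda>n. T (F n)"])
  then show "\<exists>(\<sigma> :: nat \<Rightarrow> nat) g. strict_mono \<sigma> \<and> g \<in> S \<and> (\<lambda>n. N (\<lambda>z. K (T (F (\<sigma> n))) z - g z)) \<longlonglongrightarrow> 0"
    by blast
qed

lemma compact_op_plus: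
  assumes K: "compact_op S N K" and L: "compact_op S N L"
  shows "compact_op S N (\<lambda>f z. K f z + L f z)"
  unfolding compact_op_def
proof (intro conjI allI impI)
  note bK = compact_op_imp_bounded_op[OF K] and bL = compact_op_imp_bounded_op[OF L]
  show "bounded_op S N (\<lambda>f z. K f z + L f z)" by (rule bounded_op_plus[OF bK bL])
  fix F :: "nat \<Rightarrow> complex \<Rightarrow> complex" and C assume F: "\<forall>n. F n \<in> S \<and> N (F n) \<le> C"
  obtain \<sigma> g where \<sigma>: "strict_mono (\<sigma> :: nat \<Rightarrow> nat)" and g: "g \<in> S"
    and lim: "(\<lambda>n. N (\<lambda>z. K (F (\<sigma> n)) z - g z)) \<longlonglongrightarrow> 0"
    by (rule compact_opD[OF K, of F C]) (use F in auto)
  obtain \<tau> h where \<tau>: "strict_mono (\<tau> :: nat \<Rightarrow> nat)" and h: "h \<in> S"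
    and lim2: "(\<lambda>n. N (\<lambda>z. L (F (\<sigma> (\<tau> n))) z - h z)) \<longlonglongrightarrow> 0"
    by (rule compact_opD[OF L, of "\<lambda>n. F (\<sigma> n)" C]) (use F in auto)
  have lim1: "(\<lambda>n. N (\<lambda>z. K (F (\<sigma> (\<tau> n))) z - g z)) \<longlonglongrightarrow> 0"
    using LIMSEQ_subseq_LIMSEQ[OF lim \<tau>] by (simp add: comp_def)
  have mem: "K (F n) \<in> S" "L (F n) \<in> S" for n using bounded_opD(1)[OF bK] bounded_opD(1)[OF bL] F by blast+
  have "(\<lambda>n. N (\<lambda>z. (K (F (\<sigma> (\<tau> n))) z + L (F (\<sigma> (\<tau> n))) z) - (g z + h z))) \<longlonglongrightarrow> 0"
  proof (rule tendsto_sandwich[OF always_eventually always_eventually tendsto_const])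
    show "\<forall>n. 0 \<le> N (\<lambda>z. (K (F (\<sigma> (\<tau> n))) z + L (F (\<sigma> (\<tau> n))) z) - (g z + h z))"
      by (auto intro!: norm_nonneg diff_mem add_mem mem g h)
    show "\<forall>n. N (\<lambda>z. (K (F (\<sigma> (\<tau> n))) z + L (F (\<sigma> (\<tau> n))) z) - (g z + h z)) \<le>
      N (\<lambda>z. K (F (\<sigma> (\<tau> n))) z - g z) + N (\<lambda>z. L (F (\<sigma> (\<tau> n))) z - h z)"
      using norm_add[OF diff_mem[OF mem(1) g] diff_mem[OF mem(2) h]] by (simp add: algebra_simps)
    show "(\<lambda>n. N (\<lambda>z. K (F (\<sigma> (\<tau> n))) z - g z) + N (\<lambda>z. L (F (\<sigma> (\<tau> n))) z - h z)) \<longlonglongrightarrow> 0"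
      using tendsto_add[OF lim1 lim2] by simp
  qed
  then show "\<exists>(\<sigma> :: nat \<Rightarrow> nat) h. strict_mono \<sigma> \<and> h \<in> S \<and> (\<lambda>n. N (\<lambda>z. K (F (\<sigma> n)) z + L (F (\<sigma> n)) z - h z)) \<longlonglongrightarrow> 0"
    using strict_mono_o[OF \<sigma> \<tau>] add_mem[OF g h]
    by (intro exI[of _ "\<sigma> \<circ> \<tau>"] exI[of _ "\<lambda>z. g z + h z"]) (simp add: comp_def)
qed

text \<open>Compactness comes from Bolzano-Weierstrass for the scalars
  \<open>l (F n)\<close>.\<close>

lemma compact_op_rank_one:
  assumes \<phi>: "\<phi> \<in> S"
    and add: "\<And>f g. f \<in> S \<Longrightarrow> g \<in> S \<Longrightarrow> l (\<lambda>z. f z + g z) = l f + l g"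
    and cmult: "\<And>f c. f \<in> S \<Longrightarrow> l (\<lambda>z. c * f z) = c * l f"
    and bound: "\<And>f. f \<in> S \<Longrightarrow> cmod (l f) \<le> A * N f" and A: "A \<ge> 0"
  shows "compact_op S N (\<lambda>f z. l f * \<phi> z)"
  unfolding compact_op_def
proof (intro conjI allI impI)
  show "bounded_op S N (\<lambda>f z. l f * \<phi> z)"
  proof (rule bounded_opI)
    fix f assume f: "f \<in> S"
    show "N (\<lambda>z. l f * \<phi> z) \<le> (A * N \<phi>) * N f"
      using mult_right_mono[OF bound[OF f] norm_nonneg[OF \<phi>]] by (subst norm_cmult[OF \<phi>]) (simp add: ac_simps)
  qed (simp_all add: add cmult cmult_mem[OF \<phi>] distrib_right mult.assoc)
  fix F :: "nat \<Rightarrow> complex \<Rightarrow> complex" and C assume F: "\<forall>n. F n \<in> S \<and> N (F n) \<le> C"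
  have "cmod (l (F n)) \<le> A * C" for n
    using F bound[of "F n"] mult_left_mono[OF _ A, of "N (F n)" C] by force
  then have "bounded (range (\<lambda>n. l (F n)))" by (auto simp: bounded_iff)
  then obtain x and \<sigma> :: "nat \<Rightarrow> nat" where \<sigma>: "strict_mono \<sigma>" and lim: "(\<lambda>n. l (F (\<sigma> n))) \<longlonglongrightarrow> x"
    using bounded_imp_convergent_subsequence[of "\<lambda>n. l (F n)"] by (auto simp: comp_def)
  have "N (\<lambda>z. l (F (\<sigma> n)) * \<phi> z - x * \<phi> z) = cmod (l (F (\<sigma> n)) - x) * N \<phi>" for n
    using norm_cmult[OF \<phi>, of "l (F (\<sigma> n)) - x"] by (simp add: left_diff_distrib)
  moreover have "(\<lambda>n. cmod (l (F (\<sigma> n)) - x) * N \<phi>) \<longlonglongrightarrow> 0 * N \<phi>"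
    using lim by (intro tendsto_mult tendsto_const) (simp add: LIM_zero tendsto_norm_zero)
  ultimately show "\<exists>(\<sigma> :: nat \<Rightarrow> nat) g. strict_mono \<sigma> \<and> g \<in> S \<and> (\<lambda>n. N (\<lambda>z. l (F (\<sigma> n)) * \<phi> z - g z)) \<longlonglongrightarrow> 0"
    using \<sigma> cmult_mem[OF \<phi>] by (intro exI[of _ \<sigma>] exI[of _ "\<lambda>z. x * \<phi> z"]) auto
qed

lemma compact_op_zero: "compact_op S N (\<lambda>f z. 0)"
  using compact_op_rank_one[OF zero_mem, of "\<lambda>_. 0" 0] by simp

lemma compact_op_sum:
  "finite A \<Longrightarrow> (\<And>i. i \<in> A \<Longrightarrow> compact_op S N (K i)) \<Longrightarrow> compact_op S N (\<lambda>f z. \<Sum>i\<in>A. K i f z)"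
  by (induction A rule: finite_induct) (auto intro: compact_op_zero compact_op_plus)

section \<open>Essential norm and spectral radii\<close>

lemma ess_norm_bdd_below:
  assumes "bounded_op S N T"
  shows "bdd_below {op_norm S N (\<lambda>f z. T f z - K f z) | K. compact_op S N K}"
  by (rule bdd_belowI[of _ 0]) (auto intro!: op_norm_nonneg bounded_op_minus[OF assms] dest: compact_op_imp_bounded_op)

lemma ess_norm_le:
  assumes "bounded_op S N T" "compact_op S N K"
  shows "ess_norm S N T \<le> op_norm S N (\<lambda>f z. T f z - K f z)"
  unfolding ess_norm_def using assms(2) by (intro cInf_lower ess_norm_bdd_below assms(1)) blast

lemma ess_norm_nonneg: "bounded_op S N T \<Longrightarrow> ess_norm S N T \<ge> 0"
  unfolding ess_norm_def using compact_op_zero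
  by (intro cInf_greatest) (auto intro!: op_norm_nonneg bounded_op_minus dest: compact_op_imp_bounded_op)

lemma ess_norm_less:
  assumes "ess_norm S N T < x"
  obtains K where "compact_op S N K" "op_norm S N (\<lambda>f z. T f z - K f z) < x"
  using cInf_lessD[of "{op_norm S N (\<lambda>f z. T f z - K f z) | K. compact_op S N K}" x] assms compact_op_zero
  unfolding ess_norm_def by blast

text \<open>(T - K)(U - L) differs from T U by T L + K (U - L), which is compact along with K and L.
  This is submultiplicativity of the quotient norm modulo compact operators.\<close>

lemma ess_norm_comp:
  assumes T: "bounded_op S N T" and U: "bounded_op S N U"
  shows "ess_norm S N (\<lambda>f. T (U f)) \<le> ess_norm S N T * ess_norm S N U"
proof -
  have key: "ess_norm S N (\<lambda>f. T (U f)) \<le> x * y" if x: "ess_norm S N T < x" and y: "ess_norm S N U < y" for x y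
  proof -
    obtain K where K: "compact_op S N K" "op_norm S N (\<lambda>f z. T f z - K f z) < x" using ess_norm_less[OF x] .
    obtain L where L: "compact_op S N L" "op_norm S N (\<lambda>f z. U f z - L f z) < y" using ess_norm_less[OF y] .
    note bK = compact_op_imp_bounded_op[OF K(1)] and bL = compact_op_imp_bounded_op[OF L(1)]
    have bTK: "bounded_op S N (\<lambda>f z. T f z - K f z)" by (rule bounded_op_minus[OF T bK])
    have bUL: "bounded_op S N (\<lambda>f z. U f z - L f z)" by (rule bounded_op_minus[OF U bL])
    let ?M = "\<lambda>f z. T (L f) z + K (\<lambda>w. U f w - L f w) z"
    have M: "compact_op S N ?M"
      by (rule compact_op_plus[OF compact_op_comp_left[OF L(1) T] compact_op_comp_right[OF K(1) bUL]])
    have "ess_norm S N (\<lambda>f. T (U f)) \<le> op_norm S N (\<lambda>f z. T (U f) z - ?M f z)"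
      by (rule ess_norm_le[OF bounded_op_comp(1)[OF T U] M])
    also have "\<dots> = op_norm S N (\<lambda>f. (\<lambda>g z. T g z - K g z) (\<lambda>w. U f w - L f w))"
      by (rule op_norm_cong)
        (simp add: bounded_op_diff[OF T] bounded_opD(1)[OF U] bounded_opD(1)[OF bL] algebra_simps)
    also have "\<dots> \<le> op_norm S N (\<lambda>f z. T f z - K f z) * op_norm S N (\<lambda>f z. U f z - L f z)"
      by (rule bounded_op_comp(2)[OF bTK bUL])
    also have "\<dots> \<le> x * y"
      using K(2) L(2) op_norm_nonneg[OF bTK] op_norm_nonneg[OF bUL] by (intro mult_mono) auto
    finally show ?thesis .
  qed
  let ?a = "ess_norm S N T" and ?b = "ess_norm S N U"
  \<comment> \<open>The infima need not be attained, so the product bound is reached as a limit of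
    bounds with strictly larger factors.\<close>
  have "(\<lambda>n. (?a + 1 / real (Suc n)) * (?b + 1 / real (Suc n))) \<longlonglongrightarrow> (?a + 0) * (?b + 0)"
    by (intro tendsto_intros LIMSEQ_Suc[OF lim_1_over_n])
  then show ?thesis
    by (intro LIMSEQ_le_const[of _ "?a * ?b"]) (auto intro!: exI[of _ 0] key)
qed

lemma ess_spec_rad_le:
  assumes T: "bounded_op S N T" and \<rho>: "\<rho> \<ge> 0" and C: "C > 0"
    and approx: "\<And>k. k \<ge> 1 \<Longrightarrow> \<exists>K. compact_op S N K \<and> op_norm S N (\<lambda>f z. (T ^^ k) f z - K f z) \<le> C * \<rho> ^ k"
  shows "ess_spec_rad S N T \<le> \<rho>"
proof -
  note b = bounded_op_power[OF T]
  have "convergent (\<lambda>k. root k (ess_norm S N (T ^^ k)))"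
  proof (rule submultiplicative_root_convergent)
    fix i j
    have "ess_norm S N (T ^^ (i + j)) = ess_norm S N (\<lambda>f. (T ^^ i) ((T ^^ j) f))"
      by (simp add: funpow_add comp_def)
    then show "ess_norm S N (T ^^ (i + j)) \<le> ess_norm S N (T ^^ i) * ess_norm S N (T ^^ j)"
      using ess_norm_comp[OF b b] by simp
  qed (rule ess_norm_nonneg[OF b])
  then have "(\<lambda>k. root k (ess_norm S N (T ^^ k))) \<longlonglongrightarrow> ess_spec_rad S N T"
    unfolding ess_spec_rad_def by (simp add: convergent_LIMSEQ_iff)
  moreover have "root k (ess_norm S N (T ^^ k)) \<le> root k (C * \<rho> ^ k)" if k: "k \<ge> 1" for k
  proof -
    obtain K where "compact_op S N K" "op_norm S N (\<lambda>f z. (T ^^ k) f z - K f z) \<le> C * \<rho> ^ k"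
      using approx[OF k] by blast
    then have "ess_norm S N (T ^^ k) \<le> C * \<rho> ^ k" using ess_norm_le[OF b, of K k] by simp
    then show ?thesis using k by simp
  qed
  ultimately show ?thesis
    using root_tendsto_of_bounds[OF C \<rho>] by (intro LIMSEQ_le) (auto intro!: exI[of _ 1])
qed

lemma spec_rad_eqI:
  assumes r: "r > 0" and C: "C > 0"
    and lower: "\<And>k. r ^ k \<le> op_norm S N (T ^^ k)" and upper: "\<And>k. op_norm S N (T ^^ k) \<le> C * r ^ k"
  shows "spec_rad S N T = r"
proof -
  have "(\<lambda>k. root k (op_norm S N (T ^^ k))) \<longlonglongrightarrow> r"
  proof (rule tendsto_sandwich)
    show "\<forall>\<^sub>F k in sequentially. r \<le> root k (op_norm S N (T ^^ k))"
      using eventually_gt_at_top[of 0]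
    proof eventually_elim
      case (elim k)
      then have "root k (r ^ k) \<le> root k (op_norm S N (T ^^ k))" using lower by simp
      then show ?case using elim r by (simp add: real_root_power_cancel)
    qed
    show "\<forall>\<^sub>F k in sequentially. root k (op_norm S N (T ^^ k)) \<le> root k (C * r ^ k)"
      using eventually_gt_at_top[of 0] by eventually_elim (simp add: upper)
    show "(\<lambda>k. root k (C * r ^ k)) \<longlonglongrightarrow> r" using r by (intro root_tendsto_of_bounds C) simp
  qed simp
  then show ?thesis unfolding spec_rad_def by (rule limI)
qed

end

section \<open>Operators with a spectral gap\<close>

text \<open>Completeness in the form needed for Neumann series: geometrically bounded series
  converge. The sum is taken pointwise, and \<open>K0\<close> leaves room for the loss between the
  norm and bounds on a jet.\<close>

locale function_banach_space = function_normed_space +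
  fixes K0 :: real
  assumes norm_zero_imp: "\<And>f. f \<in> S \<Longrightarrow> N f = 0 \<Longrightarrow> f = (\<lambda>z. 0)"
    and K0: "K0 \<ge> 0"
    and geometric_series: "\<And>F C q. (\<And>n. F n \<in> S) \<Longrightarrow> 0 \<le> q \<Longrightarrow> q < 1 \<Longrightarrow> (\<And>n. N (F n) \<le> C * q ^ n) \<Longrightarrow>
      (\<forall>z. summable (\<lambda>n. F n z)) \<and> (\<lambda>z. \<Sum>n. F n z) \<in> S \<and> N (\<lambda>z. \<Sum>n. F n z) \<le> K0 * C / (1 - q)"
begin

lemma geometric_series_tail:
  assumes F: "\<And>n. F n \<in> S" and q: "0 \<le> q" "q < 1" and b: "\<And>n. N (F n) \<le> C * q ^ n"
  shows "(\<lambda>z. \<Sum>n. F (n + k) z) \<in> S" "N (\<lambda>z. \<Sum>n. F (n + k) z) \<le> K0 * C / (1 - q) * q ^ k"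
    "(\<lambda>z. \<Sum>n. F (n + k) z) = (\<lambda>z. F k z + (\<Sum>n. F (n + Suc k) z))"
proof -
  have "N (F (n + k)) \<le> (C * q ^ k) * q ^ n" for n using b[of "n + k"] by (simp add: power_add ac_simps)
  from geometric_series[OF F q this]
  show "(\<lambda>z. \<Sum>n. F (n + k) z) \<in> S" "N (\<lambda>z. \<Sum>n. F (n + k) z) \<le> K0 * C / (1 - q) * q ^ k"
    and "(\<lambda>z. \<Sum>n. F (n + k) z) = (\<lambda>z. F k z + (\<Sum>n. F (n + Suc k) z))"
    using suminf_split_head[of "\<lambda>n. F (n + k) z" for z] by (simp_all add: ac_simps)
qed

text \<open>The defect between T of a tail and the tail of the images does not depend on where the
  tail begins, and it tends to 0 in norm; so it vanishes.\<close>

lemma bounded_op_series: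
  assumes T: "bounded_op S N T"
    and F: "\<And>n. F n \<in> S" and q: "0 \<le> q" "q < 1" and b: "\<And>n. N (F n) \<le> C * q ^ n"
  shows "T (\<lambda>z. \<Sum>n. F n z) = (\<lambda>z. \<Sum>n. T (F n) z)"
proof -
  have TF: "T (F n) \<in> S" for n using bounded_opD(1)[OF T] F .
  have Tb: "N (T (F n)) \<le> op_norm S N T * C * q ^ n" for n
    using order_trans[OF op_norm_bound[OF T F] mult_left_mono[OF b op_norm_nonneg[OF T]]] by (simp add: mult.assoc)
  define D where "D k = (\<lambda>z. T (\<lambda>z. \<Sum>n. F (n + k) z) z - (\<Sum>n. T (F (n + k)) z))" for k
  note FT = geometric_series_tail[OF F q b] and TFT = geometric_series_tail[OF TF q Tb]
  have D_Suc: "D k = D (Suc k)" for k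
    unfolding D_def FT(3)[of k] bounded_opD(2)[OF T F FT(1)] using fun_cong[OF TFT(3)[of k]]
    by (simp add: fun_eq_iff)
  then have D0: "D 0 = D k" for k by (induction k) simp_all
  have Dmem: "D k \<in> S" for k
    unfolding D_def by (intro diff_mem bounded_opD(1)[OF T] FT(1) TFT(1))
  define M where "M = op_norm S N T * (K0 * C / (1 - q)) + K0 * (op_norm S N T * C) / (1 - q)"
  have "N (D 0) \<le> M * q ^ k" for k
  proof -
    have "N (D k) \<le> N (T (\<lambda>z. \<Sum>n. F (n + k) z)) + N (\<lambda>z. \<Sum>n. T (F (n + k)) z)"
      unfolding D_def by (intro norm_diff bounded_opD(1)[OF T] FT(1) TFT(1))
    also have "\<dots> \<le> op_norm S N T * (K0 * C / (1 - q) * q ^ k) + K0 * (op_norm S N T * C) / (1 - q) * q ^ k"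
      by (intro add_mono TFT(2) order_trans[OF op_norm_bound[OF T FT(1)]] mult_left_mono FT(2) op_norm_nonneg T)
    finally show ?thesis by (simp add: D0[of k] M_def algebra_simps)
  qed
  moreover have "(\<lambda>k. M * q ^ k) \<longlonglongrightarrow> M * 0"
    using q by (intro tendsto_intros LIMSEQ_realpow_zero) auto
  ultimately have "N (D 0) \<le> 0" by (intro LIMSEQ_le_const[of "\<lambda>k. M * q ^ k"]) auto
  then have "D 0 = (\<lambda>z. 0)" using norm_zero_imp[OF Dmem] norm_nonneg[OF Dmem[of 0]] by simp
  then show ?thesis by (simp add: D_def fun_eq_iff)
qed

end

text \<open>v spans an eigenline and l is the dual eigenfunctional, so S splits into the line of v
  and the kernel of l, both invariant under T. All spectral claims follow from this splitting and
  the decay on the kernel.\<close>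

locale spectral_gap = function_banach_space +
  fixes T :: "(complex \<Rightarrow> complex) \<Rightarrow> complex \<Rightarrow> complex" and r q C A :: real
    and v :: "complex \<Rightarrow> complex" and l :: "(complex \<Rightarrow> complex) \<Rightarrow> complex"
  assumes T: "bounded_op S N T" and r: "r > 0" and q: "0 < q" "q < 1"
    and v: "v \<in> S" "T v = (\<lambda>z. of_real r * v z)"
    and l_add: "\<And>f g. f \<in> S \<Longrightarrow> g \<in> S \<Longrightarrow> l (\<lambda>z. f z + g z) = l f + l g"
    and l_cmult: "\<And>f c. f \<in> S \<Longrightarrow> l (\<lambda>z. c * f z) = c * l f"
    and l_bound: "\<And>f. f \<in> S \<Longrightarrow> cmod (l f) \<le> A * N f"
    and l_T: "\<And>f. f \<in> S \<Longrightarrow> l (T f) = of_real r * l f"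
    and l_v: "l v = 1"
    and decay: "\<And>g n. g \<in> S \<Longrightarrow> l g = 0 \<Longrightarrow> N ((T ^^ n) g) \<le> C * (q * r) ^ n * N g"
begin

lemma l_diff: "f \<in> S \<Longrightarrow> g \<in> S \<Longrightarrow> l (\<lambda>z. f z - g z) = l f - l g"
  using l_add[of f "\<lambda>z. (-1) * g z"] cmult_mem[of g "-1"] l_cmult[of g "-1"] by simp

text \<open>The projection onto the kernel of l along v.\<close>

definition remainder :: "(complex \<Rightarrow> complex) \<Rightarrow> complex \<Rightarrow> complex" where
  "remainder f = (\<lambda>z. f z - l f * v z)"

lemma remainder_mem: "f \<in> S \<Longrightarrow> remainder f \<in> S"
  unfolding remainder_def by (intro diff_mem cmult_mem v(1))

lemma l_remainder: "f \<in> S \<Longrightarrow> l (remainder f) = 0"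
  unfolding remainder_def using l_diff[OF _ cmult_mem[OF v(1)], of f "l f"] l_cmult[OF v(1), of "l f"] l_v by simp

lemma v_nonzero: "v \<noteq> (\<lambda>z. 0)"
  using l_cmult[OF v(1), of 0] l_v by auto

lemma N_v: "N v > 0"
  using norm_nonneg[OF v(1)] norm_zero_imp[OF v(1)] v_nonzero by force

lemma power_v: "(T ^^ n) v = (\<lambda>z. of_real (r ^ n) * v z)"
proof (induction n)
  case (Suc n)
  have "(T ^^ Suc n) v = (\<lambda>z. of_real (r ^ n) * T v z)"
    using Suc bounded_opD(3)[OF T v(1), of "of_real (r ^ n)"] by simp
  then show ?case by (simp add: v(2) ac_simps)
qed simp

lemma norm_remainder: "f \<in> S \<Longrightarrow> N (remainder f) \<le> (1 + A * N v) * N f"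
proof -
  assume f: "f \<in> S"
  have "N (remainder f) \<le> N f + cmod (l f) * N v"
    using norm_diff[OF f cmult_mem[OF v(1)], of "l f"] norm_cmult[OF v(1), of "l f"] by (simp add: remainder_def)
  also have "\<dots> \<le> N f + (A * N f) * N v"
    using l_bound[OF f] N_v by (intro add_left_mono mult_right_mono) auto
  finally show ?thesis by (simp add: algebra_simps)
qed

lemma power_mem: "f \<in> S \<Longrightarrow> (T ^^ n) f \<in> S"
  by (rule bounded_opD(1)[OF bounded_op_power[OF T]])

lemma power_remainder:
  assumes "f \<in> S"
  shows "(T ^^ n) (remainder f) = (\<lambda>z. (T ^^ n) f z - l f * of_real (r ^ n) * v z)"
  unfolding remainder_def
  using bounded_op_diff[OF bounded_op_power[OF T] assms cmult_mem[OF v(1)], of n "l f"]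
    bounded_opD(3)[OF bounded_op_power[OF T] v(1), of n "l f"] power_v[of n] by (simp add: mult.assoc)

lemma power_limit:
  assumes f: "f \<in> S"
  shows "(\<lambda>k. N (\<lambda>z. of_real ((1 / r) ^ k) * (T ^^ k) f z - l f * v z)) \<longlonglongrightarrow> 0"
proof (rule tendsto_sandwich[OF always_eventually always_eventually tendsto_const])
  let ?g = "remainder f"
  have eq: "(\<lambda>z. of_real ((1 / r) ^ k) * (T ^^ k) f z - l f * v z) = (\<lambda>z. of_real ((1 / r) ^ k) * (T ^^ k) ?g z)" for k
    using r by (simp add: power_remainder[OF f] fun_eq_iff algebra_simps power_divide)
  have mem: "(T ^^ k) ?g \<in> S" for k by (intro power_mem remainder_mem f)
  show "\<forall>k. 0 \<le> N (\<lambda>z. of_real ((1 / r) ^ k) * (T ^^ k) f z - l f * v z)"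
    unfolding eq by (intro allI norm_nonneg cmult_mem mem)
  show "\<forall>k. N (\<lambda>z. of_real ((1 / r) ^ k) * (T ^^ k) f z - l f * v z) \<le> (C * N ?g) * q ^ k"
  proof
    fix k
    have "N (\<lambda>z. of_real ((1 / r) ^ k) * (T ^^ k) ?g z) = (1 / r) ^ k * N ((T ^^ k) ?g)"
      using r by (subst norm_cmult[OF mem]) (simp add: norm_power norm_divide)
    also have "\<dots> \<le> (1 / r) ^ k * (C * (q * r) ^ k * N ?g)"
      using r decay[OF remainder_mem[OF f] l_remainder[OF f]] by (intro mult_left_mono) auto
    also have "\<dots> = (C * N ?g) * q ^ k" using r by (simp add: power_mult_distrib power_divide)
    finally show "N (\<lambda>z. of_real ((1 / r) ^ k) * (T ^^ k) f z - l f * v z) \<le> (C * N ?g) * q ^ k"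
      unfolding eq .
  qed
  have "(\<lambda>k. (C * N ?g) * q ^ k) \<longlonglongrightarrow> (C * N ?g) * 0"
    using q by (intro tendsto_intros LIMSEQ_realpow_zero) auto
  then show "(\<lambda>k. (C * N ?g) * q ^ k) \<longlonglongrightarrow> 0" by simp
qed

lemma spec_rad: "spec_rad S N T = r"
proof (rule spec_rad_eqI)
  \<comment> \<open>The first summand comes from the component along v, the second from the
    remainder; the 1 added below secures positivity.\<close>
  let ?M = "A * N v + \<bar>C\<bar> * (1 + A * N v)"
  have A: "A \<ge> 0" using l_bound[OF v(1)] l_v N_v
    by (metis norm_one mult_neg_pos not_le norm_ge_zero order_trans zero_less_one)
  show "0 < ?M + 1" using A N_v by (simp add: add_nonneg_pos)
  fix k
  note bk = bounded_op_power[OF T, of k]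
  have "r ^ k * N v = N ((T ^^ k) v)" using r by (simp add: power_v norm_cmult[OF v(1)] norm_power del: of_real_power)
  also have "\<dots> \<le> op_norm S N (T ^^ k) * N v" by (rule op_norm_bound[OF bk v(1)])
  finally show "r ^ k \<le> op_norm S N (T ^^ k)" using N_v by simp
  have "op_norm S N (T ^^ k) \<le> ?M * r ^ k"
  proof (rule op_norm_le)
    show "0 \<le> ?M * r ^ k" using A r N_v by simp
    fix f assume f: "f \<in> S"
    let ?g = "remainder f"
    have g: "?g \<in> S" "l ?g = 0" by (simp_all add: remainder_mem l_remainder f)
    have "(T ^^ k) f = (\<lambda>z. (T ^^ k) ?g z + (l f * of_real (r ^ k)) * v z)"
      by (simp add: power_remainder[OF f])
    then have "N ((T ^^ k) f) \<le> N ((T ^^ k) ?g) + N (\<lambda>z. (l f * of_real (r ^ k)) * v z)"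
      using norm_add[OF power_mem[OF g(1)] cmult_mem[OF v(1)]] by metis
    also have "N (\<lambda>z. (l f * of_real (r ^ k)) * v z) = cmod (l f) * (r ^ k * N v)"
      using r by (subst norm_cmult[OF v(1)]) (simp add: norm_mult norm_power)
    also have "\<dots> \<le> (A * N f) * (r ^ k * N v)"
      using r N_v by (intro mult_right_mono l_bound f) simp
    also have "N ((T ^^ k) ?g) \<le> \<bar>C\<bar> * r ^ k * N ?g"
    proof -
      have "N ((T ^^ k) ?g) \<le> C * (q * r) ^ k * N ?g" by (rule decay[OF g])
      also have "\<dots> \<le> \<bar>C\<bar> * (1 * r) ^ k * N ?g"
        using q r norm_nonneg[OF g(1)] by (intro mult_right_mono mult_mono power_mono) auto
      finally show ?thesis by simp
    qed
    also have "\<bar>C\<bar> * r ^ k * N ?g \<le> \<bar>C\<bar> * r ^ k * ((1 + A * N v) * N f)"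
      using r by (intro mult_left_mono norm_remainder f) simp
    finally show "N ((T ^^ k) f) \<le> ?M * r ^ k * N f" by (simp add: algebra_simps)
  qed
  also have "\<dots> \<le> (?M + 1) * r ^ k" using r by (simp add: algebra_simps)
  finally show "op_norm S N (T ^^ k) \<le> (?M + 1) * r ^ k" by simp
qed (rule r)

text \<open>A left inverse of r - T would map 0 to v.\<close>

lemma r_in_spectrum: "of_real r \<in> spectrum_op S N T"
proof (rule ccontr)
  assume "of_real r \<notin> spectrum_op S N T"
  then obtain R where R: "bounded_op S N R" "\<forall>f\<in>S. R (\<lambda>z. of_real r * f z - T f z) = f"
    unfolding spectrum_op_def by blast
  have "v = R (\<lambda>z. 0)" using R(2) v by fastforce
  then show False using bounded_op_zero[OF R(1)] v_nonzero by simp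
qed

text \<open>The expansion of the inverse of \<xi> - T in powers of T. On the kernel of l it
  converges already for |\<xi>| > q r, while at v it needs |\<xi>| > r.\<close>

definition neumann :: "complex \<Rightarrow> (complex \<Rightarrow> complex) \<Rightarrow> complex \<Rightarrow> complex" where
  "neumann \<xi> g = (\<lambda>z. \<Sum>n. inverse \<xi> ^ Suc n * (T ^^ n) g z)"

context
  fixes \<xi> :: complex
  assumes \<xi>: "cmod \<xi> > q * r" "\<xi> \<noteq> of_real r"
begin

lemma xi_pos: "cmod \<xi> > 0" "\<xi> \<noteq> 0"
proof -
  show "cmod \<xi> > 0" using \<xi>(1) q(1) r by (meson less_trans mult_pos_pos)
  then show "\<xi> \<noteq> 0" by auto
qed

lemma neumann_term:
  assumes "g \<in> S" "l g = 0"
  shows "(\<lambda>z. inverse \<xi> ^ Suc n * (T ^^ n) g z) \<in> S"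
    "N (\<lambda>z. inverse \<xi> ^ Suc n * (T ^^ n) g z) \<le> (C * N g / cmod \<xi>) * (q * r / cmod \<xi>) ^ n"
proof -
  have mem: "(T ^^ n) g \<in> S" by (rule power_mem[OF assms(1)])
  then show "(\<lambda>z. inverse \<xi> ^ Suc n * (T ^^ n) g z) \<in> S" by (rule cmult_mem)
  have "N (\<lambda>z. inverse \<xi> ^ Suc n * (T ^^ n) g z) = inverse (cmod \<xi>) ^ Suc n * N ((T ^^ n) g)"
    by (subst norm_cmult[OF mem]) (simp add: norm_mult norm_power norm_inverse)
  also have "\<dots> \<le> inverse (cmod \<xi>) ^ Suc n * (C * (q * r) ^ n * N g)"
    using xi_pos by (intro mult_left_mono decay assms) auto
  finally show "N (\<lambda>z. inverse \<xi> ^ Suc n * (T ^^ n) g z) \<le> (C * N g / cmod \<xi>) * (q * r / cmod \<xi>) ^ n"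
    by (simp add: power_divide power_mult_distrib field_simps)
qed

lemma ratio: "0 \<le> q * r / cmod \<xi>" "q * r / cmod \<xi> < 1"
  using \<xi> q r xi_pos by (simp_all add: divide_less_eq)

lemmas neumann_series = geometric_series[OF neumann_term(1) ratio neumann_term(2)]

lemma neumann_mem: "g \<in> S \<Longrightarrow> l g = 0 \<Longrightarrow> neumann \<xi> g \<in> S"
  unfolding neumann_def using neumann_series by blast

lemma neumann_summable: "g \<in> S \<Longrightarrow> l g = 0 \<Longrightarrow> summable (\<lambda>n. inverse \<xi> ^ Suc n * (T ^^ n) g z)"
  using neumann_series by blast

lemma neumann_T:
  assumes g: "g \<in> S" "l g = 0"
  shows "T (neumann \<xi> g) = neumann \<xi> (T g)"
    "(\<lambda>z. \<xi> * neumann \<xi> g z - neumann \<xi> (T g) z) = g"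
proof -
  have "T (neumann \<xi> g) = (\<lambda>z. \<Sum>n. T (\<lambda>z. inverse \<xi> ^ Suc n * (T ^^ n) g z) z)"
    unfolding neumann_def by (rule bounded_op_series[OF T neumann_term(1)[OF g] ratio neumann_term(2)[OF g]])
  also have "\<dots> = neumann \<xi> (T g)"
    unfolding neumann_def using bounded_opD(3)[OF T power_mem[OF g(1)]]
    by (simp add: funpow_swap1)
  finally show "T (neumann \<xi> g) = neumann \<xi> (T g)" .
  show "(\<lambda>z. \<xi> * neumann \<xi> g z - neumann \<xi> (T g) z) = g"
  proof
    fix z
    let ?a = "\<lambda>n. inverse \<xi> ^ n * (T ^^ n) g z"
    have s: "summable (\<lambda>n. inverse \<xi> ^ Suc n * (T ^^ n) g z)" by (rule neumann_summable[OF g])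
    have a: "?a = (\<lambda>n. \<xi> * (inverse \<xi> ^ Suc n * (T ^^ n) g z))" using xi_pos by (simp add: fun_eq_iff)
    have sa: "summable ?a" unfolding a by (rule summable_mult[OF s])
    have "\<xi> * neumann \<xi> g z = suminf ?a"
      unfolding neumann_def a by (rule suminf_mult[OF s, symmetric])
    also have "\<dots> = (\<Sum>n. ?a (Suc n)) + ?a 0" using suminf_split_head[OF sa] by simp
    also have "(\<Sum>n. ?a (Suc n)) = neumann \<xi> (T g) z"
      unfolding neumann_def by (simp add: funpow_swap1)
    finally show "\<xi> * neumann \<xi> g z - neumann \<xi> (T g) z = g z" by simp
  qed
qed

lemma neumann_add:
  assumes "g \<in> S" "l g = 0" "h \<in> S" "l h = 0"
  shows "neumann \<xi> (\<lambda>z. g z + h z) = (\<lambda>z. neumann \<xi> g z + neumann \<xi> h z)"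
  unfolding neumann_def bounded_opD(2)[OF bounded_op_power[OF T] assms(1,3)]
  using suminf_add[OF neumann_summable[OF assms(1,2)] neumann_summable[OF assms(3,4)]]
  by (simp add: distrib_left)

lemma neumann_cmult:
  assumes "g \<in> S" "l g = 0"
  shows "neumann \<xi> (\<lambda>z. c * g z) = (\<lambda>z. c * neumann \<xi> g z)"
  unfolding neumann_def bounded_opD(3)[OF bounded_op_power[OF T] assms(1)]
  using suminf_mult[OF neumann_summable[OF assms], of c] by (simp add: ac_simps)

text \<open>On the line of v the operator \<xi> - T is multiplication by \<xi> - r, on the kernel of
  l it is inverted by the series; the two inverses are added.\<close>

definition resolvent :: "(complex \<Rightarrow> complex) \<Rightarrow> complex \<Rightarrow> complex" where
  "resolvent f = (\<lambda>z. l f / (\<xi> - of_real r) * v z + neumann \<xi> (remainder f) z)"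

lemma resolvent_bounded: "bounded_op S N resolvent"
proof (rule bounded_opI)
  fix f assume f: "f \<in> S"
  have g: "remainder f \<in> S" "l (remainder f) = 0" by (simp_all add: remainder_mem l_remainder f)
  show "resolvent f \<in> S" unfolding resolvent_def by (intro add_mem cmult_mem v(1) neumann_mem g)
  let ?M = "K0 * \<bar>C\<bar> / cmod \<xi> / (1 - q * r / cmod \<xi>)"
  have M: "?M \<ge> 0" using K0 xi_pos ratio by simp
  have "N (resolvent f) \<le> N (\<lambda>z. l f / (\<xi> - of_real r) * v z) + N (neumann \<xi> (remainder f))"
    unfolding resolvent_def by (intro norm_add cmult_mem v(1) neumann_mem g)
  also have "N (\<lambda>z. l f / (\<xi> - of_real r) * v z) = cmod (l f) / cmod (\<xi> - of_real r) * N v"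
    by (subst norm_cmult[OF v(1)]) (simp add: norm_divide)
  also have "\<dots> \<le> A * N f / cmod (\<xi> - of_real r) * N v"
    using N_v by (intro mult_right_mono divide_right_mono l_bound f) auto
  also have "N (neumann \<xi> (remainder f)) \<le> K0 * (C * N (remainder f) / cmod \<xi>) / (1 - q * r / cmod \<xi>)"
    unfolding neumann_def using neumann_series[OF g g] by blast
  also have "\<dots> \<le> K0 * (\<bar>C\<bar> * N (remainder f) / cmod \<xi>) / (1 - q * r / cmod \<xi>)"
    using K0 xi_pos ratio norm_nonneg[OF g(1)]
    by (intro divide_right_mono mult_left_mono mult_right_mono) auto
  also have "\<dots> = ?M * N (remainder f)" by simp
  also have "\<dots> \<le> ?M * ((1 + A * N v) * N f)" by (intro mult_left_mono norm_remainder f M)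
  finally show "N (resolvent f) \<le> (A / cmod (\<xi> - of_real r) * N v + ?M * (1 + A * N v)) * N f"
    by (simp add: algebra_simps)
next
  fix f g assume f: "f \<in> S" and g: "g \<in> S"
  have rem: "remainder (\<lambda>z. f z + g z) = (\<lambda>z. remainder f z + remainder g z)"
    by (simp add: remainder_def l_add f g fun_eq_iff algebra_simps)
  show "resolvent (\<lambda>z. f z + g z) = (\<lambda>z. resolvent f z + resolvent g z)"
    unfolding resolvent_def rem
    by (simp add: neumann_add remainder_mem l_remainder f g l_add fun_eq_iff add_divide_distrib algebra_simps)
next
  fix f c assume f: "f \<in> S"
  have rem: "remainder (\<lambda>z. c * f z) = (\<lambda>z. c * remainder f z)"
    by (simp add: remainder_def l_cmult f fun_eq_iff algebra_simps)
  show "resolvent (\<lambda>z. c * f z) = (\<lambda>z. c * resolvent f z)"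
    unfolding resolvent_def rem
    by (simp add: neumann_cmult remainder_mem l_remainder f l_cmult fun_eq_iff algebra_simps)
qed

lemma not_in_spectrum: "\<xi> \<notin> spectrum_op S N T"
proof -
  have ne: "\<xi> - of_real r \<noteq> 0" using \<xi> by simp
  have "(\<lambda>z. \<xi> * resolvent f z - T (resolvent f) z) = f" if f: "f \<in> S" for f
  proof -
    let ?g = "remainder f"
    have g: "?g \<in> S" "l ?g = 0" by (simp_all add: remainder_mem l_remainder f)
    have Tres: "T (resolvent f) = (\<lambda>z. l f / (\<xi> - of_real r) * (of_real r * v z) + neumann \<xi> (T ?g) z)"
      unfolding resolvent_def bounded_opD(2)[OF T cmult_mem[OF v(1)] neumann_mem[OF g]]
        bounded_opD(3)[OF T v(1)] neumann_T(1)[OF g] v(2) ..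
    have "\<xi> * resolvent f z - T (resolvent f) z
        = (\<xi> - of_real r) * (l f / (\<xi> - of_real r) * v z) + (\<xi> * neumann \<xi> ?g z - neumann \<xi> (T ?g) z)" for z
    proof -
      have "T (resolvent f) z = l f / (\<xi> - of_real r) * (of_real r * v z) + neumann \<xi> (T ?g) z"
        using Tres by (rule fun_cong)
      then show ?thesis unfolding resolvent_def by (simp only: algebra_simps)
    qed
    also have "\<dots> z = f z" for z
      unfolding fun_cong[OF neumann_T(2)[OF g]] using ne by (simp add: remainder_def)
    finally show ?thesis by blast
  qed
  \<comment> \<open>For the other side of the inverse: the projection commutes with T, so the
    remainder of \<xi> f - T f is \<xi> g - T g, with g the remainder of f.\<close>
  moreover have "resolvent (\<lambda>z. \<xi> * f z - T f z) = f" if f: "f \<in> S" for f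
  proof -
    let ?g = "remainder f" and ?h = "\<lambda>z. \<xi> * f z - T f z"
    have g: "?g \<in> S" "l ?g = 0" by (simp_all add: remainder_mem l_remainder f)
    have Tg: "T ?g \<in> S" "l (T ?g) = 0" using bounded_opD(1)[OF T g(1)] l_T[OF g(1)] g(2) by simp_all
    have lh: "l ?h = (\<xi> - of_real r) * l f"
      using l_diff[OF cmult_mem[OF f] bounded_opD(1)[OF T f]] l_cmult[OF f] l_T[OF f] by (simp add: left_diff_distrib)
    have "remainder ?h = (\<lambda>z. \<xi> * ?g z + (-1) * T ?g z)"
      using power_remainder[OF f, of 1] unfolding remainder_def lh by (simp add: fun_eq_iff algebra_simps)
    then have "neumann \<xi> (remainder ?h) = (\<lambda>z. \<xi> * neumann \<xi> ?g z + (-1) * neumann \<xi> (T ?g) z)"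
      using neumann_add[OF cmult_mem[OF g(1)] _ cmult_mem[OF Tg(1)], of \<xi> "-1"]
        neumann_cmult[OF g, of \<xi>] neumann_cmult[OF Tg, of "-1"] l_cmult[OF g(1), of \<xi>] l_cmult[OF Tg(1), of "-1"] g(2) Tg(2)
      by simp
    also have "\<dots> = ?g" using neumann_T(2)[OF g] by simp
    finally show ?thesis
      using ne unfolding resolvent_def by (simp add: lh remainder_def)
  qed
  ultimately show ?thesis
    using resolvent_bounded unfolding spectrum_op_def by blast
qed

end

lemma spectrum_bound: "\<forall>\<xi>\<in>spectrum_op S N T - {of_real r}. cmod \<xi> \<le> q * r"
  using not_in_spectrum by force

lemma spectrum_isolated: "\<exists>\<epsilon>>0. spectrum_op S N T \<inter> ball (of_real r) \<epsilon> = {of_real r}"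
proof (intro exI conjI)
  have qr: "q * r < r" using q r by simp
  then show pos: "r - q * r > 0" by simp
  have "\<xi> = of_real r" if "\<xi> \<in> spectrum_op S N T" "\<xi> \<in> ball (of_real r) (r - q * r)" for \<xi>
  proof (rule ccontr)
    assume "\<xi> \<noteq> of_real r"
    then have "cmod \<xi> \<le> q * r" using spectrum_bound that(1) by blast
    moreover have "cmod (of_real r :: complex) \<le> cmod \<xi> + cmod (of_real r - \<xi>)"
      by (rule norm_triangle_sub)
    ultimately show False using that(2) r by (simp add: dist_norm)
  qed
  then show "spectrum_op S N T \<inter> ball (of_real r) (r - q * r) = {of_real r}"
    using r_in_spectrum pos by auto
qed

text \<open>r - T maps S into the kernel of l and is injective there, since T g = r g contradicts
  decay at rate q r unless g = 0. Hence a generalised eigenvector is an eigenvector, and its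
  remainder vanishes.\<close>

lemma eigenspace_simple:
  "{f\<in>S. \<exists>k. ((\<lambda>g z. of_real r * g z - T g z) ^^ k) f = (\<lambda>z. 0)} = {(\<lambda>z. c * v z) | c. True}"
proof (intro equalityI subsetI)
  let ?D = "\<lambda>g z. of_real r * g z - T g z"
  have Dmem: "?D g \<in> S" if "g \<in> S" for g using that by (intro diff_mem cmult_mem bounded_opD(1)[OF T])
  have lD: "l (?D g) = 0" if "g \<in> S" for g
    using l_diff[OF cmult_mem[OF that] bounded_opD(1)[OF T that]] l_cmult[OF that] l_T[OF that] by simp
  have D_inj: "g = (\<lambda>z. 0)" if g: "g \<in> S" "l g = 0" "?D g = (\<lambda>z. 0)" for g
  proof -
    have Tg: "T g = (\<lambda>z. of_real r * g z)" using fun_cong[OF g(3)] by (simp add: fun_eq_iff)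
    have "(T ^^ k) g = (\<lambda>z. of_real (r ^ k) * g z)" for k
    proof (induction k)
      case (Suc k)
      have "(T ^^ Suc k) g = (\<lambda>z. of_real (r ^ k) * T g z)"
        using Suc bounded_opD(3)[OF T g(1), of "of_real (r ^ k)"] by simp
      then show ?case by (simp add: Tg ac_simps)
    qed simp
    then have "r ^ k * N g \<le> C * (q * r) ^ k * N g" for k
      using decay[OF g(1,2), of k] norm_cmult[OF g(1), of "of_real (r ^ k)"] r by (simp add: norm_power)
    then have "r ^ k * N g \<le> r ^ k * ((C * N g) * q ^ k)" for k
      by (simp add: power_mult_distrib ac_simps)
    then have le: "N g \<le> (C * N g) * q ^ k" for k using r by (simp add: mult.assoc)
    have "(\<lambda>k. (C * N g) * q ^ k) \<longlonglongrightarrow> (C * N g) * 0"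
      using q by (intro tendsto_intros LIMSEQ_realpow_zero) auto
    then have "N g \<le> 0" using le by (intro LIMSEQ_le_const[of "\<lambda>k. (C * N g) * q ^ k"]) auto
    then show ?thesis using norm_zero_imp[OF g(1)] norm_nonneg[OF g(1)] by simp
  qed
  have D_pow: "g = (\<lambda>z. 0)" if "g \<in> S" "l g = 0" "(?D ^^ k) g = (\<lambda>z. 0)" for g k
    using that
  proof (induction k arbitrary: g)
    case (Suc k)
    have "?D g = (\<lambda>z. 0)"
      using Suc.prems(3) by (intro Suc.IH[OF Dmem[OF Suc.prems(1)] lD[OF Suc.prems(1)]]) (simp only: funpow_Suc_right comp_def)
    then show ?case by (rule D_inj[OF Suc.prems(1,2)])
  qed simp
  fix f
  {
    assume "f \<in> {f\<in>S. \<exists>k. (?D ^^ k) f = (\<lambda>z. 0)}"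
    then obtain k where f: "f \<in> S" and k: "(?D ^^ k) f = (\<lambda>z. 0)" by blast
    have D0: "?D (\<lambda>z. 0) = (\<lambda>z. 0)" by (simp add: bounded_op_zero[OF T])
    have "(?D ^^ k) (?D f) = ?D ((?D ^^ k) f)" by (rule funpow_swap1[symmetric])
    also have "\<dots> = (\<lambda>z. 0)" unfolding k by (rule D0)
    finally have "(?D ^^ k) (?D f) = (\<lambda>z. 0)" .
    then have Df: "?D f = (\<lambda>z. 0)" using D_pow Dmem[OF f] lD[OF f] by blast
    let ?g = "remainder f"
    have "?D ?g = (\<lambda>z. 0)"
      using power_remainder[OF f, of 1] fun_cong[OF Df] by (simp add: remainder_def fun_eq_iff algebra_simps)
    then have "?g = (\<lambda>z. 0)" by (rule D_inj[OF remainder_mem[OF f] l_remainder[OF f]])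
    then have "f = (\<lambda>z. l f * v z)" by (simp add: remainder_def fun_eq_iff)
    then show "f \<in> {(\<lambda>z. c * v z) | c. True}" by blast
  }
  {
    assume "f \<in> {(\<lambda>z. c * v z) | c. True}"
    then obtain c where c: "f = (\<lambda>z. c * v z)" by blast
    have "f \<in> S" unfolding c by (rule cmult_mem[OF v(1)])
    moreover have "(?D ^^ 1) f = (\<lambda>z. 0)"
      by (simp add: c bounded_opD(3)[OF T v(1)] v(2) fun_eq_iff)
    ultimately show "f \<in> {f\<in>S. \<exists>k. (?D ^^ k) f = (\<lambda>z. 0)}" by blast
  }
qed

end

section \<open>Completeness\<close>

lemma cmod_le_sup_norm:
  assumes "bounded H" "f \<in> CSpace H" "z \<in> closure H"
  shows "cmod (f z) \<le> sup_norm H f"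
proof -
  have "compact ((\<lambda>z. cmod (f z)) ` closure H)"
    using assms(1,2) by (intro compact_continuous_image continuous_intros) (auto simp: CSpace_def)
  then show ?thesis
    unfolding sup_norm_def by (intro cSUP_upper assms(3) bounded_imp_bdd_above compact_imp_bounded)
qed

lemma CSpace_normed:
  assumes H: "bounded H" "H \<noteq> {}"
  shows "function_normed_space (CSpace H) (sup_norm H)"
proof
  note upper = cmod_le_sup_norm[OF H(1)]
  have least: "sup_norm H f \<le> M" if "\<And>z. z \<in> closure H \<Longrightarrow> cmod (f z) \<le> M" for f M
    unfolding sup_norm_def using H(2) that by (intro cSUP_least) auto
  obtain z0 where z0: "z0 \<in> closure H" using H(2) closure_subset by fastforce
  show "(\<lambda>z. 0) \<in> CSpace H" by (simp add: CSpace_def)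
  show add: "(\<lambda>z. f z + g z) \<in> CSpace H" if "f \<in> CSpace H" "g \<in> CSpace H" for f g
    using that by (auto simp: CSpace_def intro!: continuous_intros)
  show cm: "(\<lambda>z. c * f z) \<in> CSpace H" if "f \<in> CSpace H" for f c
    using that by (auto simp: CSpace_def intro!: continuous_intros)
  show "sup_norm H (\<lambda>z. f z + g z) \<le> sup_norm H f + sup_norm H g" if "f \<in> CSpace H" "g \<in> CSpace H" for f g
    by (rule least, rule norm_triangle_le) (intro add_mono upper that)
  have le: "sup_norm H (\<lambda>z. c * f z) \<le> cmod c * sup_norm H f" if "f \<in> CSpace H" for f c
    by (rule least) (simp add: norm_mult mult_left_mono upper that)
  show "sup_norm H (\<lambda>z. c * f z) = cmod c * sup_norm H f" if f: "f \<in> CSpace H" for f c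
  proof (cases "c = 0")
    case True
    then show ?thesis using le[OF f, of c] order_trans[OF norm_ge_zero upper[OF cm[OF f] z0], of c] by simp
  next
    case False
    have "sup_norm H f \<le> inverse (cmod c) * sup_norm H (\<lambda>z. c * f z)"
      using le[OF cm[OF f, of c], of "inverse c"] False by (simp add: mult.assoc[symmetric] norm_inverse)
    then have "cmod c * sup_norm H f \<le> sup_norm H (\<lambda>z. c * f z)"
      using False by (simp add: field_simps)
    then show ?thesis using le[OF f, of c] by simp
  qed
qed

text \<open>Every entry converges uniformly on the closure by the M-test. Termwise differentiation
  is applied on a ball inside H, where convexity is available.\<close>

lemma jet_geometric_series:
  assumes H: "open H" and q: "0 \<le> q" "q < 1"
    and W: "\<And>n. wirtinger_jet H m (W n)"
    and b: "\<And>n i j z. i + j \<le> m \<Longrightarrow> z \<in> closure H \<Longrightarrow> cmod (W n i j z) \<le> C * q ^ n"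
  shows "i + j \<le> m \<Longrightarrow> z \<in> closure H \<Longrightarrow> summable (\<lambda>n. W n i j z)"
    and "i + j \<le> m \<Longrightarrow> z \<in> closure H \<Longrightarrow> cmod (\<Sum>n. W n i j z) \<le> C / (1 - q)"
    and "wirtinger_jet H m (\<lambda>i j z. \<Sum>n. W n i j z)"
proof -
  have geo: "(\<lambda>n. C * q ^ n) sums (C / (1 - q))"
    using sums_mult[OF geometric_sums, of q C] q by simp
  have sn: "summable (\<lambda>n. cmod (W n i j z))" if "i + j \<le> m" "z \<in> closure H" for i j z
    by (rule summable_comparison_test'[OF sums_summable[OF geo]]) (use b that in auto)
  show s: "summable (\<lambda>n. W n i j z)" if "i + j \<le> m" "z \<in> closure H" for i j z
    by (rule summable_norm_cancel[OF sn[OF that]])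
  show "cmod (\<Sum>n. W n i j z) \<le> C / (1 - q)" if "i + j \<le> m" "z \<in> closure H" for i j z
    using order_trans[OF summable_norm[OF sn[OF that]] suminf_le[OF b[OF that] sn[OF that] sums_summable[OF geo]]]
    by (simp add: sums_unique[OF geo, symmetric])
  have unif: "uniform_limit (closure H) (\<lambda>n z. \<Sum>k<n. W k i j z) (\<lambda>z. \<Sum>k. W k i j z) sequentially"
    if "i + j \<le> m" for i j
    by (rule Weierstrass_m_test[OF _ sums_summable[OF geo]]) (rule b[OF that])
  show "wirtinger_jet H m (\<lambda>i j z. \<Sum>n. W n i j z)"
    unfolding jet_def
  proof (intro conjI allI impI ballI)
    fix i j assume ij: "i + j \<le> m"
    show "continuous_on (closure H) (\<lambda>z. \<Sum>n. W n i j z)"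
      by (rule uniform_limit_theorem[OF always_eventually unif[OF ij]])
        (use ij in \<open>auto intro!: continuous_intros jet_continuous[OF W]\<close>)
  next
    fix i j z assume ij: "i + j < m" and z: "z \<in> H"
    obtain d where d: "d > 0" "ball z d \<subseteq> H" using H z open_contains_ball by blast
    have sub: "ball z d \<subseteq> closure H" using d(2) closure_subset by blast
    let ?g' = "\<lambda>x h. h * (\<Sum>n. W n (Suc i) j x) + cnj h * (\<Sum>n. W n i (Suc j) x)"
    have "\<exists>g. \<forall>x\<in>ball z d. (\<lambda>n. W n i j x) sums g x \<and> (g has_derivative ?g' x) (at x within ball z d)"
    proof (rule has_derivative_series[where f' = "\<lambda>n x h. h * W n (Suc i) j x + cnj h * W n i (Suc j) x" and x = z])
      show "(W n i j has_derivative (\<lambda>h. h * W n (Suc i) j x + cnj h * W n i (Suc j) x)) (at x within ball z d)"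
        if "x \<in> ball z d" for n x
        by (rule has_derivative_at_withinI[OF jet_has_derivative[OF W ij]]) (use that d(2) in blast)
      fix e :: real assume e: "e > 0"
      \<comment> \<open>Half of e for each of the two terms of the differential.\<close>
      have ev: "\<forall>\<^sub>F n in sequentially. \<forall>x\<in>closure H. dist (\<Sum>k<n. W k (Suc i) j x) (\<Sum>k. W k (Suc i) j x) < e / 2"
        "\<forall>\<^sub>F n in sequentially. \<forall>x\<in>closure H. dist (\<Sum>k<n. W k i (Suc j) x) (\<Sum>k. W k i (Suc j) x) < e / 2"
        using uniform_limitD[OF unif[of "Suc i" j], of "e / 2"] uniform_limitD[OF unif[of i "Suc j"], of "e / 2"] ij e by simp_all
      show "\<forall>\<^sub>F n in sequentially. \<forall>x\<in>ball z d. \<forall>h.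
          norm ((\<Sum>k<n. h * W k (Suc i) j x + cnj h * W k i (Suc j) x) - ?g' x h) \<le> e * norm h"
        using ev
      proof eventually_elim
        case (elim n)
        show ?case
        proof (intro ballI allI)
          fix x h assume "x \<in> ball z d"
          with sub have xc: "x \<in> closure H" by blast
          have "norm ((\<Sum>k<n. h * W k (Suc i) j x + cnj h * W k i (Suc j) x) - ?g' x h)
            = norm (h * ((\<Sum>k<n. W k (Suc i) j x) - (\<Sum>k. W k (Suc i) j x)) + cnj h * ((\<Sum>k<n. W k i (Suc j) x) - (\<Sum>k. W k i (Suc j) x)))"
            by (simp add: sum.distrib sum_distrib_left[symmetric] algebra_simps)
          also have "\<dots> \<le> norm h * (e / 2) + norm h * (e / 2)"
            using bspec[OF elim(1) xc] bspec[OF elim(2) xc] unfolding dist_norm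
            by (intro norm_triangle_le add_mono) (auto simp only: norm_mult complex_mod_cnj intro!: mult_left_mono[OF less_imp_le] norm_ge_zero)
          finally show "norm ((\<Sum>k<n. h * W k (Suc i) j x + cnj h * W k i (Suc j) x) - ?g' x h) \<le> e * norm h"
            by (simp add: algebra_simps)
        qed
      qed
    next
      show "(\<lambda>n. W n i j z) sums (\<Sum>n. W n i j z)"
        using s[of i j z] ij z closure_subset by (intro summable_sums) auto
    qed (use d in auto)
    then obtain g where g: "\<And>x. x \<in> ball z d \<Longrightarrow> (\<lambda>n. W n i j x) sums g x"
      "\<And>x. x \<in> ball z d \<Longrightarrow> (g has_derivative ?g' x) (at x within ball z d)"
      by blast
    have zb: "z \<in> ball z d" using d(1) by simp
    have "(g has_derivative ?g' z) (at z)" using g(2)[OF zb] at_within_open[OF zb] by simp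
    then show "((\<lambda>z. \<Sum>n. W n i j z) has_derivative ?g' z) (at z)"
      by (rule has_derivative_transform_within_open[OF _ open_ball zb]) (rule sums_unique[OF g(1)])
  qed
qed

text \<open>Series lose the factor 2^m because the sum is bounded through its Wirtinger jet. For
  sums and multiples the real derivatives are compared directly, so that the norm laws hold without
  loss.\<close>

lemma CmSpace_banach:
  assumes H: "open H" "bounded H" "H \<noteq> {}"
  shows "function_banach_space (CmSpace H m) (Cm_norm H m) (2 ^ m)"
proof
  have sub: "H \<subseteq> closure H" by (rule closure_subset)
  obtain z0 where z0: "z0 \<in> H" using H(3) by blast
  have out: "f z = 0" if "f \<in> CmSpace H m" "z \<notin> closure H" for f z
    using that by (simp add: CmSpace_def)
  show "(\<lambda>z. 0) \<in> CmSpace H m"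
    by (rule CmSpaceI[OF H(1), of m "\<lambda>i j z. 0"]) (auto simp: jet_def)
  have add: "(\<lambda>z. f z + g z) \<in> CmSpace H m \<and> Cm_norm H m (\<lambda>z. f z + g z) \<le> Cm_norm H m f + Cm_norm H m g"
    if f: "f \<in> CmSpace H m" and g: "g \<in> CmSpace H m" for f g
  proof -
    obtain W where W: "wirtinger_jet H m W" "\<And>z. z \<in> closure H \<Longrightarrow> W 0 0 z = f z"
      "\<And>i j z. i + j \<le> m \<Longrightarrow> z \<in> closure H \<Longrightarrow> cmod (W i j z) \<le> Cm_norm H m f"
      using CmSpace_jet[OF H(1,2) f] by metis
    obtain V where V: "wirtinger_jet H m V" "\<And>z. z \<in> closure H \<Longrightarrow> V 0 0 z = g z"
      "\<And>i j z. i + j \<le> m \<Longrightarrow> z \<in> closure H \<Longrightarrow> cmod (V i j z) \<le> Cm_norm H m g"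
      using CmSpace_jet[OF H(1,2) g] by metis
    note WV = jet_add[OF W(1) V(1)]
    have "Cm_norm H m (\<lambda>z. f z + g z) \<le> Cm_norm H m f + Cm_norm H m g"
    proof (rule Cm_norm_least[OF H(3)])
      fix a b z assume ab: "a + b \<le> m" and z: "z \<in> H"
      have "Dmi (a, b) (\<lambda>z. f z + g z) z = dirs (replicate a 1 @ replicate b \<i>) (\<lambda>i j z. W i j z + V i j z) 0 0 z"
        by (rule Dmi_jet[OF H(1) WV _ z ab]) (use W(2) V(2) sub in auto)
      also have "\<dots> = Dmi (a, b) f z + Dmi (a, b) g z"
        unfolding dirs_add
        by (intro arg_cong2[of _ _ _ _ "(+)"] Dmi_jet[OF H(1) W(1) _ z ab, symmetric] Dmi_jet[OF H(1) V(1) _ z ab, symmetric])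
          (use W(2) V(2) sub in auto)
      finally show "cmod (Dmi (a, b) (\<lambda>z. f z + g z) z) \<le> Cm_norm H m f + Cm_norm H m g"
        using norm_triangle_ineq[of "Dmi (a, b) f z" "Dmi (a, b) g z"]
          cmod_Dmi_le_Cm_norm[OF H(2) f ab z] cmod_Dmi_le_Cm_norm[OF H(2) g ab z] by simp
    qed
    moreover have "(\<lambda>z. f z + g z) \<in> CmSpace H m"
      by (rule CmSpaceI[OF H(1) WV]) (use W(2) V(2) out[OF f] out[OF g] in auto)
    ultimately show ?thesis by blast
  qed
  show "(\<lambda>z. f z + g z) \<in> CmSpace H m" "Cm_norm H m (\<lambda>z. f z + g z) \<le> Cm_norm H m f + Cm_norm H m g"
    if "f \<in> CmSpace H m" "g \<in> CmSpace H m" for f g using add[OF that] by auto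
  have cm: "(\<lambda>z. c * f z) \<in> CmSpace H m \<and> Cm_norm H m (\<lambda>z. c * f z) \<le> cmod c * Cm_norm H m f"
    if f: "f \<in> CmSpace H m" for f c
  proof -
    obtain W where W: "wirtinger_jet H m W" "\<And>z. z \<in> closure H \<Longrightarrow> W 0 0 z = f z"
      "\<And>i j z. i + j \<le> m \<Longrightarrow> z \<in> closure H \<Longrightarrow> cmod (W i j z) \<le> Cm_norm H m f"
      using CmSpace_jet[OF H(1,2) f] by metis
    note cW = jet_cmult[OF W(1), of c]
    have "Cm_norm H m (\<lambda>z. c * f z) \<le> cmod c * Cm_norm H m f"
    proof (rule Cm_norm_least[OF H(3)])
      fix a b z assume ab: "a + b \<le> m" and z: "z \<in> H"
      have "Dmi (a, b) (\<lambda>z. c * f z) z = dirs (replicate a 1 @ replicate b \<i>) (\<lambda>i j z. c * W i j z) 0 0 z"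
        by (rule Dmi_jet[OF H(1) cW _ z ab]) (use W(2) sub in auto)
      also have "\<dots> = c * Dmi (a, b) f z"
        unfolding dirs_cmult
        by (intro arg_cong2[of _ _ _ _ "(*)"] Dmi_jet[OF H(1) W(1) _ z ab, symmetric]) (use W(2) sub in auto)
      finally show "cmod (Dmi (a, b) (\<lambda>z. c * f z) z) \<le> cmod c * Cm_norm H m f"
        using cmod_Dmi_le_Cm_norm[OF H(2) f ab z] by (simp add: norm_mult mult_left_mono)
    qed
    moreover have "(\<lambda>z. c * f z) \<in> CmSpace H m"
      by (rule CmSpaceI[OF H(1) cW]) (use W(2) out[OF f] in auto)
    ultimately show ?thesis by blast
  qed
  show "(\<lambda>z. c * f z) \<in> CmSpace H m" if "f \<in> CmSpace H m" for f c using cm[OF that] by auto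
  have nonneg: "Cm_norm H m f \<ge> 0" if "f \<in> CmSpace H m" for f
    using order_trans[OF norm_ge_zero cmod_Dmi_le_Cm_norm[OF H(2) that, of 0 0 z0]] z0 by simp
  show "Cm_norm H m (\<lambda>z. c * f z) = cmod c * Cm_norm H m f" if f: "f \<in> CmSpace H m" for f c
  proof (cases "c = 0")
    case True
    then show ?thesis using cm[OF f, of c] nonneg[of "\<lambda>z. c * f z"] by simp
  next
    case False
    have "Cm_norm H m f \<le> inverse (cmod c) * Cm_norm H m (\<lambda>z. c * f z)"
      using cm[of "\<lambda>z. c * f z" "inverse c"] cm[OF f, of c] False by (simp add: mult.assoc[symmetric] norm_inverse)
    then have "cmod c * Cm_norm H m f \<le> Cm_norm H m (\<lambda>z. c * f z)"
      using False by (simp add: field_simps)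
    then show ?thesis using cm[OF f, of c] by simp
  qed
  show "f = (\<lambda>z. 0)" if f: "f \<in> CmSpace H m" "Cm_norm H m f = 0" for f
  proof
    fix z
    obtain W where "wirtinger_jet H m W" and W: "\<And>z. z \<in> closure H \<Longrightarrow> W 0 0 z = f z"
      "\<And>i j z. i + j \<le> m \<Longrightarrow> z \<in> closure H \<Longrightarrow> cmod (W i j z) \<le> Cm_norm H m f"
      using CmSpace_jet[OF H(1,2) f(1)] by metis
    show "f z = 0" using W(1)[of z] W(2)[of 0 0 z] f(2) out[OF f(1), of z] by (cases "z \<in> closure H") auto
  qed
  fix F :: "nat \<Rightarrow> complex \<Rightarrow> complex" and C q :: real
  assume F: "\<And>n. F n \<in> CmSpace H m" and q: "0 \<le> q" "q < 1" and b: "\<And>n. Cm_norm H m (F n) \<le> C * q ^ n"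
  have "\<exists>W. wirtinger_jet H m W \<and> (\<forall>z\<in>closure H. W 0 0 z = F n z) \<and>
    (\<forall>i j z. i + j \<le> m \<longrightarrow> z \<in> closure H \<longrightarrow> cmod (W i j z) \<le> C * q ^ n)" for n
  proof -
    obtain W where "wirtinger_jet H m W" "\<forall>z\<in>closure H. W 0 0 z = F n z"
      "\<forall>i j z. i + j \<le> m \<longrightarrow> z \<in> closure H \<longrightarrow> cmod (W i j z) \<le> Cm_norm H m (F n)"
      using CmSpace_jet[OF H(1,2) F] by blast
    then show ?thesis using b[of n] by (intro exI[of _ W]) force
  qed
  then obtain W where W: "\<And>n. wirtinger_jet H m (W n)" "\<And>n z. z \<in> closure H \<Longrightarrow> W n 0 0 z = F n z"
    "\<And>n i j z. i + j \<le> m \<Longrightarrow> z \<in> closure H \<Longrightarrow> cmod (W n i j z) \<le> C * q ^ n"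
    by metis
  note U = jet_geometric_series[OF H(1) q W(1,3)]
  have "summable (\<lambda>n. F n z)" for z
    using U(1)[of 0 0 z] W(2) out[OF F] by (cases "z \<in> closure H") auto
  moreover have "(\<lambda>z. \<Sum>n. F n z) \<in> CmSpace H m"
    by (rule CmSpaceI[OF H(1) U(3)]) (use W(2) out[OF F] in auto)
  moreover have "Cm_norm H m (\<lambda>z. \<Sum>n. F n z) \<le> 2 ^ m * (C / (1 - q))"
    by (rule Cm_norm_le_jet[OF H(1,3) U(3)]) (use W(2) sub U(2) in auto)
  ultimately show "(\<forall>z. summable (\<lambda>n. F n z)) \<and> (\<lambda>z. \<Sum>n. F n z) \<in> CmSpace H m \<and>
      Cm_norm H m (\<lambda>z. \<Sum>n. F n z) \<le> 2 ^ m * C / (1 - q)"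
    by simp
qed simp

section \<open>Contraction of Markov averages\<close>

text \<open>With t = |d| the modulus is t |b + 1/d|, and Re (1/d) is at least \<gamma>/t^2, so it is
  at least \<gamma> t + \<gamma>/t. This is increasing for t \<ge> 1 and equals \<gamma>^2 + 1 at t
  = \<gamma>.\<close>

lemma norm_mult_add_one_ge:
  fixes b d :: complex
  assumes "\<gamma> \<ge> 1" "Re b \<ge> \<gamma>" "Re d \<ge> \<gamma>"
  shows "cmod (b * d + 1) \<ge> \<gamma>\<^sup>2 + 1"
proof -
  define t where "t = cmod d"
  have t: "t \<ge> \<gamma>" "t > 0" using assms complex_Re_le_cmod[of d] by (auto simp: t_def)
  then have d0: "d \<noteq> 0" by (auto simp: t_def)
  have "\<gamma> + \<gamma> / t\<^sup>2 \<le> Re b + Re d / t\<^sup>2" using assms t by (intro add_mono divide_right_mono) auto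
  also have "\<dots> = Re (b + 1 / d)"
    by (simp add: Re_divide t_def cmod_power2)
  also have "\<dots> \<le> cmod (b + 1 / d)" by (rule complex_Re_le_cmod)
  finally have "t * (\<gamma> + \<gamma> / t\<^sup>2) \<le> t * cmod (b + 1 / d)" using t by (intro mult_left_mono) auto
  also have "t * cmod (b + 1 / d) = cmod (b * d + 1)"
    using d0 by (simp add: t_def norm_mult[symmetric] algebra_simps)
  also have "t * (\<gamma> + \<gamma> / t\<^sup>2) = \<gamma> * t + \<gamma> / t" using t by (simp add: power2_eq_square field_simps)
  finally have *: "\<gamma> * t + \<gamma> / t \<le> cmod (b * d + 1)" .
  have "t * \<gamma> \<ge> 1" using mult_mono[of 1 t 1 \<gamma>] t assms(1) by simp
  \<comment> \<open>The product is t times the difference of the two sides of the claim.\<close>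
  then have "(t - \<gamma>) * (t * \<gamma> - 1) \<ge> 0" using t by simp
  then have "(\<gamma>\<^sup>2 + 1) * t \<le> (\<gamma> * t + \<gamma> / t) * t"
    using t by (simp add: power2_eq_square algebra_simps)
  then have "\<gamma>\<^sup>2 + 1 \<le> \<gamma> * t + \<gamma> / t" using t by simp
  with * show ?thesis by simp
qed

text \<open>Inversion maps the line Re w = \<gamma> to the circle with diameter from 0 to
  1/\<gamma>. The distance from its centre to 1/w is |2 \<gamma> - w| / |w| times the radius, and
  |w|^2 - |2 \<gamma> - w|^2 = 4 \<gamma> (Re w - \<gamma>).\<close>

lemma inverse_in_disc:
  fixes w :: complex
  assumes "\<gamma> \<ge> 1"
  shows "Re w > \<gamma> \<Longrightarrow> 1 / w \<in> ball (of_real (1 / (2 * \<gamma>))) (1 / (2 * \<gamma>))"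
    and "Re w \<ge> \<gamma> \<Longrightarrow> 1 / w \<in> cball (of_real (1 / (2 * \<gamma>))) (1 / (2 * \<gamma>))"
proof -
  have sq: "(cmod (of_real (2 * \<gamma>) - w))\<^sup>2 = (cmod w)\<^sup>2 - 4 * \<gamma> * (Re w - \<gamma>)"
    unfolding cmod_power2 by (simp add: power2_eq_square algebra_simps)
  have eq: "dist (of_real (1 / (2 * \<gamma>))) (1 / w) = cmod (of_real (2 * \<gamma>) - w) / cmod w * (1 / (2 * \<gamma>))"
    if "w \<noteq> 0"
  proof -
    have "of_real (1 / (2 * \<gamma>)) - 1 / w = - (of_real (2 * \<gamma>) - w) / w * of_real (1 / (2 * \<gamma>))"
      using that assms by (simp add: field_simps)
    then show ?thesis unfolding dist_norm using assms by (simp add: norm_mult norm_divide norm_minus_commute del: of_real_mult of_real_divide)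
  qed
  show "1 / w \<in> ball (of_real (1 / (2 * \<gamma>))) (1 / (2 * \<gamma>))" if w: "Re w > \<gamma>"
  proof -
    have w0: "w \<noteq> 0" using w assms by auto
    have "0 < 4 * \<gamma> * (Re w - \<gamma>)" using w assms by (intro mult_pos_pos) auto
    then have "(cmod (of_real (2 * \<gamma>) - w))\<^sup>2 < (cmod w)\<^sup>2" unfolding sq by simp
    then have "cmod (of_real (2 * \<gamma>) - w) < cmod w" by (rule power2_less_imp_less) simp
    then have "cmod (of_real (2 * \<gamma>) - w) / cmod w < 1" using w0 by simp
    then have "cmod (of_real (2 * \<gamma>) - w) / cmod w * (1 / (2 * \<gamma>)) < 1 * (1 / (2 * \<gamma>))"
      using assms by (intro mult_strict_right_mono) auto
    then show ?thesis unfolding mem_ball eq[OF w0] by (simp only: mult_1)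
  qed
  show "1 / w \<in> cball (of_real (1 / (2 * \<gamma>))) (1 / (2 * \<gamma>))" if w: "Re w \<ge> \<gamma>"
  proof -
    have w0: "w \<noteq> 0" using w assms by auto
    have "0 \<le> 4 * \<gamma> * (Re w - \<gamma>)" using w assms by (intro mult_nonneg_nonneg) auto
    then have "(cmod (of_real (2 * \<gamma>) - w))\<^sup>2 \<le> (cmod w)\<^sup>2" unfolding sq by simp
    then have "cmod (of_real (2 * \<gamma>) - w) \<le> cmod w" by (rule power2_le_imp_le) simp
    then have "cmod (of_real (2 * \<gamma>) - w) / cmod w \<le> 1" using w0 by simp
    then have "cmod (of_real (2 * \<gamma>) - w) / cmod w * (1 / (2 * \<gamma>)) \<le> 1 * (1 / (2 * \<gamma>))"
      using assms by (intro mult_right_mono) auto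
    then show ?thesis unfolding mem_cball eq[OF w0] by (simp only: mult_1)
  qed
qed

text \<open>A single step of the chain: \<open>p i x\<close> is the probability of moving from x to
  \<open>\<theta> i x\<close>. The chain is inhomogeneous, so steps are treated one at a time, and
  uniformity is carried by c and \<kappa>. As the diameter is at most 1, probabilities at two points
  differ at most by the factor exp c.\<close>

locale markov_step =
  fixes I :: "'i set" and D :: "complex set" and p :: "'i \<Rightarrow> complex \<Rightarrow> real" and \<theta> :: "'i \<Rightarrow> complex \<Rightarrow> complex"
    and c \<kappa> :: real
  assumes fin: "finite I" and nonneg: "\<And>i x. i \<in> I \<Longrightarrow> x \<in> D \<Longrightarrow> p i x \<ge> 0"
    and sum1: "\<And>x. x \<in> D \<Longrightarrow> (\<Sum>i\<in>I. p i x) = 1"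
    and log_lip: "\<And>i x y. i \<in> I \<Longrightarrow> x \<in> D \<Longrightarrow> y \<in> D \<Longrightarrow> p i x \<le> exp (c * cmod (x - y)) * p i y"
    and maps: "\<And>i x. i \<in> I \<Longrightarrow> x \<in> D \<Longrightarrow> \<theta> i x \<in> D"
    and lip: "\<And>i x y. i \<in> I \<Longrightarrow> x \<in> D \<Longrightarrow> y \<in> D \<Longrightarrow> cmod (\<theta> i x - \<theta> i y) \<le> \<kappa> * cmod (x - y)"
    and diam: "\<And>x y. x \<in> D \<Longrightarrow> y \<in> D \<Longrightarrow> cmod (x - y) \<le> 1"
    and c: "c \<ge> 0" and \<kappa>: "\<kappa> \<ge> 0"
begin

definition avg :: "(complex \<Rightarrow> complex) \<Rightarrow> complex \<Rightarrow> complex" where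
  "avg h x = (\<Sum>i\<in>I. of_real (p i x) * h (\<theta> i x))"

lemma sum1_complex: "x \<in> D \<Longrightarrow> (\<Sum>i\<in>I. complex_of_real (p i x)) = 1"
  using sum1[of x] by (metis of_real_1 of_real_sum)

text \<open>A mean of points of a disc lies in the disc. This keeps later iterates near a value once
  an earlier one is.\<close>

lemma avg_near:
  assumes "\<And>y. y \<in> D \<Longrightarrow> cmod (h y - z) \<le> R" "x \<in> D"
  shows "cmod (avg h x - z) \<le> R"
proof -
  have "avg h x - z = (\<Sum>i\<in>I. of_real (p i x) * (h (\<theta> i x) - z))"
    unfolding avg_def using sum1_complex[OF assms(2)] by (simp add: right_diff_distrib sum_subtractf sum_distrib_right[symmetric])
  also have "cmod \<dots> \<le> (\<Sum>i\<in>I. p i x * R)"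
    using nonneg assms maps by (intro order_trans[OF norm_sum] sum_mono) (auto simp: norm_mult intro!: mult_left_mono)
  also have "\<dots> = R" using sum1[OF assms(2)] by (simp add: sum_distrib_right[symmetric])
  finally show ?thesis .
qed

text \<open>The target points are moved first, with the probabilities of x; then the probabilities
  are changed at the targets of y. The first change is paid by the Lipschitz bound, the second is
  left open for two different estimates.\<close>

lemma avg_diff_split:
  assumes h: "\<And>x y. x \<in> D \<Longrightarrow> y \<in> D \<Longrightarrow> cmod (h x - h y) \<le> L * cmod (x - y)" and L: "L \<ge> 0"
    and x: "x \<in> D" and y: "y \<in> D"
  shows "cmod (avg h x - avg h y) \<le> \<kappa> * L * cmod (x - y) + cmod (\<Sum>i\<in>I. of_real (p i x - p i y) * h (\<theta> i y))"
proof -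
  let ?A = "\<Sum>i\<in>I. of_real (p i x) * (h (\<theta> i x) - h (\<theta> i y))"
  let ?B = "\<Sum>i\<in>I. of_real (p i x - p i y) * h (\<theta> i y)"
  have "avg h x - avg h y = ?A + ?B"
    unfolding avg_def by (simp add: algebra_simps sum_subtractf sum.distrib)
  moreover have "cmod ?A \<le> \<kappa> * L * cmod (x - y)"
  proof -
    have "cmod ?A \<le> (\<Sum>i\<in>I. p i x * (\<kappa> * L * cmod (x - y)))"
    proof (intro order_trans[OF norm_sum] sum_mono)
      fix i assume i: "i \<in> I"
      have "cmod (h (\<theta> i x) - h (\<theta> i y)) \<le> L * (\<kappa> * cmod (x - y))"
        by (intro order_trans[OF h] mult_left_mono lip maps i x y L)
      from mult_left_mono[OF this nonneg[OF i x]]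
      show "cmod (of_real (p i x) * (h (\<theta> i x) - h (\<theta> i y))) \<le> p i x * (\<kappa> * L * cmod (x - y))"
        using nonneg[OF i x] by (simp add: norm_mult ac_simps)
    qed
    also have "\<dots> = (\<Sum>i\<in>I. p i x) * (\<kappa> * L * cmod (x - y))" by (rule sum_distrib_right[symmetric])
    finally show ?thesis using sum1[OF x] by simp
  qed
  ultimately show ?thesis using norm_triangle_ineq[of ?A ?B] by simp
qed

text \<open>Doeblin's argument: \<open>p i x\<close> and \<open>p i y\<close> share the mass \<open>exp (- c) * p i y\<close>, and only the
  remaining mass \<open>1 - exp (- c)\<close> sees the oscillation of \<open>h\<close>.\<close>

lemma avg_osc:
  assumes h: "\<And>x y. x \<in> D \<Longrightarrow> y \<in> D \<Longrightarrow> cmod (h x - h y) \<le> L * cmod (x - y)" and L: "L \<ge> 0"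
    and osc: "\<And>x y. x \<in> D \<Longrightarrow> y \<in> D \<Longrightarrow> cmod (h x - h y) \<le> R"
    and x: "x \<in> D" and y: "y \<in> D"
  shows "cmod (avg h x - avg h y) \<le> (1 - exp (- c)) * R + \<kappa> * L"
proof -
  define \<delta> where "\<delta> = exp (- c)"
  let ?\<alpha> = "\<lambda>i. p i x - \<delta> * p i y"
  let ?u = "\<lambda>i. h (\<theta> i y)"
  have \<alpha>: "?\<alpha> i \<ge> 0" if "i \<in> I" for i
  proof -
    have "p i y \<le> exp (c * cmod (y - x)) * p i x" by (rule log_lip[OF that y x])
    also have "\<dots> \<le> exp c * p i x"
      using diam[OF y x] c nonneg[OF that x] by (intro mult_right_mono) (auto simp: mult_left_le)
    finally have "\<delta> * p i y \<le> \<delta> * (exp c * p i x)" by (intro mult_left_mono) (simp_all add: \<delta>_def)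
    also have "\<dots> = p i x" by (simp add: \<delta>_def exp_minus)
    finally show ?thesis by simp
  qed
  have s\<alpha>: "(\<Sum>i\<in>I. ?\<alpha> i) = 1 - \<delta>"
    using sum1[OF x] sum1[OF y] by (simp add: sum_subtractf sum_distrib_left[symmetric])
  have "(\<Sum>i\<in>I. of_real (p i x - p i y) * ?u i) = (\<Sum>i\<in>I. of_real (?\<alpha> i) * ?u i) - of_real (1 - \<delta>) * (\<Sum>j\<in>I. of_real (p j y) * ?u j)"
    by (simp add: sum_distrib_left sum_subtractf[symmetric] algebra_simps)
  \<comment> \<open>Multiplying each sum by the total mass of the other family produces a double
    sum, in which h enters only through differences of values.\<close>
  also have "\<dots> = (\<Sum>i\<in>I. of_real (?\<alpha> i) * ?u i) * (\<Sum>j\<in>I. of_real (p j y)) - (\<Sum>i\<in>I. of_real (?\<alpha> i)) * (\<Sum>j\<in>I. of_real (p j y) * ?u j)"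
    unfolding s\<alpha>[symmetric] of_real_sum sum1_complex[OF y] by simp
  also have "\<dots> = (\<Sum>i\<in>I. \<Sum>j\<in>I. of_real (?\<alpha> i * p j y) * (?u i - ?u j))"
    unfolding sum_product sum_subtractf[symmetric] by (intro sum.cong refl) (simp add: algebra_simps)
  finally have eq: "(\<Sum>i\<in>I. of_real (p i x - p i y) * ?u i) = (\<Sum>i\<in>I. \<Sum>j\<in>I. of_real (?\<alpha> i * p j y) * (?u i - ?u j))" .
  have "cmod (\<Sum>i\<in>I. of_real (p i x - p i y) * ?u i) \<le> (\<Sum>i\<in>I. \<Sum>j\<in>I. ?\<alpha> i * p j y * R)"
    unfolding eq
  proof (intro order_trans[OF norm_sum] sum_mono)
    fix i j assume i: "i \<in> I" and j: "j \<in> I"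
    have "cmod (of_real (?\<alpha> i * p j y) * (?u i - ?u j)) = (?\<alpha> i * p j y) * cmod (?u i - ?u j)"
      using \<alpha>[OF i] nonneg[OF j y] by (simp only: norm_mult norm_of_real abs_of_nonneg mult_nonneg_nonneg)
    also have "\<dots> \<le> ?\<alpha> i * p j y * R"
      using \<alpha>[OF i] nonneg[OF j y] by (intro mult_left_mono osc maps i j y mult_nonneg_nonneg) auto
    finally show "cmod (of_real (?\<alpha> i * p j y) * (?u i - ?u j)) \<le> ?\<alpha> i * p j y * R" .
  qed
  also have "\<dots> = (\<Sum>i\<in>I. ?\<alpha> i) * (\<Sum>j\<in>I. p j y) * R"
    by (subst sum_product) (simp only: sum_distrib_right)
  also have "\<dots> = (1 - \<delta>) * R" using s\<alpha> sum1[OF y] by simp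
  finally have "cmod (\<Sum>i\<in>I. of_real (p i x - p i y) * ?u i) \<le> (1 - \<delta>) * R" .
  moreover have "\<kappa> * L * cmod (x - y) \<le> \<kappa> * L * 1"
    using diam[OF x y] \<kappa> L by (intro mult_left_mono) auto
  ultimately show ?thesis using avg_diff_split[OF h L x y] by (simp add: \<delta>_def)
qed

text \<open>The Lipschitz constant shrinks by \<kappa>, at the price of a multiple of the
  oscillation. The factor 2 c exp c bounds the total variation of the probabilities per unit of
  distance.\<close>

lemma avg_lip:
  assumes h: "\<And>x y. x \<in> D \<Longrightarrow> y \<in> D \<Longrightarrow> cmod (h x - h y) \<le> L * cmod (x - y)" and L: "L \<ge> 0"
    and osc: "\<And>x y. x \<in> D \<Longrightarrow> y \<in> D \<Longrightarrow> cmod (h x - h y) \<le> R"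
    and x: "x \<in> D" and y: "y \<in> D"
  shows "cmod (avg h x - avg h y) \<le> (\<kappa> * L + 2 * c * exp c * R) * cmod (x - y)"
proof -
  have R: "R \<ge> 0" using osc[OF x x] by simp
  let ?t = "c * exp c * cmod (x - y)"
  have e: "exp (c * cmod (x - y)) \<le> 1 + ?t"
  proof -
    let ?a = "c * cmod (x - y)"
    \<comment> \<open>From exp (- a) \<ge> 1 - a follows exp a \<le> 1 + a exp a, a bound linear in
      the distance.\<close>
    have "1 - ?a \<le> exp (- ?a)" using exp_ge_add_one_self[of "- ?a"] by simp
    then have "exp ?a * (1 - ?a) \<le> exp ?a * exp (- ?a)" by (intro mult_left_mono) auto
    then have "exp ?a \<le> 1 + ?a * exp ?a" by (simp add: exp_minus algebra_simps)
    also have "?a * exp ?a \<le> ?a * exp c"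
      using c diam[OF x y] by (intro mult_left_mono) (auto simp: mult_left_le)
    finally show ?thesis by (simp add: ac_simps)
  qed
  have pd: "\<bar>p i x - p i y\<bar> \<le> ?t * (p i x + p i y)" if i: "i \<in> I" for i
  proof -
    have t0: "?t \<ge> 0" using c by simp
    have "p i x \<le> (1 + ?t) * p i y"
      by (rule order_trans[OF log_lip[OF i x y] mult_right_mono[OF e nonneg[OF i y]]])
    moreover have "p i y \<le> (1 + ?t) * p i x"
      using order_trans[OF log_lip[OF i y x]] mult_right_mono[OF e nonneg[OF i x]] by (simp add: norm_minus_commute)
    ultimately show ?thesis
      using mult_nonneg_nonneg[OF t0 nonneg[OF i x]] mult_nonneg_nonneg[OF t0 nonneg[OF i y]]
      by (simp add: abs_le_iff algebra_simps)
  qed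
  \<comment> \<open>The differences of probabilities sum to 0, so a constant may be subtracted from
    h; \<open>h y\<close> turns every value into an oscillation.\<close>
  have "(\<Sum>i\<in>I. of_real (p i x - p i y) * h (\<theta> i y)) = (\<Sum>i\<in>I. of_real (p i x - p i y) * (h (\<theta> i y) - h y))"
  proof -
    have "(\<Sum>i\<in>I. of_real (p i x - p i y) * h y) = 0"
      using sum1_complex[OF x] sum1_complex[OF y]
      by (simp add: sum_distrib_right[symmetric] sum_subtractf)
    then show ?thesis by (simp add: right_diff_distrib sum_subtractf)
  qed
  also have "cmod \<dots> \<le> (\<Sum>i\<in>I. ?t * (p i x + p i y) * R)"
  proof (intro order_trans[OF norm_sum] sum_mono)
    fix i assume i: "i \<in> I"
    have "cmod (of_real (p i x - p i y) * (h (\<theta> i y) - h y)) = \<bar>p i x - p i y\<bar> * cmod (h (\<theta> i y) - h y)"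
      by (simp only: norm_mult norm_of_real)
    also have "\<dots> \<le> ?t * (p i x + p i y) * R"
      using c R nonneg[OF i x] nonneg[OF i y] by (intro mult_mono pd osc maps i y) auto
    finally show "cmod (of_real (p i x - p i y) * (h (\<theta> i y) - h y)) \<le> ?t * (p i x + p i y) * R" .
  qed
  also have "\<dots> = ?t * ((\<Sum>i\<in>I. p i x) + (\<Sum>i\<in>I. p i y)) * R"
    by (simp only: sum_distrib_right[symmetric] sum_distrib_left[symmetric] sum.distrib)
  also have "\<dots> = 2 * c * exp c * R * cmod (x - y)" using sum1[OF x] sum1[OF y] by simp
  finally show ?thesis using avg_diff_split[OF h L x y] by (simp add: algebra_simps)
qed

end

text \<open>Turns decay per block of N steps into decay per step; \<open>inverse q\<close> pays for
  the incomplete last block.\<close>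

lemma power_div_le_power_root:
  fixes q :: real
  assumes q: "0 < q" "q < 1" and N: "N > 0"
  shows "0 < root N q" "root N q < 1" "q ^ (n div N) \<le> inverse q * root N q ^ n"
proof -
  let ?p = "root N q"
  show p: "0 < ?p" "?p < 1" using q N by simp_all
  have pN: "?p ^ N = q" using q N by (simp add: real_root_pow_pos2)
  have "q ^ (n div N) * q = ?p ^ (N * (n div N) + N)" by (simp add: pN power_add power_mult)
  also have "\<dots> \<le> ?p ^ n" using p N by (intro power_decreasing) (simp_all add: dividend_less_times_div less_imp_le add.commute)
  finally show "q ^ (n div N) \<le> inverse q * ?p ^ n" using q by (simp add: field_simps)
qed

section \<open>Branches of the iterated function system\<close>

text \<open>A word \<open>b # xs\<close> stands for the branch obtained by applying \<open>\<lambda>z. 1 / (z + b)\<close> first. Each nonempty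
  word acts as \<open>z \<mapsto> a + \<kappa> / (z + d)\<close>; the empty word gets \<open>d = 0\<close>, so that \<open>1 / d = 0\<close> makes
  the recursion for \<open>d\<close> and \<open>a\<close> uniform.\<close>

fun word_shift :: "complex list \<Rightarrow> complex" where
  "word_shift [] = 0"
| "word_shift (b # xs) = b + 1 / word_shift xs"

text \<open>From \<kappa>/(1/(z + b) + d) = \<kappa>/d - (\<kappa>/d^2)/(z + b + 1/d) come the new
  scale and the summand \<kappa>/d of the offset. For the empty tail the quotient by d^2 = 0 would
  be 0 instead of 1, hence the case distinction.\<close>

fun word_scale :: "complex list \<Rightarrow> complex" where
  "word_scale [] = 1"
| "word_scale (b # xs) = (if xs = [] then 1 else - word_scale xs / (word_shift xs)\<^sup>2)"

fun word_offset :: "complex list \<Rightarrow> complex" where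
  "word_offset [] = 0"
| "word_offset (b # xs) = word_offset xs + word_scale xs / word_shift xs"

text \<open>Meaningful for nonempty words only: at the empty word the formula gives 1/z, not the
  identity.\<close>

definition branch :: "complex list \<Rightarrow> complex \<Rightarrow> complex" where
  "branch xs z = word_offset xs + word_scale xs / (z + word_shift xs)"

text \<open>The s-th power of the modulus of the derivative - \<kappa>/(z + d)^2 of the branch. By
  the chain rule it is the product of the weights |w + b|^(-2 s) met along the orbit.\<close>

definition weight :: "real \<Rightarrow> complex list \<Rightarrow> complex \<Rightarrow> real" where
  "weight s xs z = cmod (word_scale xs) powr s * cmod (z + word_shift xs) powr (- (2 * s))"

locale transfer =
  fixes \<gamma> s :: real and B H :: "complex set" and m :: nat
  assumes \<gamma>: "\<gamma> \<ge> 1" and B: "finite B" "B \<noteq> {}" "\<forall>b\<in>B. Re b \<ge> \<gamma>"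
    and H: "open H" "bounded H" "H \<subseteq> {z. Re z > 0}"
    and disc_H: "ball (complex_of_real (1 / (2 * \<gamma>))) (1 / (2 * \<gamma>)) \<subseteq> H"
    and m: "m \<ge> 1" and s: "s > 0"
begin

abbreviation G :: "complex set" where "G \<equiv> ball (complex_of_real (1 / (2 * \<gamma>))) (1 / (2 * \<gamma>))"
abbreviation D :: "complex set" where "D \<equiv> cball (complex_of_real (1 / (2 * \<gamma>))) (1 / (2 * \<gamma>))"
abbreviation L :: "(complex \<Rightarrow> complex) \<Rightarrow> complex \<Rightarrow> complex" where "L \<equiv> Lam B s H"

text \<open>Index k stands for length k + 1, as the closed formula excludes the empty word; thus
  \<open>words k\<close> belongs to the power \<open>Suc k\<close> of the operator.\<close>

definition words :: "nat \<Rightarrow> complex list set" where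
  "words k = {xs. set xs \<subseteq> B \<and> length xs = Suc k}"

definition rate :: real where "rate = inverse (\<gamma>\<^sup>2 + 1)"

lemma rate: "0 < rate" "rate \<le> 1 / 2"
proof -
  have "\<gamma>\<^sup>2 \<ge> 1" using \<gamma> by simp
  then show "0 < rate" "rate \<le> 1 / 2" by (auto simp: rate_def field_simps add_pos_pos)
qed

lemma closure_disc: "closure G = D"
  using \<gamma> by (intro closure_ball) simp

lemma D_closure: "D \<subseteq> closure H"
  using closure_mono[OF disc_H] closure_disc by simp

lemma closure_H_Re: "z \<in> closure H \<Longrightarrow> Re z \<ge> 0"
proof -
  have "closed {z::complex. Re z \<ge> 0}" using closed_halfspace_Re_ge by simp
  then have "closure H \<subseteq> {z. Re z \<ge> 0}" using H(3) by (intro closure_minimal) auto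
  then show "z \<in> closure H \<Longrightarrow> Re z \<ge> 0" by auto
qed

lemma H_nonempty: "H \<noteq> {}"
  using disc_H \<gamma> by (metis ball_eq_empty divide_pos_pos le_zero_eq mult_pos_pos not_le order_less_le_trans subset_empty zero_less_numeral zero_less_one)

lemma diam_D: "x \<in> D \<Longrightarrow> y \<in> D \<Longrightarrow> cmod (x - y) \<le> 1"
proof -
  assume "x \<in> D" "y \<in> D"
  then have "dist x y \<le> 1 / (2 * \<gamma>) + 1 / (2 * \<gamma>)"
    by (intro order_trans[OF dist_triangle2[of x y "complex_of_real (1 / (2 * \<gamma>))"]] add_mono) (auto simp: dist_commute)
  also have "\<dots> \<le> 1" using \<gamma> by simp
  finally show ?thesis by (simp add: dist_norm)
qed

lemma words_nonempty: "xs \<in> words k \<Longrightarrow> xs \<noteq> []" and words_subset: "xs \<in> words k \<Longrightarrow> set xs \<subseteq> B"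
  by (auto simp: words_def)

lemma finite_words: "finite (words k)"
  unfolding words_def using finite_lists_length_eq[OF B(1)] by simp

lemma words_0: "words 0 = (\<lambda>b. [b]) ` B"
  by (auto simp: words_def length_Suc_conv)

lemma words_Suc: "words (Suc k) = (\<lambda>(b, xs). b # xs) ` (B \<times> words k)"
  by (force simp: words_def length_Suc_conv image_iff)

lemma word_shift_Re: "set xs \<subseteq> B \<Longrightarrow> xs \<noteq> [] \<Longrightarrow> Re (word_shift xs) \<ge> \<gamma>"
proof (induction xs)
  case (Cons b xs)
  have b: "Re b \<ge> \<gamma>" using Cons.prems B(3) by simp
  show ?case
  proof (cases "xs = []")
    case False
    then have "Re (word_shift xs) \<ge> \<gamma>" using Cons by simp
    then have "Re (1 / word_shift xs) \<ge> 0" using \<gamma> by (simp add: Re_divide)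
    then show ?thesis using b by simp
  qed (use b in simp)
qed simp

lemma word_shift_ge:
  assumes "set xs \<subseteq> B" "xs \<noteq> []" "Re z \<ge> 0"
  shows "cmod (z + word_shift xs) \<ge> \<gamma>" "cmod (z + word_shift xs) \<ge> 1" "z + word_shift xs \<noteq> 0"
proof -
  have "\<gamma> \<le> Re (z + word_shift xs)" using word_shift_Re[OF assms(1,2)] assms(3) by simp
  then show "cmod (z + word_shift xs) \<ge> \<gamma>" using complex_Re_le_cmod order_trans by blast
  then show "cmod (z + word_shift xs) \<ge> 1" using \<gamma> by simp
  then show "z + word_shift xs \<noteq> 0" by auto
qed

lemma word_shift_nonzero: "set xs \<subseteq> B \<Longrightarrow> xs \<noteq> [] \<Longrightarrow> word_shift xs \<noteq> 0"
  using word_shift_ge(3)[of xs 0] by simp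

lemma word_scale_nonzero: "set xs \<subseteq> B \<Longrightarrow> word_scale xs \<noteq> 0"
  by (induction xs) (auto simp: word_shift_nonzero)

text \<open>The recursions of shift, scale and offset encode composition of Moebius maps, and the
  weights form the corresponding cocycle.\<close>

lemma branch_Cons:
  assumes "set (b # xs) \<subseteq> B" "xs \<noteq> []" "Re z \<ge> 0"
  shows "branch (b # xs) z = branch xs (1 / (z + b))"
    and "weight s (b # xs) z = cmod (z + b) powr (- (2 * s)) * weight s xs (1 / (z + b))"
proof -
  let ?d = "word_shift xs" and ?\<kappa> = "word_scale xs"
  have d: "?d \<noteq> 0" using assms by (intro word_shift_nonzero) auto
  have zb: "z + b \<noteq> 0" using assms B(3) \<gamma> by (auto simp: complex_eq_iff)
  have zbd: "z + (b + 1 / ?d) \<noteq> 0" using word_shift_ge(3)[of "b # xs" z] assms by simp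
  then have q: "(z + b) * ?d + 1 \<noteq> 0" using d by (auto simp: field_simps)
  have e1: "1 / (z + b) + ?d = ((z + b) * ?d + 1) / (z + b)" using zb by (simp add: field_simps)
  have e2: "z + (b + 1 / ?d) = ((z + b) * ?d + 1) / ?d" using d by (simp add: field_simps)
  have "?\<kappa> / ?d + (- ?\<kappa> / ?d\<^sup>2) / (((z + b) * ?d + 1) / ?d) = ?\<kappa> / (((z + b) * ?d + 1) / (z + b))"
    using d zb q by (simp add: divide_simps power2_eq_square) (simp add: algebra_simps)
  then show "branch (b # xs) z = branch xs (1 / (z + b))"
    unfolding branch_def e1 using assms(2) by (simp add: e2 add.assoc)
  have "weight s (b # xs) z = (cmod ?\<kappa> / (cmod ?d)\<^sup>2) powr s * (cmod ((z + b) * ?d + 1) / cmod ?d) powr (- (2 * s))"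
    unfolding weight_def using assms(2) by (simp add: e2 norm_divide norm_power)
  also have "\<dots> = cmod ?\<kappa> powr s * cmod ((z + b) * ?d + 1) powr (- (2 * s))"
  proof -
    have "(cmod ?\<kappa> / (cmod ?d)\<^sup>2) powr s = cmod ?\<kappa> powr s / (cmod ?d)\<^sup>2 powr s"
      by (simp add: powr_divide)
    also have "(cmod ?d)\<^sup>2 powr s = cmod ?d powr (2 * s)"
      using powr_powr[of "cmod ?d" "real 2" s] powr_realpow[of "cmod ?d" 2] d by simp
    finally show ?thesis using d q by (auto simp: powr_divide powr_minus field_simps)
  qed
  also have "\<dots> = cmod (z + b) powr (- (2 * s)) * weight s xs (1 / (z + b))"
    unfolding weight_def e1 norm_divide using zb q by (simp add: powr_divide powr_minus field_simps)
  finally show "weight s (b # xs) z = cmod (z + b) powr (- (2 * s)) * weight s xs (1 / (z + b))" .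
qed

lemma branch_singleton: "branch [b] z = 1 / (z + b)" and weight_singleton: "weight s [b] z = cmod (z + b) powr (- (2 * s))"
  by (simp_all add: branch_def weight_def)

lemma step_in_disc:
  assumes "b \<in> B"
  shows "z \<in> H \<Longrightarrow> 1 / (z + b) \<in> G" "z \<in> closure H \<Longrightarrow> 1 / (z + b) \<in> D"
proof -
  have b: "Re b \<ge> \<gamma>" using assms B(3) by simp
  show "1 / (z + b) \<in> G" if "z \<in> H" using that H(3) b by (intro inverse_in_disc(1)[OF \<gamma>]) auto
  show "1 / (z + b) \<in> D" if "z \<in> closure H" using closure_H_Re[OF that] b by (intro inverse_in_disc(2)[OF \<gamma>]) auto
qed

text \<open>Two versions, because a jet is differentiable only inside H: points of H must go to the
  open disc, points of the closure at least to the closed disc.\<close>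

lemma branch_in_disc:
  assumes "set xs \<subseteq> B" "xs \<noteq> []"
  shows "z \<in> H \<Longrightarrow> branch xs z \<in> G" "z \<in> closure H \<Longrightarrow> branch xs z \<in> D"
proof -
  have "(z \<in> H \<longrightarrow> branch xs z \<in> G) \<and> (z \<in> closure H \<longrightarrow> branch xs z \<in> D)"
    using assms
  proof (induction xs arbitrary: z)
    case (Cons b xs)
    note st = step_in_disc[of b z]
    show ?case
    proof (cases "xs = []")
      case True
      then show ?thesis using st Cons.prems by (simp add: branch_singleton)
    next
      case False
      have br: "branch (b # xs) z = branch xs (1 / (z + b))" if "z \<in> closure H"
        by (rule branch_Cons(1)[OF Cons.prems(1) False closure_H_Re[OF that]])
      show ?thesis
        using br st Cons.IH[of "1 / (z + b)"] Cons.prems False disc_H D_closure closure_subset[of H] by auto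
    qed
  qed simp
  then show "z \<in> H \<Longrightarrow> branch xs z \<in> G" "z \<in> closure H \<Longrightarrow> branch xs z \<in> D" by auto
qed

lemma Lam_power:
  assumes "z \<in> closure H"
  shows "(L ^^ Suc k) f z = (\<Sum>xs\<in>words k. of_real (weight s xs z) * f (branch xs z))"
  using assms
proof (induction k arbitrary: z)
  case 0
  have "L f z = (\<Sum>b\<in>B. of_real (weight s [b] z) * f (branch [b] z))"
    using 0 by (simp add: Lam_def weight_singleton branch_singleton powr_minus divide_inverse)
  also have "\<dots> = (\<Sum>xs\<in>(\<lambda>b. [b]) ` B. of_real (weight s xs z) * f (branch xs z))"
    by (subst sum.reindex) (auto simp: inj_on_def)
  finally show ?case by (simp add: words_0)
next
  case (Suc k)
  have z: "Re z \<ge> 0" by (rule closure_H_Re[OF Suc.prems])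
  have "(L ^^ Suc (Suc k)) f z = L ((L ^^ Suc k) f) z" by simp
  also have "\<dots> = (\<Sum>b\<in>B. of_real (cmod (z + b) powr (- (2 * s))) * (L ^^ Suc k) f (1 / (z + b)))"
    unfolding Lam_def[of B s H "(L ^^ Suc k) f"] using Suc.prems by (simp add: powr_minus divide_inverse)
  also have "\<dots> = (\<Sum>b\<in>B. \<Sum>xs\<in>words k. of_real (weight s (b # xs) z) * f (branch (b # xs) z))"
  proof (rule sum.cong[OF refl])
    fix b assume b: "b \<in> B"
    have mem: "1 / (z + b) \<in> closure H" using step_in_disc(2)[OF b Suc.prems] D_closure by auto
    show "of_real (cmod (z + b) powr (- (2 * s))) * (L ^^ Suc k) f (1 / (z + b))
        = (\<Sum>xs\<in>words k. of_real (weight s (b # xs) z) * f (branch (b # xs) z))"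
      unfolding Suc.IH[OF mem] sum_distrib_left
      using b words_subset words_nonempty z
      by (intro sum.cong refl) (simp add: branch_Cons mult.assoc)
  qed
  also have "\<dots> = (\<Sum>xs\<in>words (Suc k). of_real (weight s xs z) * f (branch xs z))"
    unfolding words_Suc sum.cartesian_product
    by (subst sum.reindex) (auto simp: inj_on_def case_prod_unfold)
  finally show ?case .
qed

lemma word_scale_Cons:
  assumes "set (b # xs) \<subseteq> B"
  shows "cmod (word_scale (b # xs)) \<le> cmod (word_scale xs)"
proof (cases "xs = []")
  case False
  have "1 \<le> cmod (word_shift xs)" using word_shift_ge(2)[of xs 0] assms False by simp
  then have "1 \<le> (cmod (word_shift xs))\<^sup>2" by simp
  then show ?thesis using False by (simp add: norm_divide norm_power divide_le_eq mult_le_cancel_left1)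
qed simp

lemma word_scale_le_1: "set xs \<subseteq> B \<Longrightarrow> cmod (word_scale xs) \<le> 1"
proof (induction xs)
  case (Cons b xs)
  then show ?case using word_scale_Cons[OF Cons.prems] by force
qed simp

text \<open>Two letters at a time: the scale is divided by the square of |b d + 1|, where d is the
  shift of the tail, and this modulus is at least \<gamma>^2 + 1. The factor
  \<open>inverse (rate\<^sup>2)\<close> makes the claim trivial for words of at most two
  letters.\<close>

lemma word_scale_bound: "set xs \<subseteq> B \<Longrightarrow> cmod (word_scale xs) \<le> inverse (rate\<^sup>2) * rate ^ length xs"
proof (induction xs rule: induct_list012)
  case 1
  then show ?case using rate by (simp add: field_simps power_le_one)
next
  case (2 b)
  have "rate ^ 2 \<le> rate ^ 1" using rate by (intro power_decreasing) auto
  then show ?case using rate by (simp add: field_simps)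
next
  case (3 c b xs)
  have IH: "cmod (word_scale xs) \<le> inverse (rate\<^sup>2) * rate ^ length xs" using 3 by simp
  show ?case
  proof (cases "xs = []")
    case True
    have e: "inverse (rate\<^sup>2) * rate ^ length (c # b # xs) = 1" using rate True by (simp add: field_simps power2_eq_square)
    show ?thesis unfolding e by (rule word_scale_le_1[OF 3(3)])
  next
    case False
    let ?d = "word_shift xs"
    have "set xs \<subseteq> B" using 3 by simp
    then have d: "Re ?d \<ge> \<gamma>" "?d \<noteq> 0" by (rule word_shift_Re[OF _ False], rule word_shift_nonzero[OF _ False])
    have b: "Re b \<ge> \<gamma>" using 3 B(3) by simp
    have "\<gamma>\<^sup>2 + 1 \<le> cmod (b * ?d + 1)" by (rule norm_mult_add_one_ge[OF \<gamma> b d(1)])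
    then have "(\<gamma>\<^sup>2 + 1)\<^sup>2 \<le> (cmod (b * ?d + 1))\<^sup>2" by (intro power_mono) auto
    moreover have "b * ?d + 1 = word_shift (b # xs) * ?d" using d(2) by (simp add: field_simps)
    ultimately have le: "(\<gamma>\<^sup>2 + 1)\<^sup>2 \<le> (cmod (word_shift (b # xs)))\<^sup>2 * (cmod ?d)\<^sup>2"
      by (simp only: norm_mult power_mult_distrib)
    have pos: "0 < (\<gamma>\<^sup>2 + 1)\<^sup>2" using rate(1) by (simp add: rate_def)
    have "cmod (word_scale (c # b # xs)) = cmod (word_scale xs) / ((cmod (word_shift (b # xs)))\<^sup>2 * (cmod ?d)\<^sup>2)"
      using False by (simp add: norm_divide norm_mult norm_power del: word_shift.simps)
    also have "\<dots> \<le> cmod (word_scale xs) / (\<gamma>\<^sup>2 + 1)\<^sup>2"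
      using le pos by (intro divide_left_mono mult_pos_pos) (auto intro: less_le_trans)
    also have "\<dots> = cmod (word_scale xs) * rate\<^sup>2" by (simp add: rate_def divide_inverse power_inverse)
    also have "\<dots> \<le> inverse (rate\<^sup>2) * rate ^ length xs * rate\<^sup>2" by (intro mult_right_mono IH) simp
    finally show ?thesis by (simp add: power2_eq_square ac_simps)
  qed
qed

text \<open>The minimum keeps two facts at hand: no branch expands, and the scale decays
  geometrically in k.\<close>

definition scale_bound :: "nat \<Rightarrow> real" where
  "scale_bound k = min 1 (inverse (rate\<^sup>2) * rate ^ Suc k)"

lemma scale_bound: "xs \<in> words k \<Longrightarrow> cmod (word_scale xs) \<le> scale_bound k"
  using word_scale_le_1[of xs] word_scale_bound[of xs] by (auto simp: words_def scale_bound_def)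

lemma scale_bound_range: "0 \<le> scale_bound k" "scale_bound k \<le> 1"
  using rate by (auto simp: scale_bound_def)

lemma scale_bound_tendsto: "scale_bound \<longlonglongrightarrow> 0"
proof (rule tendsto_sandwich[OF always_eventually always_eventually tendsto_const])
  have "(\<lambda>k. inverse (rate\<^sup>2) * rate ^ Suc k) \<longlonglongrightarrow> inverse (rate\<^sup>2) * 0"
    using rate by (intro tendsto_intros LIMSEQ_Suc LIMSEQ_realpow_zero) auto
  then show "(\<lambda>k. inverse (rate\<^sup>2) * rate ^ Suc k) \<longlonglongrightarrow> 0" by simp
qed (use rate in \<open>auto simp: scale_bound_def\<close>)

lemma branch_lipschitz:
  assumes xs: "set xs \<subseteq> B" "xs \<noteq> []" and "Re x \<ge> 0" "Re y \<ge> 0"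
  shows "cmod (branch xs x - branch xs y) \<le> cmod (word_scale xs) * cmod (x - y)"
proof -
  let ?d = "word_shift xs"
  note x = word_shift_ge[OF xs assms(3)] and y = word_shift_ge[OF xs assms(4)]
  have "branch xs x - branch xs y = word_scale xs * (y - x) / ((x + ?d) * (y + ?d))"
    unfolding branch_def using x(3) y(3) by (simp add: divide_simps) (simp add: algebra_simps)
  then have "cmod (branch xs x - branch xs y) = cmod (word_scale xs) * cmod (x - y) / (cmod (x + ?d) * cmod (y + ?d))"
    by (simp add: norm_mult norm_divide norm_minus_commute)
  also have "\<dots> \<le> cmod (word_scale xs) * cmod (x - y) / 1"
    using mult_mono[OF x(2) y(2)] x(2) y(2) by (intro divide_left_mono) auto
  finally show ?thesis by simp
qed

lemma weight_pos: "set xs \<subseteq> B \<Longrightarrow> xs \<noteq> [] \<Longrightarrow> Re z \<ge> 0 \<Longrightarrow> weight s xs z > 0"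
  unfolding weight_def using word_scale_nonzero word_shift_ge(3) by simp

text \<open>The scale cancels between the two points, and |z + d| \<ge> 1 makes log |z + d|
  Lipschitz with constant 1; so 2 s does not see the word.\<close>

lemma weight_log_lip:
  assumes xs: "set xs \<subseteq> B" "xs \<noteq> []" and "Re x \<ge> 0" "Re y \<ge> 0"
  shows "weight s xs x \<le> exp (2 * s * cmod (x - y)) * weight s xs y"
proof -
  let ?d = "word_shift xs"
  note x = word_shift_ge[OF xs assms(3)] and y = word_shift_ge[OF xs assms(4)]
  have "cmod (y + ?d) \<le> cmod (x + ?d) + cmod (x - y)"
    using norm_triangle_ineq4[of "x + ?d" "x - y"] by (simp add: algebra_simps)
  also have "\<dots> \<le> cmod (x + ?d) * (1 + cmod (x - y))"
    using mult_right_mono[OF x(2), of "cmod (x - y)"] by (simp add: algebra_simps)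
  also have "\<dots> \<le> cmod (x + ?d) * exp (cmod (x - y))"
    using exp_ge_add_one_self[of "cmod (x - y)"] by (intro mult_left_mono) auto
  finally have "cmod (y + ?d) powr (2 * s) \<le> (cmod (x + ?d) * exp (cmod (x - y))) powr (2 * s)"
    using s by (intro powr_mono2) auto
  also have "\<dots> = cmod (x + ?d) powr (2 * s) * exp (2 * s * cmod (x - y))"
    by (simp add: powr_mult exp_powr_real ac_simps)
  finally have "cmod (x + ?d) powr (- (2 * s)) \<le> exp (2 * s * cmod (x - y)) * cmod (y + ?d) powr (- (2 * s))"
    using x(3) y(3) by (simp add: powr_minus field_simps)
  then have "cmod (word_scale xs) powr s * cmod (x + ?d) powr (- (2 * s)) \<le>
      cmod (word_scale xs) powr s * (exp (2 * s * cmod (x - y)) * cmod (y + ?d) powr (- (2 * s)))"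
    by (rule mult_left_mono) simp
  then show ?thesis by (simp add: weight_def ac_simps)
qed

section \<open>Iterates of the constant 1 and the Markov chain they define\<close>

definition mass :: "nat \<Rightarrow> complex \<Rightarrow> real" where
  "mass n z = (case n of 0 \<Rightarrow> 1 | Suc k \<Rightarrow> \<Sum>xs\<in>words k. weight s xs z)"

definition one :: "complex \<Rightarrow> complex" where
  "one = (\<lambda>z. if z \<in> closure H then 1 else 0)"

lemma mass_one: "z \<in> closure H \<Longrightarrow> (L ^^ n) one z = of_real (mass n z)"
proof (cases n)
  case (Suc k)
  assume z: "z \<in> closure H"
  have "one (branch xs z) = 1" if "xs \<in> words k" for xs
    using branch_in_disc(2)[OF words_subset[OF that] words_nonempty[OF that] z] D_closure by (auto simp: one_def)
  then show ?thesis unfolding Suc Lam_power[OF z] by (simp add: mass_def)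
qed (simp add: mass_def one_def)

lemma words_ne: "words k \<noteq> {}"
proof -
  obtain b where "b \<in> B" using B(2) by blast
  then have "replicate (Suc k) b \<in> words k" by (auto simp: words_def)
  then show ?thesis by blast
qed

lemma mass_pos: "Re z \<ge> 0 \<Longrightarrow> mass n z > 0"
  by (cases n) (auto simp: mass_def intro!: sum_pos finite_words words_ne weight_pos dest: words_subset words_nonempty)

lemma mass_log_lip:
  assumes "Re x \<ge> 0" "Re y \<ge> 0"
  shows "mass n x \<le> exp (2 * s * cmod (x - y)) * mass n y"
proof (cases n)
  case (Suc k)
  show ?thesis
    unfolding Suc mass_def nat.case sum_distrib_left
    by (intro sum_mono weight_log_lip assms) (auto dest: words_subset words_nonempty)
qed (use s in \<open>simp add: mass_def\<close>)

text \<open>The cocycle identity: n further steps from the endpoint of a word of length k + 1. It is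
  what makes \<open>kernel\<close> sum to 1.\<close>

lemma mass_add:
  assumes z: "z \<in> closure H"
  shows "mass (n + Suc k) z = (\<Sum>xs\<in>words k. weight s xs z * mass n (branch xs z))"
proof -
  have "complex_of_real (mass (n + Suc k) z) = (L ^^ Suc k) ((L ^^ n) one) z"
    using mass_one[OF z, of "n + Suc k"] by (simp only: add.commute[of n "Suc k"] funpow_add comp_def)
  also have "\<dots> = (\<Sum>xs\<in>words k. of_real (weight s xs z) * of_real (mass n (branch xs z)))"
    unfolding Lam_power[OF z]
  proof (intro sum.cong refl)
    fix xs assume "xs \<in> words k"
    then have "branch xs z \<in> closure H" using branch_in_disc(2)[OF words_subset words_nonempty z] D_closure by blast
    then show "of_real (weight s xs z) * (L ^^ n) one (branch xs z) = complex_of_real (weight s xs z) * of_real (mass n (branch xs z))"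
      by (simp add: mass_one)
  qed
  also have "\<dots> = of_real (\<Sum>xs\<in>words k. weight s xs z * mass n (branch xs z))" by simp
  finally show ?thesis by (simp only: of_real_eq_iff)
qed

definition quotient :: "nat \<Rightarrow> (complex \<Rightarrow> complex) \<Rightarrow> complex \<Rightarrow> complex" where
  "quotient n f z = (L ^^ n) f z / of_real (mass n z)"

text \<open>Doob's transform of the weights by the masses. It depends on n because the mass need not
  be an eigenfunction.\<close>

definition kernel :: "nat \<Rightarrow> nat \<Rightarrow> complex list \<Rightarrow> complex \<Rightarrow> real" where
  "kernel n k xs z = weight s xs z * mass n (branch xs z) / mass (n + Suc k) z"

lemma D_Re: "z \<in> D \<Longrightarrow> Re z \<ge> 0"
  using D_closure closure_H_Re by blast

text \<open>6 s is three times 2 s: from the weight, from the mass at the image point (branches do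
  not expand) and from the normalising mass. The contraction depends on k alone, and no constant on
  n.\<close>

lemma markov: "markov_step (words k) D (kernel n k) branch (6 * s) (scale_bound k)"
proof
  show "finite (words k)" by (rule finite_words)
  fix x y xs
  have br: "branch xs x \<in> D" if "xs \<in> words k" "x \<in> D" for xs x
    using branch_in_disc(2)[OF words_subset[OF that(1)] words_nonempty[OF that(1)]] that(2) D_closure by blast
  then show "xs \<in> words k \<Longrightarrow> x \<in> D \<Longrightarrow> branch xs x \<in> D" .
  have mp: "mass n x > 0" if "x \<in> D" for n x using mass_pos D_Re that by simp
  have wp: "weight s xs x > 0" if "xs \<in> words k" "x \<in> D" for xs x
    using weight_pos[OF words_subset[OF that(1)] words_nonempty[OF that(1)] D_Re[OF that(2)]] .
  show "kernel n k xs x \<ge> 0" if "xs \<in> words k" "x \<in> D"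
    unfolding kernel_def using wp[OF that] mp[OF br[OF that], of n] mp[OF that(2), of "n + Suc k"]
    by (intro divide_nonneg_pos mult_nonneg_nonneg) auto
  show "(\<Sum>xs\<in>words k. kernel n k xs x) = 1" if "x \<in> D"
    unfolding kernel_def sum_divide_distrib[symmetric]
    using mass_add[of x n k] mp[OF that, of "n + Suc k"] that D_closure by auto
  show lip: "cmod (branch xs x - branch xs y) \<le> scale_bound k * cmod (x - y)" if "xs \<in> words k" "x \<in> D" "y \<in> D"
    by (rule order_trans[OF branch_lipschitz[OF words_subset[OF that(1)] words_nonempty[OF that(1)] D_Re[OF that(2)] D_Re[OF that(3)]]
          mult_right_mono[OF scale_bound[OF that(1)]]]) simp
  show "kernel n k xs x \<le> exp (6 * s * cmod (x - y)) * kernel n k xs y"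
    if xs: "xs \<in> words k" and x: "x \<in> D" and y: "y \<in> D"
  proof -
    let ?e = "exp (2 * s * cmod (x - y))"
    have 1: "weight s xs x \<le> ?e * weight s xs y"
      by (rule weight_log_lip[OF words_subset[OF xs] words_nonempty[OF xs] D_Re[OF x] D_Re[OF y]])
    have "cmod (branch xs x - branch xs y) \<le> 1 * cmod (x - y)"
      by (intro order_trans[OF lip[OF xs x y]] mult_right_mono scale_bound_range) simp
    then have "exp (2 * s * cmod (branch xs x - branch xs y)) \<le> ?e" using s by simp
    then have 2: "mass n (branch xs x) \<le> ?e * mass n (branch xs y)"
      using order_trans[OF mass_log_lip[OF D_Re[OF br[OF xs x]] D_Re[OF br[OF xs y]], of n] mult_right_mono]
        mp[OF br[OF xs y], of n] by simp
    have 3: "mass (n + Suc k) y \<le> ?e * mass (n + Suc k) x"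
      using mass_log_lip[OF D_Re[OF y] D_Re[OF x]] by (simp add: norm_minus_commute)
    have "kernel n k xs x \<le> (?e * weight s xs y) * (?e * mass n (branch xs y)) / (mass (n + Suc k) y / ?e)"
      unfolding kernel_def using 1 2 3 wp[OF xs y] wp[OF xs x] mp[OF br[OF xs y], of n] mp[OF br[OF xs x], of n] mp[OF x, of "n + Suc k"] mp[OF y, of "n + Suc k"]
      by (intro frac_le mult_mono) (auto simp: field_simps)
    also have "\<dots> = ?e * ?e * ?e * kernel n k xs y"
      by (simp add: kernel_def field_simps)
    also have "?e * ?e * ?e = exp (6 * s * cmod (x - y))"
      unfolding exp_add[symmetric] by (simp add: algebra_simps)
    finally show ?thesis .
  qed
qed (use s scale_bound_range diam_D in auto)

lemma quotient_avg:
  assumes x: "x \<in> D"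
  shows "quotient (n + Suc k) f x = markov_step.avg (words k) (kernel n k) branch (quotient n f) x"
proof -
  have xc: "x \<in> closure H" using x D_closure by blast
  have "(L ^^ (n + Suc k)) f x = (\<Sum>xs\<in>words k. of_real (weight s xs x) * (L ^^ n) f (branch xs x))"
    using Lam_power[OF xc, of k "(L ^^ n) f"] by (simp only: add.commute[of n "Suc k"] funpow_add comp_def)
  also have "\<dots> / of_real (mass (n + Suc k) x) = (\<Sum>xs\<in>words k. of_real (kernel n k xs x) * quotient n f (branch xs x))"
    unfolding sum_divide_distrib
  proof (intro sum.cong refl)
    fix xs assume xs: "xs \<in> words k"
    have "mass n (branch xs x) > 0"
      using branch_in_disc(2)[OF words_subset[OF xs] words_nonempty[OF xs] xc] by (intro mass_pos D_Re)
    then show "of_real (weight s xs x) * (L ^^ n) f (branch xs x) / of_real (mass (n + Suc k) x)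
      = of_real (kernel n k xs x) * quotient n f (branch xs x)"
      by (simp add: kernel_def quotient_def)
  qed
  finally show ?thesis
    unfolding quotient_def[of "n + Suc k"] markov_step.avg_def[OF markov] .
qed

section \<open>The limiting functional\<close>

definition lipschitz_disc :: "(complex \<Rightarrow> complex) \<Rightarrow> real \<Rightarrow> bool" where
  "lipschitz_disc f K \<longleftrightarrow> K \<ge> 0 \<and> (\<forall>x\<in>D. \<forall>y\<in>D. cmod (f x - f y) \<le> K * cmod (x - y))"

definition center :: complex where "center = of_real (1 / (2 * \<gamma>))"

lemma center: "center \<in> D" "center \<in> G" "center \<in> H" "center \<in> closure H"
proof -
  show 1: "center \<in> D" "center \<in> G" using \<gamma> by (simp_all add: center_def)
  then show "center \<in> H" "center \<in> closure H" using disc_H D_closure by blast+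
qed

text \<open>For functions that are Lipschitz on D, any point of D gives the same limit. The
  functional plays the part of the eigenmeasure of the dual operator, normalised so that
  \<open>ell one\<close> is 1.\<close>

definition ell :: "(complex \<Rightarrow> complex) \<Rightarrow> complex" where
  "ell f = lim (\<lambda>n. quotient n f center)"

text \<open>Later quotients are averages of earlier ones, so they stay in any disc that holds all
  values of an earlier quotient.\<close>

lemma quotient_near:
  assumes "\<And>y. y \<in> D \<Longrightarrow> cmod (quotient n f y - z) \<le> R" "n \<le> n'" "x \<in> D"
  shows "cmod (quotient n' f x - z) \<le> R"
proof (cases "n' = n")
  case False
  then have n': "n' = n + Suc (n' - n - 1)" using assms(2) by simp
  interpret markov_step "words (n' - n - 1)" D "kernel n (n' - n - 1)" branch "6 * s" "scale_bound (n' - n - 1)"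
    by (rule markov)
  show ?thesis
    by (subst n', subst quotient_avg[OF assms(3)], rule avg_near[OF assms(1,3)])
qed (use assms in simp)

text \<open>Oscillation and Lipschitz constant are controlled together: the former drops by
  Doeblin's estimate up to a small multiple of the latter, the latter shrinks up to a multiple of
  the former. With the weight \<epsilon> between them, both shrink by q after a block of k + 1
  steps, uniformly in n.\<close>

lemma quotient_decay_aux:
  obtains C q where "C \<ge> 0" "0 < q" "q < 1"
    "\<And>f K n n' x y. lipschitz_disc f K \<Longrightarrow> x \<in> D \<Longrightarrow> y \<in> D \<Longrightarrow> n \<le> n' \<Longrightarrow>
      cmod (quotient n f x - quotient n' f y) \<le> C * q ^ n * K"
proof -
  define c where "c = 6 * s"
  have c: "c > 0" using s by (simp add: c_def)
  define \<delta> where "\<delta> = exp (- c)"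
  have \<delta>: "0 < \<delta>" "\<delta> < 1" using c by (auto simp: \<delta>_def)
  define q where "q = 1 - \<delta> / 2"
  have q: "0 < q" "q < 1" using \<delta> by (auto simp: q_def)
  define M where "M = 2 * c * exp c"
  have M: "M > 0" using c by (simp add: M_def)
  \<comment> \<open>Chosen so that M V is half of q V / \<epsilon>; the other half is left to the
    contracted Lipschitz constant.\<close>
  define \<epsilon> where "\<epsilon> = q / (2 * M)"
  have \<epsilon>: "\<epsilon> > 0" using q M by (simp add: \<epsilon>_def)
  \<comment> \<open>The first bound lets the Lipschitz constant V / \<epsilon> add only \<delta> V /
    2 to the oscillation, which gives q = 1 - \<delta>/2; the second is the missing half in the
    Lipschitz estimate.\<close>
  have "\<forall>\<^sub>F k in sequentially. scale_bound k < min (\<delta> * \<epsilon> / 2) (q / 2)"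
    using \<delta> \<epsilon> q by (intro order_tendstoD(2)[OF scale_bound_tendsto]) auto
  then obtain k where k: "scale_bound k < \<delta> * \<epsilon> / 2" "scale_bound k < q / 2"
    using eventually_happens by fastforce
  let ?good = "\<lambda>n V f. \<forall>x\<in>D. \<forall>y\<in>D. cmod (quotient n f x - quotient n f y) \<le> V \<and>
      cmod (quotient n f x - quotient n f y) \<le> V / \<epsilon> * cmod (x - y)"
  have step: "?good (n + Suc k) (q * V) f" if good: "?good n V f" and V: "V \<ge> 0" for n V f
  proof (intro ballI)
    fix x y assume x: "x \<in> D" and y: "y \<in> D"
    interpret markov_step "words k" D "kernel n k" branch "6 * s" "scale_bound k"
      by (rule markov)
    have V\<epsilon>: "V / \<epsilon> \<ge> 0" using V \<epsilon> by simp
    have lip: "cmod (quotient n f x - quotient n f y) \<le> V / \<epsilon> * cmod (x - y)"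
      and osc: "cmod (quotient n f x - quotient n f y) \<le> V" if "x \<in> D" "y \<in> D" for x y
      using good that by blast+
    have "cmod (avg (quotient n f) x - avg (quotient n f) y) \<le> (1 - exp (- (6 * s))) * V + scale_bound k * (V / \<epsilon>)"
      by (rule avg_osc[OF lip V\<epsilon> osc x y])
    also have "\<dots> \<le> (1 - \<delta>) * V + \<delta> * \<epsilon> / 2 * (V / \<epsilon>)"
      using k(1) V\<epsilon> V by (intro add_mono mult_right_mono) (auto simp: \<delta>_def c_def)
    also have "\<dots> = q * V" using \<epsilon> by (simp add: q_def field_simps)
    finally have 1: "cmod (avg (quotient n f) x - avg (quotient n f) y) \<le> q * V" .
    have "cmod (avg (quotient n f) x - avg (quotient n f) y) \<le>
        (scale_bound k * (V / \<epsilon>) + 2 * (6 * s) * exp (6 * s) * V) * cmod (x - y)"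
      by (rule avg_lip[OF lip V\<epsilon> osc x y])
    also have "\<dots> \<le> (q / 2 * (V / \<epsilon>) + M * V) * cmod (x - y)"
      using k(2) V\<epsilon> V by (intro add_mono mult_right_mono) (auto simp: M_def c_def)
    also have "q / 2 * (V / \<epsilon>) + M * V = q * V / \<epsilon>" using M q by (simp add: \<epsilon>_def field_simps)
    finally show "cmod (quotient (n + Suc k) f x - quotient (n + Suc k) f y) \<le> q * V \<and>
       cmod (quotient (n + Suc k) f x - quotient (n + Suc k) f y) \<le> q * V / \<epsilon> * cmod (x - y)"
      using 1 quotient_avg[OF x] quotient_avg[OF y] by simp
  qed
  have bound: "cmod (quotient n f x - quotient n' f y) \<le> 2 * (q ^ (n div Suc k) * ((1 + \<epsilon>) * K))"
    if f: "lipschitz_disc f K" and x: "x \<in> D" and y: "y \<in> D" and n: "n \<le> n'" for f K n n' x y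
  proof -
    have K: "K \<ge> 0" and fK: "\<And>x y. x \<in> D \<Longrightarrow> y \<in> D \<Longrightarrow> cmod (f x - f y) \<le> K * cmod (x - y)"
      using f by (auto simp: lipschitz_disc_def)
    define V where "V = (1 + \<epsilon>) * K"
    have V: "V \<ge> 0" using K \<epsilon> by (simp add: V_def)
    have good: "?good (j * Suc k) (q ^ j * V) f" for j
    proof (induction j)
      case 0
      show ?case
      proof (intro ballI)
        fix x y assume xy: "x \<in> D" "y \<in> D"
        have "cmod (f x - f y) \<le> K * 1"
          by (rule order_trans[OF fK[OF xy] mult_left_mono[OF diam_D[OF xy] K]])
        also have "\<dots> \<le> V" using K \<epsilon> by (simp add: V_def algebra_simps)
        finally have 1: "cmod (f x - f y) \<le> V" .
        have "K \<le> V / \<epsilon>" using K \<epsilon> by (simp add: V_def field_simps)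
        then have "cmod (f x - f y) \<le> V / \<epsilon> * cmod (x - y)"
          using fK[OF xy] by (meson mult_right_mono norm_ge_zero order_trans)
        with 1 show "cmod (quotient (0 * Suc k) f x - quotient (0 * Suc k) f y) \<le> q ^ 0 * V \<and>
            cmod (quotient (0 * Suc k) f x - quotient (0 * Suc k) f y) \<le> q ^ 0 * V / \<epsilon> * cmod (x - y)"
          by (simp add: quotient_def mass_def)
      qed
    next
      case (Suc j)
      have "q ^ j * V \<ge> 0" using q V by simp
      from step[OF Suc this] show ?case by (simp only: mult_Suc power_Suc add.commute[of "Suc k"] mult.assoc)
    qed
    let ?j = "n div Suc k"
    have le: "?j * Suc k \<le> n" by (rule div_times_less_eq_dividend)
    \<comment> \<open>At the last completed block all values lie within q^j V of the value at the
      centre, and averaging keeps every later quotient there.\<close>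
    have near: "cmod (quotient n'' f z - quotient (?j * Suc k) f center) \<le> q ^ ?j * V" if "n \<le> n''" "z \<in> D" for n'' z
      by (rule quotient_near[of "?j * Suc k"]) (use good center that le in auto)
    have "cmod (quotient n f x - quotient n' f y) \<le> cmod (quotient n f x - quotient (?j * Suc k) f center)
        + cmod (quotient n' f y - quotient (?j * Suc k) f center)"
      using norm_triangle_ineq4[of "quotient n f x - quotient (?j * Suc k) f center" "quotient n' f y - quotient (?j * Suc k) f center"]
      by simp
    also have "\<dots> \<le> q ^ ?j * V + q ^ ?j * V" using n x y by (intro add_mono near) auto
    finally show ?thesis by (simp only: V_def mult_2)
  qed
  let ?p = "root (Suc k) q"
  note p = power_div_le_power_root[OF q, of "Suc k"]
  show ?thesis
  proof (rule that[of "2 * inverse q * (1 + \<epsilon>)" ?p])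
    show "0 \<le> 2 * inverse q * (1 + \<epsilon>)" "0 < ?p" "?p < 1" using q \<epsilon> p by auto
    fix f K x y and n n' :: nat assume a: "lipschitz_disc f K" "x \<in> D" "y \<in> D" "n \<le> n'"
    have "cmod (quotient n f x - quotient n' f y) \<le> 2 * (q ^ (n div Suc k) * ((1 + \<epsilon>) * K))"
      by (rule bound[OF a])
    also have "\<dots> \<le> 2 * (inverse q * ?p ^ n * ((1 + \<epsilon>) * K))"
      using a(1) \<epsilon> p(3)[of n] by (intro mult_left_mono mult_right_mono) (auto simp: lipschitz_disc_def)
    finally show "cmod (quotient n f x - quotient n' f y) \<le> 2 * inverse q * (1 + \<epsilon>) * ?p ^ n * K"
      by (simp only: ac_simps)
  qed
qed

text \<open>Letting n' tend to infinity turns the Cauchy estimate into a rate of convergence with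
  the same constants.\<close>

lemma quotient_decay:
  obtains C q where "C \<ge> 0" "0 < q" "q < 1"
    "\<And>f K n x. lipschitz_disc f K \<Longrightarrow> x \<in> D \<Longrightarrow> cmod (quotient n f x - ell f) \<le> C * q ^ n * K"
proof -
  obtain C q where C: "C \<ge> 0" and q: "0 < q" "q < 1" and
    bound: "\<And>f K n n' x y. lipschitz_disc f K \<Longrightarrow> x \<in> D \<Longrightarrow> y \<in> D \<Longrightarrow> n \<le> n' \<Longrightarrow>
      cmod (quotient n f x - quotient n' f y) \<le> C * q ^ n * K"
    using quotient_decay_aux by blast
  show ?thesis
  proof (rule that[OF C q])
    fix f K n x assume f: "lipschitz_disc f K" and x: "x \<in> D"
    have lim0: "(\<lambda>n. C * q ^ n * K) \<longlonglongrightarrow> C * 0 * K"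
      using q by (intro tendsto_intros LIMSEQ_realpow_zero) auto
    have "Cauchy (\<lambda>n. quotient n f center)"
    proof (rule CauchyI)
      fix e :: real assume e: "e > 0"
      have "\<forall>\<^sub>F n in sequentially. C * q ^ n * K < e" using lim0 e by (auto intro: order_tendstoD)
      then obtain M where M: "\<And>n. n \<ge> M \<Longrightarrow> C * q ^ n * K < e" by (auto simp: eventually_sequentially)
      have lt: "cmod (quotient i f center - quotient j f center) < e" if "M \<le> i" "i \<le> j" for i j
        using le_less_trans[OF bound[OF f center(1) center(1) that(2)] M[OF that(1)]] .
      show "\<exists>M. \<forall>m\<ge>M. \<forall>n\<ge>M. cmod (quotient m f center - quotient n f center) < e"
      proof (intro exI allI impI)
        fix i j assume "M \<le> i" "M \<le> j"
        then show "cmod (quotient i f center - quotient j f center) < e"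
          using lt[of i j] lt[of j i] by (cases "i \<le> j") (auto simp: norm_minus_commute)
      qed
    qed
    then have "(\<lambda>n. quotient n f center) \<longlonglongrightarrow> ell f"
      unfolding ell_def by (simp add: Cauchy_convergent_iff convergent_LIMSEQ_iff)
    then have "(\<lambda>n'. cmod (quotient n f x - quotient n' f center)) \<longlonglongrightarrow> cmod (quotient n f x - ell f)"
      by (intro tendsto_intros)
    then show "cmod (quotient n f x - ell f) \<le> C * q ^ n * K"
      by (rule LIMSEQ_le_const2) (use bound[OF f x center(1)] in blast)
  qed
qed

lemma quotient_tendsto:
  assumes f: "lipschitz_disc f K" and x: "x \<in> D"
  shows "(\<lambda>n. quotient n f x) \<longlonglongrightarrow> ell f"
proof -
  obtain C q where "C \<ge> 0" "0 < q" "q < 1"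
    and bound: "\<And>f K n x. lipschitz_disc f K \<Longrightarrow> x \<in> D \<Longrightarrow> cmod (quotient n f x - ell f) \<le> C * q ^ n * K"
    using quotient_decay by blast
  then have "(\<lambda>n. C * q ^ n * K) \<longlonglongrightarrow> C * 0 * K"
    by (intro tendsto_intros LIMSEQ_realpow_zero) auto
  then have "(\<lambda>n. quotient n f x - ell f) \<longlonglongrightarrow> 0"
    by (intro Lim_null_comparison[OF always_eventually[OF allI[OF bound[OF f x]]]]) simp
  then show ?thesis by (simp add: LIM_zero_iff)
qed

section \<open>Linearity, boundedness and positivity of the functional\<close>

lemma Lam_add: "L (\<lambda>z. f z + g z) = (\<lambda>z. L f z + L g z)"
  by (simp add: Lam_def fun_eq_iff sum.distrib distrib_left)

lemma Lam_cmult: "L (\<lambda>z. c * f z) = (\<lambda>z. c * L f z)"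
  by (simp add: Lam_def fun_eq_iff sum_distrib_left ac_simps)

lemma Lam_power_add: "(L ^^ n) (\<lambda>z. f z + g z) = (\<lambda>z. (L ^^ n) f z + (L ^^ n) g z)"
  by (induction n) (simp_all add: Lam_add)

lemma Lam_power_cmult: "(L ^^ n) (\<lambda>z. c * f z) = (\<lambda>z. c * (L ^^ n) f z)"
  by (induction n) (simp_all add: Lam_cmult)

lemma lipschitz_disc_add: "lipschitz_disc f K \<Longrightarrow> lipschitz_disc g K' \<Longrightarrow> lipschitz_disc (\<lambda>z. f z + g z) (K + K')"
  unfolding lipschitz_disc_def
proof (intro conjI ballI; elim conjE)
  fix x y assume x: "x \<in> D" and y: "y \<in> D"
    and f: "\<forall>x\<in>D. \<forall>y\<in>D. cmod (f x - f y) \<le> K * cmod (x - y)"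
    and g: "\<forall>x\<in>D. \<forall>y\<in>D. cmod (g x - g y) \<le> K' * cmod (x - y)"
  have "cmod ((f x - f y) + (g x - g y)) \<le> K * cmod (x - y) + K' * cmod (x - y)"
    using f g x y by (intro norm_triangle_le add_mono) blast+
  then show "cmod (f x + g x - (f y + g y)) \<le> (K + K') * cmod (x - y)"
    by (simp add: algebra_simps)
qed simp

lemma lipschitz_disc_cmult: "lipschitz_disc f K \<Longrightarrow> lipschitz_disc (\<lambda>z. c * f z) (cmod c * K)"
  unfolding lipschitz_disc_def
  by (auto simp: right_diff_distrib[symmetric] norm_mult mult.assoc intro!: mult_left_mono)

lemma ell_add:
  assumes "lipschitz_disc f K" "lipschitz_disc g K'"
  shows "ell (\<lambda>z. f z + g z) = ell f + ell g"
proof -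
  have "quotient n (\<lambda>z. f z + g z) center = quotient n f center + quotient n g center" for n
    by (simp add: quotient_def Lam_power_add add_divide_distrib)
  then have "(\<lambda>n. quotient n (\<lambda>z. f z + g z) center) \<longlonglongrightarrow> ell f + ell g"
    using tendsto_add[OF quotient_tendsto[OF assms(1) center(1)] quotient_tendsto[OF assms(2) center(1)]] by simp
  then show ?thesis
    using quotient_tendsto[OF lipschitz_disc_add[OF assms] center(1)] LIMSEQ_unique by blast
qed

lemma ell_cmult:
  assumes "lipschitz_disc f K"
  shows "ell (\<lambda>z. c * f z) = c * ell f"
proof -
  have "quotient n (\<lambda>z. c * f z) center = c * quotient n f center" for n
    by (simp add: quotient_def Lam_power_cmult)
  then have "(\<lambda>n. quotient n (\<lambda>z. c * f z) center) \<longlonglongrightarrow> c * ell f"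
    using tendsto_mult[OF tendsto_const quotient_tendsto[OF assms(1) center(1)], of c] by simp
  then show ?thesis
    using quotient_tendsto[OF lipschitz_disc_cmult[OF assms] center(1)] LIMSEQ_unique by blast
qed

lemma ell_bound:
  assumes f: "lipschitz_disc f K" and M: "\<And>x. x \<in> D \<Longrightarrow> cmod (f x) \<le> M"
  shows "cmod (ell f) \<le> M"
proof (rule LIMSEQ_le_const2[OF tendsto_norm[OF quotient_tendsto[OF f center(1)]]])
  have "cmod (quotient n f center - 0) \<le> M" for n
    by (rule quotient_near[of 0]) (use M center in \<open>auto simp: quotient_def mass_def\<close>)
  then show "\<exists>N. \<forall>n\<ge>N. cmod (quotient n f center) \<le> M" by simp
qed

text \<open>Averages with nonnegative weights respect real values and two-sided bounds; in the limit
  this gives positivity of the functional.\<close>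

lemma quotient_real:
  assumes f: "\<And>x. x \<in> D \<Longrightarrow> f x = of_real (\<phi> x) \<and> a \<le> \<phi> x \<and> \<phi> x \<le> b" and x: "x \<in> D"
  shows "\<exists>t. quotient n f x = of_real t \<and> a \<le> t \<and> t \<le> b"
proof (cases n)
  case 0
  then show ?thesis using f[OF x] by (simp add: quotient_def mass_def)
next
  case (Suc k)
  interpret markov_step "words k" D "kernel 0 k" branch "6 * s" "scale_bound k" by (rule markov)
  let ?t = "\<Sum>xs\<in>words k. kernel 0 k xs x * \<phi> (branch xs x)"
  have "quotient n f x = of_real ?t"
    using quotient_avg[OF x, of 0 k f] f maps[OF _ x] unfolding avg_def Suc
    by (simp add: quotient_def mass_def)
  moreover have "?t \<ge> (\<Sum>xs\<in>words k. kernel 0 k xs x * a)"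
    using f maps[OF _ x] nonneg[OF _ x] by (intro sum_mono mult_left_mono) auto
  moreover have "?t \<le> (\<Sum>xs\<in>words k. kernel 0 k xs x * b)"
    using f maps[OF _ x] nonneg[OF _ x] by (intro sum_mono mult_left_mono) auto
  ultimately show ?thesis using sum1[OF x] by (intro exI[of _ ?t]) (simp add: sum_distrib_right[symmetric])
qed

lemma ell_real:
  assumes f: "lipschitz_disc f K" and real: "\<And>x. x \<in> D \<Longrightarrow> f x = of_real (\<phi> x) \<and> a \<le> \<phi> x \<and> \<phi> x \<le> b"
  obtains t where "ell f = of_real t" "a \<le> t" "t \<le> b"
proof -
  note lim = quotient_tendsto[OF f center(1)]
  have q: "Im (quotient n f center) = 0" "a \<le> Re (quotient n f center)" "Re (quotient n f center) \<le> b" for n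
    using quotient_real[of f \<phi> a b center n, OF real center(1)] by auto
  have "Im (ell f) = 0" using LIMSEQ_unique[OF tendsto_Im[OF lim]] q(1) by simp
  then have "ell f = of_real (Re (ell f))" by (simp add: complex_eq_iff)
  moreover have "a \<le> Re (ell f)" by (rule LIMSEQ_le_const[OF tendsto_Re[OF lim]]) (use q in auto)
  moreover have "Re (ell f) \<le> b" by (rule LIMSEQ_le_const2[OF tendsto_Re[OF lim]]) (use q in auto)
  ultimately show ?thesis using that by blast
qed

end

section \<open>Jets of branches\<close>

text \<open>With u = 1/(z + d), this is the coefficient of u^(a + i) (- \<kappa>)^i times the i-th
  derivative at the image, in the a-th Wirtinger derivative of a weighted branch. Differentiating
  u^(a + i) and the weight gives the factor - (a + i + s); the chain rule raises i. For s = 0 these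
  are Lah numbers up to sign.\<close>

fun branch_coeff :: "real \<Rightarrow> nat \<Rightarrow> nat \<Rightarrow> real" where
  "branch_coeff s 0 i = (if i = 0 then 1 else 0)"
| "branch_coeff s (Suc a) i = - (real a + real i + s) * branch_coeff s a i + (case i of 0 \<Rightarrow> 0 | Suc i' \<Rightarrow> branch_coeff s a i')"

lemma branch_coeff_above: "i > a \<Longrightarrow> branch_coeff s a i = 0"
  by (induction a arbitrary: i) (auto split: nat.split)

lemma branch_coeff_sum:
  fixes g :: "nat \<Rightarrow> complex"
  shows "(\<Sum>i\<le>a. of_real (branch_coeff s a i) * (- of_real (real a + real i + s) * g i + g (Suc i)))
    = (\<Sum>i\<le>Suc a. of_real (branch_coeff s (Suc a) i) * g i)"
proof -
  have "(\<Sum>i\<le>Suc a. of_real (branch_coeff s (Suc a) i) * g i) =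
      (\<Sum>i\<le>Suc a. of_real (- (real a + real i + s) * branch_coeff s a i) * g i) +
      (\<Sum>i\<le>Suc a. of_real (case i of 0 \<Rightarrow> 0 | Suc i' \<Rightarrow> branch_coeff s a i') * g i)"
    by (simp only: branch_coeff.simps of_real_add distrib_right sum.distrib)
  also have "(\<Sum>i\<le>Suc a. of_real (- (real a + real i + s) * branch_coeff s a i) * g i)
    = (\<Sum>i\<le>a. of_real (- (real a + real i + s) * branch_coeff s a i) * g i)"
    by (simp add: branch_coeff_above)
  also have "(\<Sum>i\<le>Suc a. of_real (case i of 0 \<Rightarrow> 0 | Suc i' \<Rightarrow> branch_coeff s a i') * g i) = (\<Sum>i\<le>a. of_real (branch_coeff s a i) * g (Suc i))"
    by (subst sum.atMost_Suc_shift) simp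
  finally show ?thesis by (simp add: sum.distrib[symmetric] algebra_simps)
qed

lemma jet_sum:
  assumes "finite A" "\<And>x. x \<in> A \<Longrightarrow> jet p q H n (F x)"
  shows "jet p q H n (\<lambda>i j z. \<Sum>x\<in>A. F x i j z)"
  using assms
proof (induction A rule: finite_induct)
  case (insert x A)
  then show ?case using jet_add[of p q H n "F x" "\<lambda>i j z. \<Sum>x\<in>A. F x i j z"] by simp
qed (simp add: jet_def)

text \<open>Formally |w|^(-2 s) is w^(-s) times its conjugate, with logarithmic differential - s
  (h/w + cnj (h/w)).\<close>

lemma norm_powr_has_derivative:
  fixes z d :: complex
  assumes "z + d \<noteq> 0"
  shows "((\<lambda>z. complex_of_real (cmod (z + d) powr (- (2 * s)))) has_derivative
    (\<lambda>h. of_real (cmod (z + d) powr (- (2 * s))) * (- of_real s * (h / (z + d) + cnj (h / (z + d)))))) (at z)"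
proof -
  have "((\<lambda>z. z + d) has_derivative (\<lambda>h. h)) (at z)" by (auto intro!: derivative_eq_intros)
  then have n: "((\<lambda>z. cmod (z + d)) has_derivative (\<lambda>h. inner h (sgn (z + d)))) (at z)"
    using has_derivative_compose[of "\<lambda>z. z + d" "\<lambda>h. h" z UNIV cmod "\<lambda>h. inner h (sgn (z + d))"] has_derivative_norm[OF assms] by simp
  have "((\<lambda>z. cmod (z + d) powr (- (2 * s))) has_derivative
    (\<lambda>h. (cmod (z + d) powr (- (2 * s))) * (0 * ln (cmod (z + d)) + inner h (sgn (z + d)) * (- (2 * s)) / cmod (z + d)))) (at z)"
    using assms by (intro has_derivative_powr n has_derivative_const) auto
  then have D: "((\<lambda>z. complex_of_real (cmod (z + d) powr (- (2 * s)))) has_derivative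
    (\<lambda>h. of_real ((cmod (z + d) powr (- (2 * s))) * (0 * ln (cmod (z + d)) + inner h (sgn (z + d)) * (- (2 * s)) / cmod (z + d))))) (at z)"
    by (rule bounded_linear.has_derivative[OF bounded_linear_of_real])
  have c: "of_real (inner h (sgn (z + d)) / cmod (z + d)) = (h / (z + d) + cnj (h / (z + d))) / 2" for h
  proof -
    have "inner h (sgn (z + d)) / cmod (z + d) = Re (h / (z + d))"
    proof -
      have "inner h (sgn (z + d)) / cmod (z + d) = inner h (z + d) / (cmod (z + d))\<^sup>2"
        by (simp add: sgn_div_norm power2_eq_square divide_inverse)
      then show ?thesis by (simp only: cmod_power2 Re_divide inner_complex_def)
    qed
    then show ?thesis using complex_add_cnj[of "h / (z + d)"] by simp
  qed
  show ?thesis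
  proof (rule has_derivative_eq_rhs[OF D], rule ext)
    fix h
    have "of_real ((cmod (z + d) powr (- (2 * s))) * (0 * ln (cmod (z + d)) + inner h (sgn (z + d)) * (- (2 * s)) / cmod (z + d)))
      = of_real (cmod (z + d) powr (- (2 * s))) * (of_real (- (2 * s)) * complex_of_real (inner h (sgn (z + d)) / cmod (z + d)))"
      by (simp add: field_simps)
    also have "\<dots> = of_real (cmod (z + d) powr (- (2 * s))) * (- of_real s * (h / (z + d) + cnj (h / (z + d))))"
    proof -
      have "of_real (- (2 * s)) * (x / 2) = - of_real s * x" for x :: complex by simp
      then show ?thesis unfolding c by simp
    qed
    finally show "of_real ((cmod (z + d) powr (- (2 * s))) * (0 * ln (cmod (z + d)) + inner h (sgn (z + d)) * (- (2 * s)) / cmod (z + d)))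
      = of_real (cmod (z + d) powr (- (2 * s))) * (- of_real s * (h / (z + d) + cnj (h / (z + d))))" .
  qed
qed

text \<open>The branch is holomorphic and the weight splits formally into a holomorphic and an
  antiholomorphic factor, so the two Wirtinger derivatives act independently and their coefficients
  multiply.\<close>

definition branch_jet :: "real \<Rightarrow> complex list \<Rightarrow> (nat \<Rightarrow> nat \<Rightarrow> complex \<Rightarrow> complex) \<Rightarrow> nat \<Rightarrow> nat \<Rightarrow> complex \<Rightarrow> complex" where
  "branch_jet s xs W a b z = of_real (weight s xs z) *
    (\<Sum>i\<le>a. \<Sum>j\<le>b. of_real (branch_coeff s a i) * of_real (branch_coeff s b j) *
      (inverse (z + word_shift xs) ^ (a + i) * cnj (inverse (z + word_shift xs)) ^ (b + j) *
       ((- word_scale xs) ^ i * cnj (- word_scale xs) ^ j * W i j (branch xs z))))"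

lemma branch_term_has_derivative:
  fixes \<kappa> d z :: complex and F :: "complex \<Rightarrow> complex" and s :: real
  assumes zd: "z + d \<noteq> 0"
    and F: "(F has_derivative (\<lambda>h. h * F1 + cnj h * F2)) (at (a0 + \<kappa> / (z + d)))"
  defines "u \<equiv> inverse (z + d)" and "w \<equiv> complex_of_real (cmod (z + d) powr (- (2 * s)))"
  shows "((\<lambda>z. of_real (cmod (z + d) powr (- (2 * s))) * (inverse (z + d) ^ p * cnj (inverse (z + d)) ^ q * F (a0 + \<kappa> / (z + d)))) has_derivative
    (\<lambda>h. h * (w * (- of_real (real p + s) * u ^ Suc p * cnj u ^ q * F (a0 + \<kappa> / (z + d)) + (- \<kappa>) * u ^ (p + 2) * cnj u ^ q * F1))
      + cnj h * (w * (- of_real (real q + s) * u ^ p * cnj u ^ Suc q * F (a0 + \<kappa> / (z + d)) + cnj (- \<kappa>) * u ^ p * cnj u ^ (q + 2) * F2)))) (at z)"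
proof -
  have du: "((\<lambda>z. inverse (z + d)) has_derivative (\<lambda>h. - (h * u\<^sup>2))) (at z)"
    using zd by (auto intro!: derivative_eq_intros simp: u_def power2_eq_square)
  have dp: "((\<lambda>z. inverse (z + d) ^ p) has_derivative (\<lambda>h. - (h * (of_nat p * u ^ Suc p)))) (at z)"
  proof (rule has_derivative_eq_rhs[OF has_derivative_power[OF du]], rule ext)
    fix h show "of_nat p * (- (h * u\<^sup>2)) * inverse (z + d) ^ (p - 1) = - (h * (of_nat p * u ^ Suc p))"
      by (cases p) (simp_all add: u_def power2_eq_square)
  qed
  have "((\<lambda>z. inverse (z + d) ^ q) has_derivative (\<lambda>h. - (h * (of_nat q * u ^ Suc q)))) (at z)"
  proof (rule has_derivative_eq_rhs[OF has_derivative_power[OF du]], rule ext)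
    fix h show "of_nat q * (- (h * u\<^sup>2)) * inverse (z + d) ^ (q - 1) = - (h * (of_nat q * u ^ Suc q))"
      by (cases q) (simp_all add: u_def power2_eq_square)
  qed
  from bounded_linear.has_derivative[OF bounded_linear_cnj this]
  have dq: "((\<lambda>z. cnj (inverse (z + d)) ^ q) has_derivative (\<lambda>h. - (cnj h * (of_nat q * cnj u ^ Suc q)))) (at z)"
    by (simp add: complex_cnj_power)
  have dth: "((\<lambda>z. a0 + \<kappa> / (z + d)) has_derivative (\<lambda>h. h * ((- \<kappa>) * u\<^sup>2))) (at z)"
    using zd by (auto intro!: derivative_eq_intros simp: u_def power2_eq_square field_simps)
  have dF: "((\<lambda>z. F (a0 + \<kappa> / (z + d))) has_derivative (\<lambda>h. h * ((- \<kappa>) * u\<^sup>2) * F1 + cnj (h * ((- \<kappa>) * u\<^sup>2)) * F2)) (at z)"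
    by (rule has_derivative_compose[OF dth, where g = F, OF F])
  have dw: "((\<lambda>z. complex_of_real (cmod (z + d) powr (- (2 * s)))) has_derivative (\<lambda>h. w * (- of_real s * (h * u + cnj (h * u))))) (at z)"
    using norm_powr_has_derivative[OF zd, of s] by (simp add: w_def u_def divide_inverse)
  have D: "((\<lambda>z. of_real (cmod (z + d) powr (- (2 * s))) * (inverse (z + d) ^ p * cnj (inverse (z + d)) ^ q * F (a0 + \<kappa> / (z + d)))) has_derivative
    (\<lambda>h. w * ((u ^ p * cnj u ^ q) * (h * ((- \<kappa>) * u\<^sup>2) * F1 + cnj (h * ((- \<kappa>) * u\<^sup>2)) * F2)
         + (u ^ p * (- (cnj h * (of_nat q * cnj u ^ Suc q))) + (- (h * (of_nat p * u ^ Suc p))) * cnj u ^ q) * F (a0 + \<kappa> / (z + d)))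
       + (w * (- of_real s * (h * u + cnj (h * u)))) * (u ^ p * cnj u ^ q * F (a0 + \<kappa> / (z + d))))) (at z)"
    using has_derivative_mult[OF dw has_derivative_mult[OF has_derivative_mult[OF dp dq] dF]]
    by (simp add: w_def u_def)
  show ?thesis
    by (rule has_derivative_eq_rhs[OF D]) (simp add: fun_eq_iff algebra_simps power2_eq_square power_add)
qed

context transfer
begin

lemma branch_jet_0: "branch_jet s xs W 0 0 z = of_real (weight s xs z) * W 0 0 (branch xs z)"
  by (simp add: branch_jet_def)

lemma wirtinger_branch_jet:
  assumes xs: "set xs \<subseteq> B" "xs \<noteq> []" and W: "wirtinger_jet H n W"
  shows "wirtinger_jet H n (branch_jet s xs W)"
  unfolding jet_def
proof (intro conjI allI impI ballI)
  let ?d = "word_shift xs" and ?\<kappa> = "word_scale xs"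
  have zd: "z + ?d \<noteq> 0" if "z \<in> closure H" for z using word_shift_ge(3)[OF xs closure_H_Re[OF that]] .
  {
    fix a b assume ab: "a + b \<le> n"
    have cb: "continuous_on (closure H) (branch xs)"
      unfolding branch_def[abs_def] by (intro continuous_intros) (use zd in auto)
    have cW: "continuous_on (closure H) (\<lambda>z. W i j (branch xs z))" if "i \<le> a" "j \<le> b" for i j
      using branch_in_disc(2)[OF xs] D_closure that ab
      by (intro continuous_on_compose2[OF jet_continuous[OF W] cb]) auto
    have cw: "continuous_on (closure H) (\<lambda>z. of_real (weight s xs z) :: complex)"
      unfolding weight_def by (intro continuous_intros) (use zd in auto)
    show "continuous_on (closure H) (branch_jet s xs W a b)"
      unfolding branch_jet_def by (intro continuous_intros cw cW) (use zd in auto)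
  }
  fix a b z assume ab: "a + b < n" and z: "z \<in> H"
  have zc: "z \<in> closure H" using z closure_subset by auto
  let ?w = "\<lambda>z. complex_of_real (cmod (z + ?d) powr (- (2 * s)))"
  let ?c = "\<lambda>a i. complex_of_real (branch_coeff s a i)"
  define K where "K = complex_of_real (cmod ?\<kappa> powr s)"
  define u where "u = inverse (z + ?d)"
  define V where "V i j = (- ?\<kappa>) ^ i * cnj (- ?\<kappa>) ^ j * W i j (branch xs z)" for i j
  \<comment> \<open>\<open>A1\<close> and \<open>A2\<close> are what the two Wirtinger derivatives
    make of summand i, j, up to the common factor: the first term comes from the powers of u and the
    weight, the second from the chain rule.\<close>
  define A1 where "A1 i j = - of_real (real a + real i + s) * u ^ Suc (a + i) * cnj u ^ (b + j) * V i j + u ^ Suc (a + Suc i) * cnj u ^ (b + j) * V (Suc i) j" for i j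
  define A2 where "A2 i j = - of_real (real b + real j + s) * u ^ (a + i) * cnj u ^ Suc (b + j) * V i j + u ^ (a + i) * cnj u ^ Suc (b + Suc j) * V i (Suc j)" for i j
  have bj: "branch_jet s xs W a b = (\<lambda>z. \<Sum>i\<le>a. \<Sum>j\<le>b. (K * (?c a i * ?c b j * ((- ?\<kappa>) ^ i * cnj (- ?\<kappa>) ^ j))) *
      (?w z * (inverse (z + ?d) ^ (a + i) * cnj (inverse (z + ?d)) ^ (b + j) * W i j (word_offset xs + ?\<kappa> / (z + ?d)))))" for a b
    unfolding branch_jet_def[abs_def] branch_def weight_def K_def sum_distrib_left of_real_mult
    by (intro ext sum.cong refl) (simp only: ac_simps)
  have T: "((\<lambda>z. (K * (?c a i * ?c b j * ((- ?\<kappa>) ^ i * cnj (- ?\<kappa>) ^ j))) *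
      (?w z * (inverse (z + ?d) ^ (a + i) * cnj (inverse (z + ?d)) ^ (b + j) * W i j (word_offset xs + ?\<kappa> / (z + ?d))))) has_derivative
     (\<lambda>h. h * (K * ?w z * (?c a i * ?c b j * A1 i j)) + cnj h * (K * ?w z * (?c a i * ?c b j * A2 i j)))) (at z)"
    if i: "i \<le> a" and j: "j \<le> b" for i j
  proof -
    have "branch xs z \<in> H" using branch_in_disc(1)[OF xs z] disc_H by auto
    then have "(W i j has_derivative (\<lambda>h. h * W (Suc i) j (branch xs z) + cnj h * W i (Suc j) (branch xs z))) (at (branch xs z))"
      using i j ab by (intro jet_has_derivative[OF W]) auto
    from has_derivative_mult_right[OF branch_term_has_derivative[OF zd[OF zc] this[unfolded branch_def], of s "a + i" "b + j"],
        of "K * (?c a i * ?c b j * ((- ?\<kappa>) ^ i * cnj (- ?\<kappa>) ^ j))"]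
    show ?thesis
      by (rule has_derivative_eq_rhs)
        (simp add: fun_eq_iff A1_def A2_def V_def u_def branch_def power_add power2_eq_square algebra_simps)
  qed
  have "(branch_jet s xs W a b has_derivative
      (\<lambda>h. \<Sum>i\<le>a. \<Sum>j\<le>b. h * (K * ?w z * (?c a i * ?c b j * A1 i j)) + cnj h * (K * ?w z * (?c a i * ?c b j * A2 i j)))) (at z)"
    unfolding bj by (intro has_derivative_sum T) auto
  moreover have "branch_jet s xs W (Suc a) b z = (\<Sum>i\<le>a. \<Sum>j\<le>b. K * ?w z * (?c a i * ?c b j * A1 i j))"
  proof -
    let ?g = "\<lambda>i. \<Sum>j\<le>b. ?c b j * (u ^ (Suc a + i) * cnj u ^ (b + j) * V i j)"
    have "branch_jet s xs W (Suc a) b z = K * ?w z * (\<Sum>i\<le>Suc a. ?c (Suc a) i * ?g i)"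
      unfolding branch_jet_def weight_def K_def u_def V_def sum_distrib_left of_real_mult
      by (intro sum.cong refl) (simp only: ac_simps)
    also have "\<dots> = K * ?w z * (\<Sum>i\<le>a. ?c a i * (- of_real (real a + real i + s) * ?g i + ?g (Suc i)))"
      by (simp only: branch_coeff_sum[of s a ?g])
    also have "\<dots> = (\<Sum>i\<le>a. \<Sum>j\<le>b. K * ?w z * (?c a i * ?c b j * A1 i j))"
      unfolding A1_def sum_distrib_left sum.distrib[symmetric]
      by (intro sum.cong refl) (simp add: algebra_simps)
    finally show ?thesis .
  qed
  moreover have "branch_jet s xs W a (Suc b) z = (\<Sum>i\<le>a. \<Sum>j\<le>b. K * ?w z * (?c a i * ?c b j * A2 i j))"
  proof -
    let ?g = "\<lambda>i j. u ^ (a + i) * cnj u ^ (Suc b + j) * V i j"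
    have "branch_jet s xs W a (Suc b) z = (\<Sum>i\<le>a. K * ?w z * ?c a i * (\<Sum>j\<le>Suc b. ?c (Suc b) j * ?g i j))"
      unfolding branch_jet_def weight_def K_def u_def V_def sum_distrib_left of_real_mult
      by (intro sum.cong refl) (simp only: ac_simps)
    also have "\<dots> = (\<Sum>i\<le>a. K * ?w z * ?c a i * (\<Sum>j\<le>b. ?c b j * (- of_real (real b + real j + s) * ?g i j + ?g i (Suc j))))"
      by (simp only: branch_coeff_sum[of s b "?g i" for i])
    also have "\<dots> = (\<Sum>i\<le>a. \<Sum>j\<le>b. K * ?w z * (?c a i * ?c b j * A2 i j))"
      unfolding A2_def sum_distrib_left
      by (intro sum.cong refl) (simp add: algebra_simps)
    finally show ?thesis .
  qed
  ultimately show "(branch_jet s xs W a b has_derivative (\<lambda>h. h * branch_jet s xs W (Suc a) b z + cnj h * branch_jet s xs W a (Suc b) z)) (at z)"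
    by (simp only: sum.distrib sum_distrib_left)
qed

definition coeff_bound :: real where
  "coeff_bound = (\<Sum>a\<le>m. \<Sum>i\<le>a. \<bar>branch_coeff s a i\<bar>)\<^sup>2"

lemma coeff_bound_nonneg: "coeff_bound \<ge> 0"
  by (simp add: coeff_bound_def)

text \<open>Since |z + d| \<ge> 1, all powers of u are dropped. What remains is the power of the
  scale in front of each derivative, the gain on which the decay and the approximation estimates
  rest.\<close>

lemma branch_jet_bound:
  assumes xs: "set xs \<subseteq> B" "xs \<noteq> []" and z: "z \<in> closure H" and ab: "a + b \<le> m"
    and R: "\<And>i j. i \<le> a \<Longrightarrow> j \<le> b \<Longrightarrow> cmod (word_scale xs) ^ (i + j) * cmod (W i j (branch xs z)) \<le> R"
  shows "cmod (branch_jet s xs W a b z) \<le> weight s xs z * (coeff_bound * R)"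
proof -
  let ?d = "word_shift xs" and ?\<kappa> = "word_scale xs" and ?c = "branch_coeff s"
  have w: "weight s xs z \<ge> 0" using weight_pos[OF xs closure_H_Re[OF z]] by simp
  have R0: "R \<ge> 0" using R[of 0 0] by (rule order_trans[rotated]) simp_all
  have u: "cmod (inverse (z + ?d)) \<le> 1"
    using word_shift_ge(2)[OF xs closure_H_Re[OF z]] by (simp add: norm_inverse inverse_le_1_iff)
  have tm: "cmod (of_real (?c a i) * of_real (?c b j) * (inverse (z + ?d) ^ (a + i) * cnj (inverse (z + ?d)) ^ (b + j) *
       ((- ?\<kappa>) ^ i * cnj (- ?\<kappa>) ^ j * W i j (branch xs z)))) \<le> \<bar>?c a i\<bar> * \<bar>?c b j\<bar> * R" if "i \<le> a" "j \<le> b" for i j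
  proof -
    have "cmod (inverse (z + ?d)) ^ (a + i) * cmod (inverse (z + ?d)) ^ (b + j) \<le> 1 * 1"
      using u by (intro mult_mono power_le_one) auto
    then have "(cmod (inverse (z + ?d)) ^ (a + i) * cmod (inverse (z + ?d)) ^ (b + j)) * (cmod ?\<kappa> ^ (i + j) * cmod (W i j (branch xs z))) \<le> (1 * 1) * R"
      by (rule mult_mono[OF _ R[OF that]]) auto
    then have "\<bar>?c a i\<bar> * \<bar>?c b j\<bar> * ((cmod (inverse (z + ?d)) ^ (a + i) * cmod (inverse (z + ?d)) ^ (b + j)) * (cmod ?\<kappa> ^ (i + j) * cmod (W i j (branch xs z)))) \<le> \<bar>?c a i\<bar> * \<bar>?c b j\<bar> * R"
      by (intro mult_left_mono) auto
    then show ?thesis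
      by (simp only: norm_mult norm_power norm_of_real complex_mod_cnj norm_minus_cancel power_add mult.assoc)
  qed
  let ?S = "\<lambda>a. \<Sum>i\<le>a. \<bar>?c a i\<bar>"
  have S: "?S a \<le> (\<Sum>a\<le>m. ?S a)" if "a \<le> m" for a
    using that by (intro member_le_sum sum_nonneg) auto
  have "cmod (branch_jet s xs W a b z) \<le> weight s xs z * (\<Sum>i\<le>a. \<Sum>j\<le>b. \<bar>?c a i\<bar> * \<bar>?c b j\<bar> * R)"
    unfolding branch_jet_def norm_mult[of "of_real (weight s xs z)"] norm_of_real abs_of_nonneg[OF w]
    by (intro mult_left_mono w order_trans[OF norm_sum] sum_mono tm) auto
  also have "(\<Sum>i\<le>a. \<Sum>j\<le>b. \<bar>?c a i\<bar> * \<bar>?c b j\<bar> * R) = ?S a * ?S b * R"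
    by (subst sum_product) (simp only: sum_distrib_right)
  also have "\<dots> \<le> coeff_bound * R"
    unfolding coeff_bound_def power2_eq_square using ab R0
    by (intro mult_right_mono mult_mono S sum_nonneg) auto
  finally show ?thesis using w by (simp add: mult_left_mono)
qed

section \<open>Action on smooth functions\<close>

abbreviation X :: "(complex \<Rightarrow> complex) set" where "X \<equiv> CmSpace H m"
abbreviation NX :: "(complex \<Rightarrow> complex) \<Rightarrow> real" where "NX \<equiv> Cm_norm H m"

sublocale X: function_banach_space "CmSpace H m" "Cm_norm H m" "2 ^ m"
  by (rule CmSpace_banach[OF H(1,2) H_nonempty])

sublocale Y: function_normed_space "CSpace H" "sup_norm H"
  by (rule CSpace_normed[OF H(2) H_nonempty])

lemma jets_agree:
  assumes W: "wirtinger_jet H m W" and V: "wirtinger_jet H m V"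
    and eq: "\<And>z. z \<in> H \<Longrightarrow> W 0 0 z = V 0 0 z" and ij: "i + j \<le> m" and z: "z \<in> closure H"
  shows "W i j z = V i j z"
proof -
  have "cmod (W i j z - V i j z) \<le> 0"
  proof (rule continuous_on_closure_norm_le[OF _ _ z])
    show "continuous_on (closure H) (\<lambda>z. W i j z - V i j z)"
      by (intro continuous_intros jet_continuous[OF W] jet_continuous[OF V] ij)
  qed (use jet_unique[OF H(1) W V eq ij] in auto)
  then show ?thesis by simp
qed

text \<open>Bounds derivatives up to an order l that may be less than m, as the induction on orders
  requires. Any two jets of f agree on the closure, so one of them suffices to verify the
  bound.\<close>

definition jet_le :: "nat \<Rightarrow> (complex \<Rightarrow> complex) \<Rightarrow> real \<Rightarrow> bool" where
  "jet_le l f M \<longleftrightarrow> (\<forall>W. wirtinger_jet H m W \<longrightarrow> (\<forall>z\<in>H. W 0 0 z = f z) \<longrightarrow>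
     (\<forall>i j z. i + j \<le> l \<longrightarrow> z \<in> closure H \<longrightarrow> cmod (W i j z) \<le> M))"

lemma jet_leI:
  assumes V: "wirtinger_jet H m V" "\<And>z. z \<in> H \<Longrightarrow> V 0 0 z = f z" and l: "l \<le> m"
    and b: "\<And>i j z. i + j \<le> l \<Longrightarrow> z \<in> closure H \<Longrightarrow> cmod (V i j z) \<le> M"
  shows "jet_le l f M"
  unfolding jet_le_def
proof (intro allI impI)
  fix W i j z assume W: "wirtinger_jet H m W" "\<forall>z\<in>H. W 0 0 z = f z" and ij: "i + j \<le> l" "z \<in> closure H"
  have "W i j z = V i j z" by (rule jets_agree[OF W(1) V(1)]) (use W(2) V(2) ij l in auto)
  then show "cmod (W i j z) \<le> M" using b[OF ij] by simp
qed

lemma jet_leD: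
  assumes "jet_le l f M" "wirtinger_jet H m W" "\<And>z. z \<in> closure H \<Longrightarrow> W 0 0 z = f z" "i + j \<le> l" "z \<in> closure H"
  shows "cmod (W i j z) \<le> M"
  using assms closure_subset[of H] unfolding jet_le_def by blast

lemma jet_le_mono: "jet_le l f M \<Longrightarrow> M \<le> M' \<Longrightarrow> l' \<le> l \<Longrightarrow> jet_le l' f M'"
  unfolding jet_le_def by (meson order_trans)

lemma X_jet:
  assumes "f \<in> X"
  obtains W where "wirtinger_jet H m W" "\<And>z. z \<in> closure H \<Longrightarrow> W 0 0 z = f z"
    "\<And>i j z. i + j \<le> m \<Longrightarrow> z \<in> closure H \<Longrightarrow> cmod (W i j z) \<le> NX f"
  using CmSpace_jet[OF H(1,2) assms] by metis

lemma jet_le_norm: "f \<in> X \<Longrightarrow> jet_le m f (NX f)"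
proof -
  assume f: "f \<in> X"
  obtain W where W: "wirtinger_jet H m W" "\<And>z. z \<in> closure H \<Longrightarrow> W 0 0 z = f z"
    "\<And>i j z. i + j \<le> m \<Longrightarrow> z \<in> closure H \<Longrightarrow> cmod (W i j z) \<le> NX f"
    using X_jet[OF f] by metis
  show ?thesis by (rule jet_leI[OF W(1) _ order_refl W(3)]) (use W(2) closure_subset[of H] in auto)
qed

lemma norm_le_jet_le:
  assumes f: "f \<in> X" and le: "jet_le m f M"
  shows "NX f \<le> 2 ^ m * M"
proof -
  obtain W where W: "wirtinger_jet H m W" "\<And>z. z \<in> closure H \<Longrightarrow> W 0 0 z = f z"
    "\<And>i j z. i + j \<le> m \<Longrightarrow> z \<in> closure H \<Longrightarrow> cmod (W i j z) \<le> NX f"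
    using X_jet[OF f] by metis
  show ?thesis
    by (rule Cm_norm_le_jet[OF H(1) H_nonempty W(1)]) (use W(2) jet_leD[OF le W(1,2)] closure_subset[of H] in auto)
qed

lemma X_outside: "f \<in> X \<Longrightarrow> z \<notin> closure H \<Longrightarrow> f z = 0"
  by (simp add: CmSpace_def)

lemma X_pointwise: "f \<in> X \<Longrightarrow> cmod (f z) \<le> NX f"
proof -
  assume f: "f \<in> X"
  obtain W where W: "wirtinger_jet H m W" "\<And>z. z \<in> closure H \<Longrightarrow> W 0 0 z = f z"
    "\<And>i j z. i + j \<le> m \<Longrightarrow> z \<in> closure H \<Longrightarrow> cmod (W i j z) \<le> NX f"
    using X_jet[OF f] by metis
  show ?thesis
    using W(2)[of z] W(3)[of 0 0 z] X_outside[OF f, of z] X.norm_nonneg[OF f] by (cases "z \<in> closure H") auto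
qed

definition power_jet :: "nat \<Rightarrow> (nat \<Rightarrow> nat \<Rightarrow> complex \<Rightarrow> complex) \<Rightarrow> nat \<Rightarrow> nat \<Rightarrow> complex \<Rightarrow> complex" where
  "power_jet k W = (\<lambda>i j z. \<Sum>xs\<in>words k. branch_jet s xs W i j z)"

lemma wirtinger_power_jet: "wirtinger_jet H n W \<Longrightarrow> wirtinger_jet H n (power_jet k W)"
  unfolding power_jet_def
  by (rule jet_sum[OF finite_words]) (rule wirtinger_branch_jet[OF words_subset words_nonempty])

lemma power_jet_0:
  assumes "\<And>z. z \<in> closure H \<Longrightarrow> W 0 0 z = f z" "z \<in> closure H"
  shows "power_jet k W 0 0 z = (L ^^ Suc k) f z"
proof -
  have "branch xs z \<in> closure H" if "xs \<in> words k" for xs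
    using branch_in_disc(2)[OF words_subset[OF that] words_nonempty[OF that] assms(2)] D_closure by blast
  then show ?thesis unfolding power_jet_def Lam_power[OF assms(2)] branch_jet_0 using assms(1) by simp
qed

text \<open>The jet may vary with the word, because Taylor remainders are taken at a different point
  for each branch.\<close>

lemma sum_branch_jet_bound:
  assumes z: "z \<in> closure H" and ab: "a + b \<le> m"
    and R: "\<And>xs i j. xs \<in> words k \<Longrightarrow> i \<le> a \<Longrightarrow> j \<le> b \<Longrightarrow>
      cmod (word_scale xs) ^ (i + j) * cmod (W xs i j (branch xs z)) \<le> R"
  shows "cmod (\<Sum>xs\<in>words k. branch_jet s xs (W xs) a b z) \<le> mass (Suc k) z * (coeff_bound * R)"
proof -
  have "cmod (\<Sum>xs\<in>words k. branch_jet s xs (W xs) a b z) \<le> (\<Sum>xs\<in>words k. weight s xs z * (coeff_bound * R))"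
    by (intro order_trans[OF norm_sum] sum_mono branch_jet_bound z ab R) (auto dest: words_subset words_nonempty)
  then show ?thesis by (simp add: mass_def sum_distrib_right)
qed

lemma Lam_power_outside: "z \<notin> closure H \<Longrightarrow> (L ^^ Suc k) f z = 0"
  by (simp add: Lam_def)

lemma Lam_mem: "f \<in> X \<Longrightarrow> L f \<in> X"
proof -
  assume f: "f \<in> X"
  obtain W where W: "wirtinger_jet H m W" "\<And>z. z \<in> closure H \<Longrightarrow> W 0 0 z = f z"
    "\<And>i j z. i + j \<le> m \<Longrightarrow> z \<in> closure H \<Longrightarrow> cmod (W i j z) \<le> NX f"
    using X_jet[OF f] by metis
  show "L f \<in> X"
    by (rule CmSpaceI[OF H(1) wirtinger_power_jet[OF W(1), of 0]])
      (use power_jet_0[of W f _ 0] W(2) Lam_power_outside[of _ 0 f] in auto)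
qed

lemma weight_le_1:
  assumes "set xs \<subseteq> B" "xs \<noteq> []" "Re z \<ge> 0"
  shows "weight s xs z \<le> 1"
proof -
  have "cmod (word_scale xs) powr s \<le> 1" using word_scale_le_1[OF assms(1)] s by (intro powr_le1) auto
  moreover have "cmod (z + word_shift xs) powr (- (2 * s)) \<le> 1"
  proof -
    have "1 \<le> cmod (z + word_shift xs) powr (2 * s)" using word_shift_ge(2)[OF assms] s by (intro ge_one_powr_ge_zero) auto
    then show ?thesis by (simp add: powr_minus inverse_le_1_iff)
  qed
  ultimately show ?thesis unfolding weight_def using mult_mono[of _ 1 _ 1] by fastforce
qed

lemma mass_1_le: "z \<in> closure H \<Longrightarrow> mass (Suc 0) z \<le> real (card (words 0))"
  unfolding mass_def using sum_bounded_above[of "words 0" "\<lambda>xs. weight s xs z" 1]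
    weight_le_1[OF words_subset words_nonempty closure_H_Re] by simp

lemma Lam_bounded: "bounded_op X NX L"
proof (rule X.bounded_opI)
  fix f assume f: "f \<in> X"
  obtain W where W: "wirtinger_jet H m W" "\<And>z. z \<in> closure H \<Longrightarrow> W 0 0 z = f z"
    "\<And>i j z. i + j \<le> m \<Longrightarrow> z \<in> closure H \<Longrightarrow> cmod (W i j z) \<le> NX f"
    using X_jet[OF f] by metis
  have "NX (L f) \<le> 2 ^ m * (real (card (words 0)) * (coeff_bound * NX f))"
  proof (rule Cm_norm_le_jet[OF H(1) H_nonempty wirtinger_power_jet[OF W(1), of 0]])
    fix z assume "z \<in> H"
    then have z: "z \<in> closure H" using closure_subset by blast
    show "power_jet 0 W 0 0 z = L f z" using power_jet_0[of W f z 0] W(2) z by simp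
    fix i j assume ij: "i + j \<le> m"
    have "cmod (power_jet 0 W i j z) \<le> mass (Suc 0) z * (coeff_bound * NX f)"
      unfolding power_jet_def
    proof (rule sum_branch_jet_bound[OF z ij])
      fix xs i' j' assume xs: "xs \<in> words 0" and "i' \<le> i" "j' \<le> j"
      then have "cmod (W i' j' (branch xs z)) \<le> NX f"
        using branch_in_disc(2)[OF words_subset[OF xs] words_nonempty[OF xs] z] D_closure ij by (intro W(3)) auto
      moreover have "cmod (word_scale xs) ^ (i' + j') \<le> 1"
        using word_scale_le_1[OF words_subset[OF xs]] by (intro power_le_one) auto
      ultimately show "cmod (word_scale xs) ^ (i' + j') * cmod (W i' j' (branch xs z)) \<le> NX f"
        using mult_mono[of "cmod (word_scale xs) ^ (i' + j')" 1 "cmod (W i' j' (branch xs z))" "NX f"] by simp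
    qed
    also have "\<dots> \<le> real (card (words 0)) * (coeff_bound * NX f)"
      using coeff_bound_nonneg X.norm_nonneg[OF f] by (intro mult_right_mono mass_1_le z) auto
    finally show "cmod (power_jet 0 W i j z) \<le> real (card (words 0)) * (coeff_bound * NX f)" .
  qed
  then show "NX (L f) \<le> (2 ^ m * real (card (words 0)) * coeff_bound) * NX f" by (simp add: mult.assoc)
qed (auto simp: Lam_mem Lam_add Lam_cmult)

lemma Lam_power_mem: "f \<in> X \<Longrightarrow> (L ^^ n) f \<in> X"
  by (rule X.bounded_opD(1)[OF X.bounded_op_power[OF Lam_bounded]])

lemma one_mem: "one \<in> X"
proof (rule CmSpaceI[OF H(1)])
  show "wirtinger_jet H m (\<lambda>i j z. if i = 0 \<and> j = 0 then 1 else 0)"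
    by (simp add: jet_def)
qed (auto simp: one_def)

text \<open>The mean value inequality on the convex open disc, extended to the closed disc by
  continuity; 2 for the two Wirtinger derivatives.\<close>

lemma lipschitz_X:
  assumes f: "f \<in> X"
  shows "lipschitz_disc f (2 * NX f)"
proof -
  obtain W where W: "wirtinger_jet H m W" "\<And>z. z \<in> closure H \<Longrightarrow> W 0 0 z = f z"
    "\<And>i j z. i + j \<le> m \<Longrightarrow> z \<in> closure H \<Longrightarrow> cmod (W i j z) \<le> NX f"
    using X_jet[OF f] by metis
  have "(2 * NX f)-lipschitz_on G (W 0 0)"
  proof (rule lipschitz_onI)
    fix x y assume x: "x \<in> G" and y: "y \<in> G"
    have "norm (W 0 0 x - W 0 0 y) \<le> (2 * NX f) * norm (x - y)"
    proof (rule differentiable_bound[OF convex_ball _ _ x y])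
      fix z assume z: "z \<in> G"
      then have zH: "z \<in> H" using disc_H by blast
      then have zc: "z \<in> closure H" using closure_subset by blast
      show "(W 0 0 has_derivative (\<lambda>h. h * W (Suc 0) 0 z + cnj h * W 0 (Suc 0) z)) (at z within G)"
        by (rule has_derivative_at_withinI, rule jet_has_derivative[OF W(1) _ zH]) (use m in simp)
      show "onorm (\<lambda>h. h * W (Suc 0) 0 z + cnj h * W 0 (Suc 0) z) \<le> 2 * NX f"
      proof (rule onorm_bound)
        fix h
        have "cmod (h * W (Suc 0) 0 z + cnj h * W 0 (Suc 0) z) \<le> cmod h * NX f + cmod h * NX f"
          using m zc by (intro norm_triangle_le add_mono) (auto simp: norm_mult intro!: mult_left_mono W(3))
        then show "cmod (h * W (Suc 0) 0 z + cnj h * W 0 (Suc 0) z) \<le> 2 * NX f * cmod h" by (simp add: algebra_simps)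
      qed (use X.norm_nonneg[OF f] in simp)
    qed
    then show "dist (W 0 0 x) (W 0 0 y) \<le> 2 * NX f * dist x y" by (simp add: dist_norm)
  qed (use X.norm_nonneg[OF f] in simp)
  moreover have "continuous_on D (W 0 0)"
    by (rule continuous_on_subset[OF jet_continuous[OF W(1)] D_closure]) simp
  ultimately have "(2 * NX f)-lipschitz_on D (W 0 0)"
    using lipschitz_on_closure[of "2 * NX f" G "W 0 0"] closure_disc by simp
  then show ?thesis
    using W(2) D_closure X.norm_nonneg[OF f]
    by (auto simp: lipschitz_disc_def lipschitz_on_def dist_norm subset_eq simp del: mem_cball)
qed

text \<open>Forced by \<open>ell (L f) = of_real r * ell f\<close> together with
  \<open>ell one = 1\<close>.\<close>

definition r :: real where "r = Re (ell (L one))"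

section \<open>The eigenvalue and the growth of the masses\<close>

lemma mass_compare: "x \<in> D \<Longrightarrow> y \<in> D \<Longrightarrow> mass n x \<le> exp (2 * s) * mass n y"
proof -
  assume x: "x \<in> D" and y: "y \<in> D"
  have "2 * s * cmod (x - y) \<le> 2 * s * 1" using diam_D[OF x y] s by (intro mult_left_mono) auto
  then have "exp (2 * s * cmod (x - y)) * mass n y \<le> exp (2 * s) * mass n y"
    using mass_pos[OF D_Re[OF y], of n] by (intro mult_right_mono) auto
  then show ?thesis using mass_log_lip[OF D_Re[OF x] D_Re[OF y], of n] by simp
qed

lemma ell_mass:
  obtains t where "ell ((L ^^ n) one) = of_real t" "exp (- (2 * s)) * mass n center \<le> t" "t \<le> exp (2 * s) * mass n center"
proof (rule ell_real[of "(L ^^ n) one" _ "mass n" "exp (- (2 * s)) * mass n center" "exp (2 * s) * mass n center"])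
  show "lipschitz_disc ((L ^^ n) one) (2 * NX ((L ^^ n) one))" by (intro lipschitz_X Lam_power_mem one_mem)
  fix x assume x: "x \<in> D"
  show "(L ^^ n) one x = of_real (mass n x) \<and> exp (- (2 * s)) * mass n center \<le> mass n x \<and> mass n x \<le> exp (2 * s) * mass n center"
  proof (intro conjI)
    show "(L ^^ n) one x = of_real (mass n x)" using x D_closure by (intro mass_one) blast
    show "mass n x \<le> exp (2 * s) * mass n center" by (rule mass_compare[OF x center(1)])
    have "mass n center \<le> exp (2 * s) * mass n x" by (rule mass_compare[OF center(1) x])
    then show "exp (- (2 * s)) * mass n center \<le> mass n x" by (simp add: exp_minus field_simps)
  qed
qed

lemma ell_r: "ell (L one) = of_real r" and r_pos: "r > 0"
proof -
  obtain t where t: "ell ((L ^^ 1) one) = of_real t" "exp (- (2 * s)) * mass 1 center \<le> t"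
    using ell_mass[of 1] by metis
  have "0 < exp (- (2 * s)) * mass 1 center" using mass_pos[OF D_Re[OF center(1)], of 1] by simp
  then show "ell (L one) = of_real r" "r > 0" using t by (simp_all add: r_def)
qed

text \<open>The n-th quotient of L f is the (n + 1)-st quotient of f times the n-th quotient of
  \<open>L one\<close>, since the masses cancel.\<close>

lemma ell_Lam:
  assumes f: "f \<in> X"
  shows "ell (L f) = of_real r * ell f"
proof -
  have mp: "mass n center \<noteq> 0" for n using mass_pos[OF D_Re[OF center(1)], of n] by simp
  have a: "(L ^^ n) (L f) = (L ^^ Suc n) f" for n f by (simp only: funpow_Suc_right comp_def)
  have "quotient n (L f) center = quotient (Suc n) f center * quotient n (L one) center" for n
    unfolding quotient_def a mass_one[OF center(4)] using mp[of n] mp[of "Suc n"] by simp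
  moreover have "(\<lambda>n. quotient (Suc n) f center * quotient n (L one) center) \<longlonglongrightarrow> ell f * of_real r"
    unfolding ell_r[symmetric]
    by (intro tendsto_mult LIMSEQ_Suc quotient_tendsto[OF lipschitz_X center(1)] f Lam_mem one_mem)
  ultimately have "(\<lambda>n. quotient n (L f) center) \<longlonglongrightarrow> ell f * of_real r" by simp
  then show ?thesis
    using quotient_tendsto[OF lipschitz_X[OF Lam_mem[OF f]] center(1)] LIMSEQ_unique by (metis mult.commute)
qed

lemma ell_one: "ell one = 1"
proof -
  have "quotient n one center = 1" for n
    unfolding quotient_def mass_one[OF center(4)] using mass_pos[OF D_Re[OF center(1)], of n] by simp
  then show ?thesis
    using quotient_tendsto[OF lipschitz_X[OF one_mem] center(1)] by (simp add: LIMSEQ_const_iff)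
qed

lemma ell_power_one: "ell ((L ^^ n) one) = of_real (r ^ n)"
  by (induction n) (simp_all add: ell_one ell_Lam Lam_power_mem one_mem)

text \<open>The mass varies on D at most by the factor exp (2 s), and the functional, a limit of
  means over D, gives it the value r^n exactly.\<close>

lemma mass_bounds:
  assumes x: "x \<in> D"
  shows "exp (- (2 * s)) * r ^ n \<le> mass n x" "mass n x \<le> exp (2 * s) * r ^ n"
proof -
  note lip = lipschitz_X[OF Lam_power_mem[OF one_mem], of n]
  have 1: "(L ^^ n) one y = of_real (mass n y) \<and> exp (- (2 * s)) * mass n x \<le> mass n y \<and> mass n y \<le> exp (2 * s) * mass n x"
    if y: "y \<in> D" for y
    using mass_one[of y n] mass_compare[OF x y, of n] mass_compare[OF y x, of n] y D_closure
    by (auto simp: exp_minus field_simps)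
  obtain t where t: "ell ((L ^^ n) one) = of_real t" "exp (- (2 * s)) * mass n x \<le> t" "t \<le> exp (2 * s) * mass n x"
    using ell_real[OF lip 1] by metis
  have "t = r ^ n" using t(1) ell_power_one[of n] by (metis of_real_eq_iff)
  then show "exp (- (2 * s)) * r ^ n \<le> mass n x" "mass n x \<le> exp (2 * s) * r ^ n"
    using t(2,3) by (simp_all add: exp_minus field_simps)
qed

text \<open>One application of the operator reads values on D only, so estimates on the disc pass to
  the whole closure of H at the cost of one step.\<close>

lemma Lam_Suc_bound:
  assumes z: "z \<in> closure H" and M: "\<And>x. x \<in> D \<Longrightarrow> cmod ((L ^^ n) f x) \<le> M"
  shows "cmod ((L ^^ Suc n) f z) \<le> real (card (words 0)) * M"
proof -
  have M0: "M \<ge> 0" using order_trans[OF norm_ge_zero M[OF center(1)]] .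
  have "cmod ((L ^^ Suc 0) ((L ^^ n) f) z) \<le> (\<Sum>xs\<in>words 0. weight s xs z * M)"
    unfolding Lam_power[OF z]
  proof (intro order_trans[OF norm_sum] sum_mono)
    fix xs assume xs: "xs \<in> words 0"
    have "branch xs z \<in> D" by (rule branch_in_disc(2)[OF words_subset[OF xs] words_nonempty[OF xs] z])
    from M[OF this] show "cmod (of_real (weight s xs z) * (L ^^ n) f (branch xs z)) \<le> weight s xs z * M"
      using weight_pos[OF words_subset[OF xs] words_nonempty[OF xs] closure_H_Re[OF z]] by (simp add: norm_mult)
  qed
  also have "\<dots> = mass (Suc 0) z * M" by (simp add: mass_def sum_distrib_right)
  also have "\<dots> \<le> real (card (words 0)) * M" by (intro mult_right_mono mass_1_le z M0)
  finally show ?thesis by simp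
qed

text \<open>The 1 covers n = 0; the quotient by r pays for the step lost in passing from D to the
  closure of H.\<close>

definition mass_const :: real where
  "mass_const = 1 + real (card (words 0)) * exp (2 * s) / r"

lemma mass_const: "mass_const \<ge> 1"
  using r_pos by (simp add: mass_const_def)

lemma mass_le:
  assumes z: "z \<in> closure H"
  shows "mass n z \<le> mass_const * r ^ n"
proof (cases n)
  case 0
  then show ?thesis using mass_const by (simp add: mass_def)
next
  case (Suc k)
  have "cmod ((L ^^ k) one x) \<le> exp (2 * s) * r ^ k" if x: "x \<in> D" for x
    using mass_one[of x k] mass_bounds(2)[OF x, of k] mass_pos[OF D_Re[OF x], of k] x D_closure by (auto simp: subset_eq)
  then have "cmod ((L ^^ Suc k) one z) \<le> real (card (words 0)) * (exp (2 * s) * r ^ k)"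
    by (rule Lam_Suc_bound[OF z])
  then have "mass n z \<le> real (card (words 0)) * (exp (2 * s) * r ^ k)"
    using mass_one[OF z, of n] Suc by simp
  also have "\<dots> = real (card (words 0)) * exp (2 * s) / r * r ^ n" using r_pos Suc by simp
  also have "\<dots> \<le> mass_const * r ^ n" using r_pos by (intro mult_right_mono) (auto simp: mass_const_def)
  finally show ?thesis .
qed

lemma sup_decay:
  obtains C q where "C \<ge> 0" "0 < q" "q < 1"
    "\<And>g n z. g \<in> X \<Longrightarrow> ell g = 0 \<Longrightarrow> z \<in> closure H \<Longrightarrow> cmod ((L ^^ n) g z) \<le> C * (q * r) ^ n * NX g"
proof -
  obtain C q where C: "C \<ge> 0" and q: "0 < q" "q < 1" and
    bound: "\<And>f K n x. lipschitz_disc f K \<Longrightarrow> x \<in> D \<Longrightarrow> cmod (quotient n f x - ell f) \<le> C * q ^ n * K"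
    using quotient_decay by blast
  \<comment> \<open>Division by q r makes up for the step used to leave D, and 2 is the constant of
    \<open>lipschitz_X\<close>.\<close>
  define C' where "C' = 1 + real (card (words 0)) * (exp (2 * s) * C * 2) / (q * r)"
  have C': "C' \<ge> 1" using C q r_pos by (simp add: C'_def)
  show ?thesis
  proof (rule that[of C' q])
    show "C' \<ge> 0" using C' by simp
    fix g n z assume g: "g \<in> X" "ell g = 0" and z: "z \<in> closure H"
    have N: "NX g \<ge> 0" by (rule X.norm_nonneg[OF g(1)])
    show "cmod ((L ^^ n) g z) \<le> C' * (q * r) ^ n * NX g"
    proof (cases n)
      case 0
      have "cmod (g z) \<le> 1 * NX g" using X_pointwise[OF g(1)] by simp
      also have "\<dots> \<le> C' * NX g" by (intro mult_right_mono C' N)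
      finally show ?thesis using 0 by simp
    next
      case (Suc k)
      have "cmod ((L ^^ k) g x) \<le> exp (2 * s) * C * 2 * ((q * r) ^ k * NX g)" if x: "x \<in> D" for x
      proof -
        have mp: "mass k x > 0" by (rule mass_pos[OF D_Re[OF x]])
        have "cmod ((L ^^ k) g x) = mass k x * cmod (quotient k g x - ell g)"
          using mp g(2) by (simp add: quotient_def norm_divide)
        also have "\<dots> \<le> (exp (2 * s) * r ^ k) * (C * q ^ k * (2 * NX g))"
          using mp by (intro mult_mono mass_bounds(2)[OF x] bound lipschitz_X g x) (use r_pos in auto)
        finally show ?thesis by (simp add: power_mult_distrib ac_simps)
      qed
      from Lam_Suc_bound[OF z this]
      have "cmod ((L ^^ n) g z) \<le> real (card (words 0)) * (exp (2 * s) * C * 2) * ((q * r) ^ k * NX g)"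
        using Suc by (simp add: mult.assoc)
      also have "\<dots> = real (card (words 0)) * (exp (2 * s) * C * 2) / (q * r) * ((q * r) ^ n * NX g)"
        using q r_pos Suc by simp
      also have "\<dots> \<le> C' * ((q * r) ^ n * NX g)"
        using N q r_pos by (intro mult_right_mono) (auto simp: C'_def)
      finally show ?thesis by (simp add: mult.assoc)
    qed
  qed (use q in auto)
qed

section \<open>Exponential decay and the positive eigenfunction\<close>

text \<open>Growth without contraction. It starts the block induction in \<open>jet_decay\<close>,
  for exponents shorter than one block.\<close>

lemma jet_le_power:
  assumes g: "g \<in> X"
  shows "jet_le m ((L ^^ n) g) (max 1 (mass_const * coeff_bound) * r ^ n * NX g)"
proof (cases n)
  case 0
  have "NX g \<le> max 1 (mass_const * coeff_bound) * NX g"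
    using mult_right_mono[of 1 "max 1 (mass_const * coeff_bound)" "NX g"] X.norm_nonneg[OF g] by simp
  then show ?thesis using 0 jet_le_mono[OF jet_le_norm[OF g]] by simp
next
  case (Suc k)
  obtain W where W: "wirtinger_jet H m W" "\<And>z. z \<in> closure H \<Longrightarrow> W 0 0 z = g z"
    "\<And>i j z. i + j \<le> m \<Longrightarrow> z \<in> closure H \<Longrightarrow> cmod (W i j z) \<le> NX g"
    using X_jet[OF g] by metis
  have "jet_le m ((L ^^ Suc k) g) (mass_const * r ^ Suc k * (coeff_bound * NX g))"
  proof (rule jet_leI[OF wirtinger_power_jet[OF W(1), of k]])
    show "power_jet k W 0 0 z = (L ^^ Suc k) g z" if "z \<in> H" for z
      using power_jet_0[of W g z k] W(2) that closure_subset by blast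
    fix i j z assume ij: "i + j \<le> m" and z: "z \<in> closure H"
    have "cmod (power_jet k W i j z) \<le> mass (Suc k) z * (coeff_bound * NX g)"
      unfolding power_jet_def
    proof (rule sum_branch_jet_bound[OF z ij])
      fix xs i' j' assume xs: "xs \<in> words k" and "i' \<le> i" "j' \<le> j"
      then have "cmod (W i' j' (branch xs z)) \<le> NX g"
        using branch_in_disc(2)[OF words_subset[OF xs] words_nonempty[OF xs] z] D_closure ij by (intro W(3)) auto
      moreover have "cmod (word_scale xs) ^ (i' + j') \<le> 1"
        using word_scale_le_1[OF words_subset[OF xs]] by (intro power_le_one) auto
      ultimately show "cmod (word_scale xs) ^ (i' + j') * cmod (W i' j' (branch xs z)) \<le> NX g"
        using mult_mono[of "cmod (word_scale xs) ^ (i' + j')" 1 "cmod (W i' j' (branch xs z))" "NX g"] by simp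
    qed
    also have "\<dots> \<le> mass_const * r ^ Suc k * (coeff_bound * NX g)"
      using coeff_bound_nonneg X.norm_nonneg[OF g] by (intro mult_right_mono mass_le z) auto
    finally show "cmod (power_jet k W i j z) \<le> mass_const * r ^ Suc k * (coeff_bound * NX g)" .
  qed simp
  moreover have "mass_const * r ^ Suc k * (coeff_bound * NX g) \<le> max 1 (mass_const * coeff_bound) * r ^ n * NX g"
  proof -
    have "mass_const * coeff_bound * (r ^ n * NX g) \<le> max 1 (mass_const * coeff_bound) * (r ^ n * NX g)"
      using r_pos X.norm_nonneg[OF g] by (intro mult_right_mono) auto
    then show ?thesis using Suc by (simp only: ac_simps)
  qed
  ultimately show ?thesis using Suc jet_le_mono by blast
qed

text \<open>The Lasota--Yorke step: after many iterations the derivatives of top order are contracted, while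
  those of lower order decay by induction.\<close>

lemma jet_le_step:
  assumes f: "f \<in> X" and top: "jet_le (Suc l) f A" and low: "jet_le l f A'" and l: "Suc l \<le> m" and A: "0 \<le> A" "0 \<le> A'"
  shows "jet_le (Suc l) ((L ^^ Suc k) f) (mass_const * r ^ Suc k * (coeff_bound * (scale_bound k * A + A')))"
proof -
  obtain W where W: "wirtinger_jet H m W" "\<And>z. z \<in> closure H \<Longrightarrow> W 0 0 z = f z"
    "\<And>i j z. i + j \<le> m \<Longrightarrow> z \<in> closure H \<Longrightarrow> cmod (W i j z) \<le> NX f"
    using X_jet[OF f] by metis
  show ?thesis
  proof (rule jet_leI[OF wirtinger_power_jet[OF W(1), of k] _ l])
    show "power_jet k W 0 0 z = (L ^^ Suc k) f z" if "z \<in> H" for z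
      using power_jet_0[of W f z k] W(2) that closure_subset by blast
    fix a b z assume ab: "a + b \<le> Suc l" and z: "z \<in> closure H"
    have "cmod (power_jet k W a b z) \<le> mass (Suc k) z * (coeff_bound * (scale_bound k * A + A'))"
      unfolding power_jet_def
    proof (rule sum_branch_jet_bound[OF z])
      show "a + b \<le> m" using ab l by simp
      fix xs i j assume xs: "xs \<in> words k" and ij: "i \<le> a" "j \<le> b"
      have bz: "branch xs z \<in> closure H"
        using branch_in_disc(2)[OF words_subset[OF xs] words_nonempty[OF xs] z] D_closure by blast
      have sc: "cmod (word_scale xs) ^ (i + j) \<le> 1"
        using word_scale_le_1[OF words_subset[OF xs]] by (intro power_le_one) auto
      show "cmod (word_scale xs) ^ (i + j) * cmod (W i j (branch xs z)) \<le> scale_bound k * A + A'"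
      proof (cases "i + j \<le> l")
        case True
        have "cmod (word_scale xs) ^ (i + j) * cmod (W i j (branch xs z)) \<le> 1 * A'"
          by (rule mult_mono[OF sc jet_leD[OF low W(1,2) True bz]]) auto
        then show ?thesis using mult_nonneg_nonneg[OF scale_bound_range(1)[of k] A(1)] by simp
      next
        case False
        then have eq: "i + j = Suc l" using ij ab by simp
        have "cmod (word_scale xs) ^ Suc l \<le> cmod (word_scale xs) ^ 1"
          using word_scale_le_1[OF words_subset[OF xs]] by (intro power_decreasing) auto
        also have "\<dots> \<le> scale_bound k" using scale_bound[OF xs] by simp
        finally have "cmod (word_scale xs) ^ (i + j) * cmod (W i j (branch xs z)) \<le> scale_bound k * A"
          unfolding eq[symmetric] using jet_leD[OF top W(1,2) _ bz, of i j] eq scale_bound_range(1)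
          by (intro mult_mono) auto
        then show ?thesis using A(2) by simp
      qed
    qed
    also have "\<dots> \<le> mass_const * r ^ Suc k * (coeff_bound * (scale_bound k * A + A'))"
      using coeff_bound_nonneg A scale_bound_range(1)[of k]
      by (intro mult_right_mono mass_le z mult_nonneg_nonneg add_nonneg_nonneg)
    finally show "cmod (power_jet k W a b z) \<le> mass_const * r ^ Suc k * (coeff_bound * (scale_bound k * A + A'))" .
  qed
qed

text \<open>By induction on the order, and for each order by blocks of K steps: the top order is
  halved, the lower orders are known to decay. The rate may get worse with each order, which is
  harmless as there are finitely many.\<close>

lemma jet_decay:
  assumes "l \<le> m"
  shows "\<exists>C q. C \<ge> 0 \<and> 0 < q \<and> q < 1 \<and> (\<forall>g\<in>X. ell g = 0 \<longrightarrow> (\<forall>n. jet_le l ((L ^^ n) g) (C * (q * r) ^ n * NX g)))"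
  using assms
proof (induction l)
  case 0
  obtain C q where C: "C \<ge> 0" "0 < q" "q < 1" and
    bound: "\<And>g n z. g \<in> X \<Longrightarrow> ell g = 0 \<Longrightarrow> z \<in> closure H \<Longrightarrow> cmod ((L ^^ n) g z) \<le> C * (q * r) ^ n * NX g"
    using sup_decay by blast
  have "jet_le 0 ((L ^^ n) g) (C * (q * r) ^ n * NX g)" if g: "g \<in> X" "ell g = 0" for g n
  proof -
    obtain W where W: "wirtinger_jet H m W" "\<And>z. z \<in> closure H \<Longrightarrow> W 0 0 z = (L ^^ n) g z"
      "\<And>i j z. i + j \<le> m \<Longrightarrow> z \<in> closure H \<Longrightarrow> cmod (W i j z) \<le> NX ((L ^^ n) g)"
      using X_jet[OF Lam_power_mem[OF g(1)]] by metis
    show ?thesis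
      by (rule jet_leI[OF W(1)]) (use W(2) bound[OF g] closure_subset[of H] in auto)
  qed
  then show ?case using C by blast
next
  case (Suc l)
  then obtain C q where C: "C \<ge> 0" and q: "0 < q" "q < 1" and
    low: "\<And>g n. g \<in> X \<Longrightarrow> ell g = 0 \<Longrightarrow> jet_le l ((L ^^ n) g) (C * (q * r) ^ n * NX g)"
    by (meson Suc_leD)
  define S where "S = mass_const * coeff_bound"
  have S: "S \<ge> 0" using mass_const coeff_bound_nonneg by (simp add: S_def)
  define Q where "Q = max 1 S"
  have "(\<lambda>k. S * scale_bound k) \<longlonglongrightarrow> S * 0" by (intro tendsto_intros scale_bound_tendsto)
  then have "\<forall>\<^sub>F k in sequentially. S * scale_bound k < 1 / 2" by (intro order_tendstoD) auto
  \<comment> \<open>A block so long that top-order derivatives lose at least half, constants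
    included.\<close>
  then obtain k where k: "S * scale_bound k < 1 / 2" using eventually_happens by fastforce
  define K where "K = Suc k"
  \<comment> \<open>3/4 is 1/2 from the contracted top order plus 1/4 from the lower orders; p \<ge>
    q absorbs the decay of the latter.\<close>
  define p where "p = max q (root K (3 / 4))"
  have p: "0 < p" "p < 1" "q \<le> p" using q by (auto simp: p_def K_def)
  have pK: "3 / 4 \<le> p ^ K"
  proof -
    have "root K (3 / 4) ^ K \<le> p ^ K" by (rule power_mono) (auto simp: p_def real_root_ge_zero)
    then show ?thesis by (simp add: K_def real_root_pow_pos2 del: power_Suc)
  qed
  \<comment> \<open>4 S C makes the lower-order part at most a quarter of M; 2 Q settles exponents
    below K, where p^n \<ge> 3/4.\<close>
  define M where "M = 2 * Q + 4 * (S * C)"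
  have M: "M \<ge> 0" using S C by (simp add: M_def Q_def)
  have "jet_le (Suc l) ((L ^^ n) g) (M * (p * r) ^ n * NX g)" if g: "g \<in> X" "ell g = 0" for g n
  proof (induction n rule: less_induct)
    case (less n)
    have N: "NX g \<ge> 0" by (rule X.norm_nonneg[OF g(1)])
    show ?case
    proof (cases "n < K")
      case True
      have "p ^ K \<le> p ^ n" using p True by (intro power_decreasing) auto
      with pK have "3 / 4 \<le> p ^ n" by (rule order_trans)
      then have "Q * 1 \<le> Q * (2 * p ^ n)" by (intro mult_left_mono) (auto simp: Q_def)
      also have "\<dots> = (2 * Q) * p ^ n" by simp
      also have "\<dots> \<le> M * p ^ n" using S C p by (intro mult_right_mono) (auto simp: M_def)
      finally have "Q * (r ^ n * NX g) \<le> (M * p ^ n) * (r ^ n * NX g)"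
        using r_pos N by (intro mult_right_mono) auto
      then have "Q * r ^ n * NX g \<le> M * (p * r) ^ n * NX g" by (simp add: power_mult_distrib ac_simps)
      then show ?thesis
        using jet_le_mono[OF jet_le_power[OF g(1), of n], of _ "Suc l"] Suc.prems by (simp add: Q_def S_def)
    next
      case False
      define i where "i = n - K"
      have n: "n = K + i" and i: "i < n" using False by (auto simp: i_def K_def)
      define x where "x = (p * r) ^ i * NX g"
      have x: "x \<ge> 0" using p r_pos N by (simp add: x_def)
      have top: "jet_le (Suc l) ((L ^^ i) g) (M * x)" using less.IH[OF i] by (simp add: x_def mult.assoc)
      have "C * (q * r) ^ i * NX g \<le> C * x"
        unfolding x_def mult.assoc using C q p r_pos N by (intro mult_left_mono mult_right_mono power_mono) auto
      then have lw: "jet_le l ((L ^^ i) g) (C * x)" using jet_le_mono[OF low[OF g, of i]] by blast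
      have "jet_le (Suc l) ((L ^^ Suc k) ((L ^^ i) g)) (mass_const * r ^ Suc k * (coeff_bound * (scale_bound k * (M * x) + C * x)))"
        using M C x by (intro jet_le_step top lw Lam_power_mem g Suc.prems) auto
      moreover have "(L ^^ Suc k) ((L ^^ i) g) = (L ^^ n) g" unfolding n K_def by (simp only: funpow_add comp_def)
      moreover have "mass_const * r ^ Suc k * (coeff_bound * (scale_bound k * (M * x) + C * x)) \<le> M * (p * r) ^ n * NX g"
      proof -
        have "S * (scale_bound k * (M * x) + C * x) = (S * scale_bound k) * (M * x) + (S * C) * x"
          by (simp add: algebra_simps)
        also have "\<dots> \<le> 1 / 2 * (M * x) + M / 4 * x"
          using k M x by (intro add_mono mult_right_mono) (auto simp: M_def Q_def)
        also have "\<dots> = 3 / 4 * (M * x)" by simp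
        also have "\<dots> \<le> p ^ K * (M * x)" using pK M x by (intro mult_right_mono) auto
        finally have "r ^ K * (S * (scale_bound k * (M * x) + C * x)) \<le> r ^ K * (p ^ K * (M * x))"
          using r_pos by (intro mult_left_mono) auto
        also have "\<dots> = M * (p * r) ^ n * NX g" by (simp add: n x_def power_add power_mult_distrib)
        finally show ?thesis by (simp only: S_def K_def ac_simps)
      qed
      ultimately show ?thesis using jet_le_mono by fastforce
    qed
  qed
  then show ?case using M p by blast
qed

lemma norm_decay:
  obtains C q where "C \<ge> 0" "0 < q" "q < 1"
    "\<And>g n. g \<in> X \<Longrightarrow> ell g = 0 \<Longrightarrow> NX ((L ^^ n) g) \<le> C * (q * r) ^ n * NX g"
proof -
  obtain C q where C: "C \<ge> 0" "0 < q" "q < 1" and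
    dec: "\<And>g n. g \<in> X \<Longrightarrow> ell g = 0 \<Longrightarrow> jet_le m ((L ^^ n) g) (C * (q * r) ^ n * NX g)"
    using jet_decay[OF order_refl] by blast
  show ?thesis
  proof (rule that[of "2 ^ m * C" q])
    fix g n assume g: "g \<in> X" "ell g = 0"
    show "NX ((L ^^ n) g) \<le> 2 ^ m * C * (q * r) ^ n * NX g"
      using norm_le_jet_le[OF Lam_power_mem[OF g(1)] dec[OF g]] by (simp add: mult.assoc)
  qed (use C in auto)
qed

lemma ell_diff: "f \<in> X \<Longrightarrow> g \<in> X \<Longrightarrow> ell (\<lambda>z. f z - g z) = ell f - ell g"
  using ell_add[OF lipschitz_X lipschitz_X[OF X.cmult_mem], of f g "-1"] ell_cmult[OF lipschitz_X, of g "-1"] by simp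

lemma Lam_power_eigenfunction:
  assumes "L v = (\<lambda>z. of_real r * v z)"
  shows "(L ^^ n) v = (\<lambda>z. of_real (r ^ n) * v z)"
proof (induction n)
  case (Suc n)
  have "(L ^^ Suc n) v = (\<lambda>z. of_real (r ^ n) * L v z)" using Suc Lam_cmult[of "of_real (r ^ n)" v] by simp
  then show ?case by (simp add: assms ac_simps)
qed simp

text \<open>\<open>L one\<close> divided by r, minus \<open>one\<close>, lies in the kernel of the
  functional, so the differences of the normalised iterates r^(-n) L^n one are summable in norm. The
  limit of these iterates is v.\<close>

lemma eigenfunction:
  obtains v where "v \<in> X" "\<And>z. z \<in> closure H \<Longrightarrow> Im (v z) = 0 \<and> Re (v z) > 0"
    "L v = (\<lambda>z. of_real r * v z)" "ell v = 1"
proof -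
  obtain C q where C: "C \<ge> 0" and q: "0 < q" "q < 1" and
    dec: "\<And>g n. g \<in> X \<Longrightarrow> ell g = 0 \<Longrightarrow> NX ((L ^^ n) g) \<le> C * (q * r) ^ n * NX g"
    using norm_decay by blast
  define g where "g = (\<lambda>z. of_real (1 / r) * L one z - one z)"
  have g: "g \<in> X" unfolding g_def by (intro X.diff_mem X.cmult_mem Lam_mem one_mem)
  have lg: "ell g = 0"
    unfolding g_def using ell_diff[OF X.cmult_mem[OF Lam_mem[OF one_mem]] one_mem, of "of_real (1 / r)"]
      ell_cmult[OF lipschitz_X[OF Lam_mem[OF one_mem]], of "of_real (1 / r)"] ell_r ell_one r_pos by simp
  define u where "u n z = of_real ((1 / r) ^ n) * (L ^^ n) one z" for n z
  define F where "F n z = of_real ((1 / r) ^ n) * (L ^^ n) g z" for n z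
  have F: "F n = (\<lambda>z. u (Suc n) z - u n z)" for n
  proof -
    have "(L ^^ n) g = (\<lambda>z. of_real (1 / r) * (L ^^ n) (L one) z - (L ^^ n) one z)"
      unfolding g_def
      using X.bounded_op_diff[OF X.bounded_op_power[OF Lam_bounded] X.cmult_mem[OF Lam_mem[OF one_mem]] one_mem, of n "of_real (1 / r)"]
        Lam_power_cmult[of n "of_real (1 / r)" "L one"] by simp
    moreover have "(L ^^ n) (L one) = (L ^^ Suc n) one" by (simp only: funpow_Suc_right comp_def)
    ultimately show ?thesis unfolding F_def u_def by (simp add: fun_eq_iff right_diff_distrib)
  qed
  have Fmem: "F n \<in> X" for n unfolding F_def by (intro X.cmult_mem Lam_power_mem g)
  have FN: "NX (F n) \<le> (C * NX g) * q ^ n" for n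
  proof -
    have "NX (F n) = (1 / r) ^ n * NX ((L ^^ n) g)"
      unfolding F_def using r_pos by (subst X.norm_cmult[OF Lam_power_mem[OF g]]) (simp add: norm_power norm_divide)
    also have "\<dots> \<le> (1 / r) ^ n * (C * (q * r) ^ n * NX g)"
      using r_pos by (intro mult_left_mono dec g lg) auto
    finally show ?thesis using r_pos by (simp add: power_mult_distrib power_divide ac_simps)
  qed
  have q0: "0 \<le> q" using q by simp
  note ser = X.geometric_series[OF Fmem q0 q(2) FN]
  define v where "v = (\<lambda>z. one z + (\<Sum>n. F n z))"
  have v: "v \<in> X" unfolding v_def using ser by (intro X.add_mem one_mem) blast
  have lim: "(\<lambda>n. u n z) \<longlonglongrightarrow> v z" for z
  proof -
    have "summable (\<lambda>n. F n z)" using ser by blast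
    then have "(\<lambda>n. \<Sum>i<n. F i z) \<longlonglongrightarrow> (\<Sum>n. F n z)" by (rule summable_LIMSEQ)
    moreover have "(\<Sum>i<n. F i z) = u n z - one z" for n
      unfolding F by (subst sum_lessThan_telescope) (simp add: u_def)
    ultimately have "(\<lambda>n. one z + (u n z - one z)) \<longlonglongrightarrow> v z"
      unfolding v_def by (intro tendsto_add) auto
    then show ?thesis by simp
  qed
  have um: "u n z = of_real (mass n z / r ^ n)" if "z \<in> closure H" for n z
    unfolding u_def mass_one[OF that] by (simp add: power_divide)
  have Lv: "L v = (\<lambda>z. of_real r * v z)"
  proof
    fix z
    have "z + b \<noteq> 0" if "z \<in> closure H" "b \<in> B" for b
      using word_shift_ge(3)[of "[b]" z] closure_H_Re that by simp
    \<comment> \<open>At each point the operator is a finite sum, so pointwise limits suffice for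
      the eigenvalue equation.\<close>
    then have "(\<lambda>n. L (u n) z) \<longlonglongrightarrow> L v z"
      unfolding Lam_def by (cases "z \<in> closure H") (auto intro!: tendsto_intros lim)
    moreover have "L (u n) z = of_real r * u (Suc n) z" for n
      using r_pos unfolding u_def[abs_def] Lam_cmult by (simp add: power_divide)
    moreover have "(\<lambda>n. of_real r * u (Suc n) z) \<longlonglongrightarrow> of_real r * v z"
      by (intro tendsto_intros LIMSEQ_Suc lim)
    ultimately show "L v z = of_real r * v z" using LIMSEQ_unique by simp
  qed
  have pos: "Im (v z) = 0 \<and> Re (v z) > 0" if z: "z \<in> closure H" for z
  proof -
    \<comment> \<open>A lower bound uniform in n: the first letter leads into D, where the mass of
      the other n steps is at least exp (-2 s) r^n.\<close>
    define c where "c = mass (Suc 0) z * exp (- (2 * s)) / r"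
    have c: "c > 0" using mass_pos[OF closure_H_Re[OF z], of "Suc 0"] r_pos by (simp add: c_def)
    have "c \<le> mass (Suc n) z / r ^ Suc n" for n
    proof -
      have "mass (Suc 0) z * (exp (- (2 * s)) * r ^ n) \<le> mass (n + Suc 0) z"
        unfolding mass_add[OF z, of n 0] mass_def[of "Suc 0"] nat.case sum_distrib_right
      proof (intro sum_mono mult_left_mono mass_bounds)
        fix xs assume xs: "xs \<in> words 0"
        show "branch xs z \<in> D" by (rule branch_in_disc(2)[OF words_subset[OF xs] words_nonempty[OF xs] z])
        show "0 \<le> weight s xs z" using weight_pos[OF words_subset[OF xs] words_nonempty[OF xs] closure_H_Re[OF z]] by simp
      qed
      then show ?thesis using r_pos by (simp add: c_def field_simps)
    qed
    then have "c \<le> Re (u (Suc n) z)" for n using um[OF z] by simp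
    then have "c \<le> Re (v z)" by (intro LIMSEQ_le_const[OF tendsto_Re[OF LIMSEQ_Suc[OF lim]]]) auto
    moreover have "Im (v z) = 0"
      using LIMSEQ_unique[OF tendsto_Im[OF lim[of z]], of 0] um[OF z] by simp
    ultimately show ?thesis using c by simp
  qed
  have "ell v = 1"
  proof -
    have "quotient n v center = v center / u n center" for n
      unfolding quotient_def um[OF center(4)] Lam_power_eigenfunction[OF Lv] using r_pos by simp
    moreover have "v center \<noteq> 0" using pos[OF center(4)] by auto
    then have "(\<lambda>n. v center / u n center) \<longlonglongrightarrow> v center / v center" by (intro tendsto_divide tendsto_const lim)
    ultimately have "(\<lambda>n. quotient n v center) \<longlonglongrightarrow> 1" using \<open>v center \<noteq> 0\<close> by simp
    then show ?thesis using quotient_tendsto[OF lipschitz_X[OF v] center(1)] LIMSEQ_unique by blast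
  qed
  then show ?thesis using that v pos Lv by blast
qed

text \<open>Positivity suffices in the sup norm: |L^n f| is at most \<open>mass n\<close> times the
  norm of f, and v shows that the growth r^n is attained.\<close>

lemma spec_rad_Y: "spec_rad (CSpace H) (sup_norm H) L = r"
proof -
  obtain v where v: "v \<in> X" "\<And>z. z \<in> closure H \<Longrightarrow> Im (v z) = 0 \<and> Re (v z) > 0" "L v = (\<lambda>z. of_real r * v z)"
    using eigenfunction by blast
  note upper = cmod_le_sup_norm[OF H(2)]
  have vY: "v \<in> CSpace H" using v(1) by (simp add: CSpace_def CmSpace_def)
  have NYv: "sup_norm H v > 0"
    using upper[OF vY center(4)] v(2)[OF center(4)] complex_Re_le_cmod[of "v center"] by linarith
  have power_bound: "sup_norm H ((L ^^ n) f) \<le> mass_const * r ^ n * sup_norm H f" if f: "f \<in> CSpace H" for n f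
    unfolding sup_norm_def[of H "(L ^^ n) f"]
  proof (rule cSUP_least)
    show "closure H \<noteq> {}" using H_nonempty by simp
    fix z assume z: "z \<in> closure H"
    have N: "sup_norm H f \<ge> 0" by (rule Y.norm_nonneg[OF f])
    have "cmod ((L ^^ n) f z) \<le> mass n z * sup_norm H f"
    proof (cases n)
      case 0
      then show ?thesis using upper[OF f z] by (simp add: mass_def)
    next
      case (Suc k)
      have "cmod ((L ^^ n) f z) \<le> (\<Sum>xs\<in>words k. weight s xs z * sup_norm H f)"
        unfolding Suc Lam_power[OF z]
      proof (intro order_trans[OF norm_sum] sum_mono)
        fix xs assume xs: "xs \<in> words k"
        have "cmod (f (branch xs z)) \<le> sup_norm H f"
          using branch_in_disc(2)[OF words_subset[OF xs] words_nonempty[OF xs] z] D_closure by (intro upper f) auto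
        then show "cmod (of_real (weight s xs z) * f (branch xs z)) \<le> weight s xs z * sup_norm H f"
          using weight_pos[OF words_subset[OF xs] words_nonempty[OF xs] closure_H_Re[OF z]] by (simp add: norm_mult)
      qed
      then show ?thesis by (simp add: Suc mass_def sum_distrib_right)
    qed
    also have "\<dots> \<le> mass_const * r ^ n * sup_norm H f" by (intro mult_right_mono mass_le z N)
    finally show "cmod ((L ^^ n) f z) \<le> mass_const * r ^ n * sup_norm H f" .
  qed
  have bounded: "bounded_op (CSpace H) (sup_norm H) L"
  proof (rule Y.bounded_opI)
    fix f assume f: "f \<in> CSpace H"
    have "wirtinger_jet H 0 (\<lambda>i j. f)" using f by (simp add: jet_def CSpace_def)
    then have "continuous_on (closure H) (power_jet 0 (\<lambda>i j. f) 0 0)"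
      using jet_continuous[OF wirtinger_power_jet, of 0 "\<lambda>i j. f" 0 0 0] by simp
    then have "continuous_on (closure H) (L f)"
      by (rule continuous_on_cong[THEN iffD1, OF refl, rotated]) (use power_jet_0[of "\<lambda>i j. f" f _ 0] in simp)
    then show "L f \<in> CSpace H" by (simp add: CSpace_def Lam_def)
    show "sup_norm H (L f) \<le> mass_const * r ^ 1 * sup_norm H f" using power_bound[OF f, of 1] by simp
  qed (auto simp: Lam_add Lam_cmult)
  note vn = Lam_power_eigenfunction[OF v(3)]
  show ?thesis
  proof (rule Y.spec_rad_eqI[OF r_pos])
    show "mass_const > 0" using mass_const by simp
    fix n
    show "op_norm (CSpace H) (sup_norm H) (L ^^ n) \<le> mass_const * r ^ n"
      using r_pos mass_const by (intro Y.op_norm_le power_bound) auto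
    have "r ^ n * sup_norm H v = sup_norm H ((L ^^ n) v)"
      using r_pos unfolding vn by (subst Y.norm_cmult[OF vY]) (simp add: norm_power)
    also have "\<dots> \<le> op_norm (CSpace H) (sup_norm H) (L ^^ n) * sup_norm H v"
      by (rule Y.op_norm_bound[OF Y.bounded_op_power[OF bounded] vY])
    finally show "r ^ n \<le> op_norm (CSpace H) (sup_norm H) (L ^^ n)" using NYv by simp
  qed
qed

end

section \<open>Finite rank approximation\<close>

text \<open>The a-th derivative of x^n / n!.\<close>

definition divided_power :: "nat \<Rightarrow> nat \<Rightarrow> complex \<Rightarrow> complex" where
  "divided_power n a x = (if a \<le> n then x ^ (n - a) / fact (n - a) else 0)"

lemma divided_power_has_derivative: "(divided_power n a has_field_derivative divided_power n (Suc a) x) (at x)"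
proof (cases "a < n")
  case True
  then obtain k where k: "n - a = Suc k" "n - Suc a = k" by (metis Suc_diff_Suc)
  have "((\<lambda>x. x ^ Suc k / fact (Suc k)) has_field_derivative of_nat (Suc k) * x ^ k / fact (Suc k)) (at x)"
    using DERIV_cdivide[OF DERIV_power[OF DERIV_ident, of "Suc k" x UNIV], of "fact (Suc k)"] by simp
  also have "of_nat (Suc k) * x ^ k / fact (Suc k) = x ^ k / fact k"
    by (simp add: fact_Suc del: of_nat_Suc)
  finally show ?thesis using True k by (simp add: divided_power_def[abs_def])
next
  case False
  then have "divided_power n a = (\<lambda>x. if a = n then 1 else 0)" by (auto simp: divided_power_def[abs_def])
  then show ?thesis using False by (simp add: divided_power_def)
qed

lemma divided_power_0: "divided_power n a 0 = (if a = n then 1 else 0)"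
  by (auto simp: divided_power_def power_0_left)

text \<open>The entry (a, b) of the jet of (z - p)^i cnj (z - p)^j / (i! j!); at p all entries but
  (i, j) vanish.\<close>

definition taylor_monomial :: "complex \<Rightarrow> nat \<Rightarrow> nat \<Rightarrow> nat \<Rightarrow> nat \<Rightarrow> complex \<Rightarrow> complex" where
  "taylor_monomial p i j a b z = divided_power i a (z - p) * divided_power j b (cnj (z - p))"

lemma wirtinger_taylor_monomial: "wirtinger_jet H n (taylor_monomial p i j)"
proof -
  have D: "(taylor_monomial p i j a b has_derivative (\<lambda>h. h * taylor_monomial p i j (Suc a) b z + cnj h * taylor_monomial p i j a (Suc b) z)) (at z)" for a b z
  proof -
    have "((\<lambda>z. z - p) has_derivative (\<lambda>h. h)) (at z)" by (auto intro!: derivative_eq_intros)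
    note d1 = has_derivative_compose[OF this, where g = "divided_power i a",
        OF divided_power_has_derivative[unfolded has_field_derivative_def]]
    have "((\<lambda>z. cnj (z - p)) has_derivative (\<lambda>h. cnj h)) (at z)"
      by (rule bounded_linear.has_derivative[OF bounded_linear_cnj]) (auto intro!: derivative_eq_intros)
    note d2 = has_derivative_compose[OF this, where g = "divided_power j b",
        OF divided_power_has_derivative[unfolded has_field_derivative_def]]
    show ?thesis
      unfolding taylor_monomial_def[abs_def]
      by (rule has_derivative_eq_rhs[OF has_derivative_mult[OF d1 d2]]) (simp add: fun_eq_iff algebra_simps)
  qed
  show ?thesis
    unfolding jet_def using D has_derivative_continuous_on[OF has_derivative_at_withinI[OF D]] by blast
qed

context transfer
begin

text \<open>A choice, since a jet is not computed from f; \<open>deriv_at_eq\<close> shows that up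
  to order m the value on the closure does not depend on it.\<close>

definition deriv_at :: "(complex \<Rightarrow> complex) \<Rightarrow> nat \<Rightarrow> nat \<Rightarrow> complex \<Rightarrow> complex" where
  "deriv_at f = (SOME W. wirtinger_jet H m W \<and> (\<forall>z\<in>closure H. W 0 0 z = f z))"

lemma deriv_at_eq:
  assumes W: "wirtinger_jet H m W" "\<And>z. z \<in> closure H \<Longrightarrow> W 0 0 z = f z" and ij: "i + j \<le> m" and p: "p \<in> closure H"
  shows "deriv_at f i j p = W i j p"
proof -
  have V: "wirtinger_jet H m (deriv_at f) \<and> (\<forall>z\<in>closure H. deriv_at f 0 0 z = f z)"
    unfolding deriv_at_def by (rule someI[of _ W]) (use W in blast)
  have "deriv_at f 0 0 z = W 0 0 z" if "z \<in> H" for z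
    using V W(2)[of z] that closure_subset[of H] by auto
  then show ?thesis using jets_agree[OF _ W(1) _ ij p] V by blast
qed

text \<open>From order m downwards: each use of the mean value inequality between p and x gains the
  factor 2 |x - p|, with 2 for the two Wirtinger derivatives.\<close>

lemma taylor_remainder:
  assumes R: "wirtinger_jet H m R" and p: "p \<in> G" and N: "N \<ge> 0"
    and zero: "\<And>i j. i + j < m \<Longrightarrow> R i j p = 0"
    and top: "\<And>i j x. i + j = m \<Longrightarrow> x \<in> G \<Longrightarrow> cmod (R i j x) \<le> N"
    and ij: "i + j \<le> m" and x: "x \<in> G"
  shows "cmod (R i j x) \<le> (2 * cmod (x - p)) ^ (m - (i + j)) * N"
  using ij x
proof (induction "m - (i + j)" arbitrary: i j x)
  case 0
  then show ?case using top[of i j x] by simp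
next
  case (Suc t)
  have lt: "i + j < m" and t: "m - (Suc i + j) = t" "m - (i + Suc j) = t" using Suc.hyps(2) by auto
  \<comment> \<open>A convex set on which no point is farther from p than x, so the bound of the
    next order holds on it with |x - p|.\<close>
  let ?S = "G \<inter> cball p (cmod (x - p))"
  let ?M = "(2 * cmod (x - p)) ^ t * N"
  have "norm (R i j x - R i j p) \<le> (2 * ?M) * norm (x - p)"
  proof (rule differentiable_bound[where S = ?S])
    show "convex ?S" by (intro convex_Int convex_ball convex_cball)
    show "x \<in> ?S" "p \<in> ?S" using Suc.prems(2) p by (auto simp: dist_norm norm_minus_commute)
    fix y assume y: "y \<in> ?S"
    then have yG: "y \<in> G" and yd: "cmod (y - p) \<le> cmod (x - p)" by (auto simp: dist_norm norm_minus_commute)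
    have yH: "y \<in> H" using yG disc_H by blast
    show "(R i j has_derivative (\<lambda>h. h * R (Suc i) j y + cnj h * R i (Suc j) y)) (at y within ?S)"
      by (rule has_derivative_at_withinI, rule jet_has_derivative[OF R lt yH])
    have le: "(2 * cmod (y - p)) ^ t * N \<le> ?M"
      using yd N by (intro mult_right_mono power_mono) auto
    have "cmod (R (Suc i) j y) \<le> ?M" "cmod (R i (Suc j) y) \<le> ?M"
      using order_trans[OF Suc.hyps(1)[OF t(1)[symmetric] _ yG, unfolded t(1)] le]
        order_trans[OF Suc.hyps(1)[OF t(2)[symmetric] _ yG, unfolded t(2)] le] lt by simp_all
    then show "onorm (\<lambda>h. h * R (Suc i) j y + cnj h * R i (Suc j) y) \<le> 2 * ?M"
    proof (intro onorm_bound)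
      fix h
      assume b: "cmod (R (Suc i) j y) \<le> ?M" "cmod (R i (Suc j) y) \<le> ?M"
      have "cmod (h * R (Suc i) j y + cnj h * R i (Suc j) y) \<le> cmod h * ?M + cmod h * ?M"
        using b by (intro norm_triangle_le add_mono) (auto simp: norm_mult intro!: mult_left_mono)
      then show "norm (h * R (Suc i) j y + cnj h * R i (Suc j) y) \<le> 2 * ?M * norm h" by (simp add: algebra_simps)
    qed (use N in auto)
  qed
  then show ?case using zero[OF lt] Suc.hyps(2)[symmetric] by (simp add: algebra_simps)
qed

text \<open>The chain rule gives the power i + j of the scale to a derivative of order i + j, and
  the Taylor remainder of that derivative, at a distance comparable to the scale from the expansion
  point, supplies the missing power m - (i + j). So the m-th power remains at every order of
  differentiation.\<close>

lemma finite_rank_approximation: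
  "\<exists>C>0. \<forall>k\<ge>1. \<exists>K. compact_op X NX K \<and> op_norm X NX (\<lambda>f z. (L ^^ k) f z - K f z) \<le> C * (rate ^ m * r) ^ k"
proof -
  obtain \<Delta> where \<Delta>: "\<Delta> \<ge> 1" "\<And>z. z \<in> closure H \<Longrightarrow> cmod (z - center) \<le> \<Delta>"
  proof -
    have "bounded (closure H)" using H(2) by (rule bounded_closure)
    then obtain M where "\<And>z. z \<in> closure H \<Longrightarrow> dist center z \<le> M" using bounded_any_center by blast
    then have "\<And>z. z \<in> closure H \<Longrightarrow> cmod (z - center) \<le> max 1 M" by (force simp: dist_norm norm_minus_commute)
    then show ?thesis using that[of "max 1 M"] by simp
  qed
  \<comment> \<open>\<Delta> bounds distances to the centre, the 2 beside it comes from the Taylor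
    estimate and \<open>inverse (rate\<^sup>2)\<close> from \<open>scale_bound\<close>; the added 1
    secures C > 0.\<close>
  define C where "C = 2 ^ m * (mass_const * (coeff_bound * (2 * \<Delta> * inverse (rate\<^sup>2)) ^ m)) + 1"
  have C: "C > 0"
    using mass_const coeff_bound_nonneg \<Delta>(1) rate by (simp add: C_def add_nonneg_pos)
  have "\<exists>K. compact_op X NX K \<and> op_norm X NX (\<lambda>f z. (L ^^ Suc k) f z - K f z) \<le> C * (rate ^ m * r) ^ Suc k" for k
  proof -
    let ?I = "{(i, j). i + j < m}"
    have fin: "finite ?I" by (rule finite_subset[of _ "{..m} \<times> {..m}"]) auto
    \<comment> \<open>The expansion point is the image of the centre; other image points are within
      the scale times \<Delta> of it.\<close>
    define p where "p xs = branch xs center" for xs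
    have pG: "p xs \<in> G" if "xs \<in> words k" for xs
      unfolding p_def by (rule branch_in_disc(1)[OF words_subset[OF that] words_nonempty[OF that] center(3)])
    have pH: "p xs \<in> closure H" if "xs \<in> words k" for xs
      using pG[OF that] disc_H closure_subset by blast
    \<comment> \<open>One weighted branch applied to one Taylor monomial; with the coefficient
      functional \<open>l\<close> it forms a rank-one operator.\<close>
    define \<phi> where "\<phi> xs ij z = (if z \<in> closure H then branch_jet s xs (taylor_monomial (p xs) (fst ij) (snd ij)) 0 0 z else 0)" for xs ij z
    have \<phi>: "\<phi> xs ij \<in> X" if "xs \<in> words k" for xs ij
      by (rule CmSpaceI[OF H(1) wirtinger_branch_jet[OF words_subset[OF that] words_nonempty[OF that] wirtinger_taylor_monomial[of H m "p xs" "fst ij" "snd ij"]]])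
        (auto simp: \<phi>_def)
    define l where "l xs ij f = deriv_at f (fst ij) (snd ij) (p xs)" for xs ij f
    define K where "K f z = (\<Sum>xs\<in>words k. \<Sum>ij\<in>?I. l xs ij f * \<phi> xs ij z)" for f z
    have "compact_op X NX (\<lambda>f z. l xs ij f * \<phi> xs ij z)" if xs: "xs \<in> words k" and ij: "ij \<in> ?I" for xs ij
    proof (rule X.compact_op_rank_one[OF \<phi>[OF xs], where A = 1])
      have ijm: "fst ij + snd ij \<le> m" using ij by auto
      fix f assume f: "f \<in> X"
      obtain W where W: "wirtinger_jet H m W" "\<And>z. z \<in> closure H \<Longrightarrow> W 0 0 z = f z"
        "\<And>i j z. i + j \<le> m \<Longrightarrow> z \<in> closure H \<Longrightarrow> cmod (W i j z) \<le> NX f"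
        using X_jet[OF f] by metis
      have lW: "l xs ij f = W (fst ij) (snd ij) (p xs)"
        unfolding l_def by (rule deriv_at_eq[OF W(1,2) ijm pH[OF xs]])
      show "cmod (l xs ij f) \<le> 1 * NX f" unfolding lW using W(3)[OF ijm pH[OF xs]] by simp
      show "l xs ij (\<lambda>z. c * f z) = c * l xs ij f" for c
        unfolding lW unfolding l_def by (rule deriv_at_eq[OF jet_cmult[OF W(1)] _ ijm pH[OF xs]]) (use W(2) in simp)
      fix g assume g: "g \<in> X"
      obtain V where V: "wirtinger_jet H m V" "\<And>z. z \<in> closure H \<Longrightarrow> V 0 0 z = g z"
        "\<And>i j z. i + j \<le> m \<Longrightarrow> z \<in> closure H \<Longrightarrow> cmod (V i j z) \<le> NX g"
        using X_jet[OF g] by metis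
      have lV: "l xs ij g = V (fst ij) (snd ij) (p xs)"
        unfolding l_def by (rule deriv_at_eq[OF V(1,2) ijm pH[OF xs]])
      show "l xs ij (\<lambda>z. f z + g z) = l xs ij f + l xs ij g"
        unfolding lW lV unfolding l_def by (rule deriv_at_eq[OF jet_add[OF W(1) V(1)] _ ijm pH[OF xs]]) (use W(2) V(2) in simp)
    qed simp
    then have comp: "compact_op X NX K"
      unfolding K_def[abs_def] by (intro X.compact_op_sum finite_words fin)
    have "op_norm X NX (\<lambda>f z. (L ^^ Suc k) f z - K f z) \<le> C * (rate ^ m * r) ^ Suc k"
    proof (rule X.op_norm_le)
      show "0 \<le> C * (rate ^ m * r) ^ Suc k" using C rate r_pos by simp
      fix f assume f: "f \<in> X"
      have N: "NX f \<ge> 0" by (rule X.norm_nonneg[OF f])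
      obtain W where W: "wirtinger_jet H m W" "\<And>z. z \<in> closure H \<Longrightarrow> W 0 0 z = f z"
        "\<And>i j z. i + j \<le> m \<Longrightarrow> z \<in> closure H \<Longrightarrow> cmod (W i j z) \<le> NX f"
        using X_jet[OF f] by metis
      define P where "P xs a b z = (\<Sum>ij\<in>?I. W (fst ij) (snd ij) (p xs) * taylor_monomial (p xs) (fst ij) (snd ij) a b z)" for xs a b z
      define R where "R xs a b z = W a b z + (-1) * P xs a b z" for xs a b z
      have R: "wirtinger_jet H m (R xs)" for xs
        unfolding R_def[abs_def] P_def
        by (intro jet_add jet_cmult jet_sum W(1) fin wirtinger_taylor_monomial)
      \<comment> \<open>The polynomial has degree below m, so the derivatives of order m of the
        remainder are those of f.\<close>
      have P_top: "P xs a b z = 0" if "a + b = m" for xs a b z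
        unfolding P_def using that by (intro sum.neutral) (auto simp: taylor_monomial_def divided_power_def)
      have P_low: "P xs a b (p xs) = W a b (p xs)" if "a + b < m" for xs a b
      proof -
        have "P xs a b (p xs) = (\<Sum>ij\<in>?I. if ij = (a, b) then W a b (p xs) else 0)"
          unfolding P_def by (intro sum.cong refl) (auto simp: taylor_monomial_def divided_power_0)
        then show ?thesis using fin that by simp
      qed
      have Rb: "cmod (R xs i j x) \<le> (2 * cmod (x - p xs)) ^ (m - (i + j)) * NX f"
        if xs: "xs \<in> words k" and "i + j \<le> m" "x \<in> G" for xs i j x
      proof (rule taylor_remainder[OF R pG[OF xs] N _ _ that(2,3)])
        fix i j x assume ij: "i + j = m" and "x \<in> G"
        then have "x \<in> closure H" using disc_H closure_subset by blast
        then show "cmod (R xs i j x) \<le> NX f"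
          using W(3)[of i j x] P_top[OF ij, of xs x] ij by (simp add: R_def)
      qed (simp add: R_def P_low)
      let ?q = "scale_bound k"
      let ?V = "\<lambda>a b z. \<Sum>xs\<in>words k. branch_jet s xs (R xs) a b z"
      have V: "wirtinger_jet H m ?V"
        by (rule jet_sum[OF finite_words]) (rule wirtinger_branch_jet[OF words_subset words_nonempty R])
      have "NX (\<lambda>z. (L ^^ Suc k) f z - K f z) \<le> 2 ^ m * (mass_const * r ^ Suc k * (coeff_bound * ((2 * \<Delta> * ?q) ^ m * NX f)))"
      proof (rule Cm_norm_le_jet[OF H(1) H_nonempty V])
        fix z assume zH: "z \<in> H"
        then have z: "z \<in> closure H" using closure_subset by blast
        have bz: "branch xs z \<in> closure H" if "xs \<in> words k" for xs
          using branch_in_disc(2)[OF words_subset[OF that] words_nonempty[OF that] z] D_closure by blast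
        have "?V 0 0 z = (\<Sum>xs\<in>words k. of_real (weight s xs z) * f (branch xs z) -
            (\<Sum>ij\<in>?I. l xs ij f * \<phi> xs ij z))"
        proof (intro sum.cong refl)
          fix xs assume xs: "xs \<in> words k"
          have "(\<Sum>ij\<in>?I. l xs ij f * \<phi> xs ij z) = (\<Sum>ij\<in>?I. of_real (weight s xs z) *
              (W (fst ij) (snd ij) (p xs) * taylor_monomial (p xs) (fst ij) (snd ij) 0 0 (branch xs z)))"
            using z by (intro sum.cong refl) (auto simp: l_def \<phi>_def branch_jet_0 deriv_at_eq[OF W(1,2) _ pH[OF xs]])
          also have "\<dots> = of_real (weight s xs z) * P xs 0 0 (branch xs z)"
            by (simp add: P_def sum_distrib_left)
          finally show "branch_jet s xs (R xs) 0 0 z = of_real (weight s xs z) * f (branch xs z) - (\<Sum>ij\<in>?I. l xs ij f * \<phi> xs ij z)"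
            using W(2)[OF bz[OF xs]] by (simp add: branch_jet_0 R_def algebra_simps)
        qed
        then show "?V 0 0 z = (L ^^ Suc k) f z - K f z"
          unfolding Lam_power[OF z] K_def by (simp add: sum_subtractf)
        fix a b assume ab: "a + b \<le> m"
        have "cmod (?V a b z) \<le> mass (Suc k) z * (coeff_bound * ((2 * \<Delta> * ?q) ^ m * NX f))"
        proof (rule sum_branch_jet_bound[OF z ab])
          fix xs i j assume xs: "xs \<in> words k" and ij: "i \<le> a" "j \<le> b"
          have ijm: "i + j \<le> m" using ij ab by simp
          have bG: "branch xs z \<in> G" by (rule branch_in_disc(1)[OF words_subset[OF xs] words_nonempty[OF xs] zH])
          have "cmod (branch xs z - p xs) \<le> cmod (word_scale xs) * cmod (z - center)"
            unfolding p_def by (rule branch_lipschitz[OF words_subset[OF xs] words_nonempty[OF xs] closure_H_Re[OF z] closure_H_Re[OF center(4)]])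
          also have "\<dots> \<le> ?q * \<Delta>" by (intro mult_mono scale_bound xs \<Delta> z scale_bound_range) auto
          finally have d: "2 * cmod (branch xs z - p xs) \<le> 2 * \<Delta> * ?q" by (simp add: ac_simps)
          have sc: "cmod (word_scale xs) \<le> 2 * \<Delta> * ?q"
          proof -
            have "cmod (word_scale xs) \<le> 1 * ?q" using scale_bound[OF xs] by simp
            also have "\<dots> \<le> (2 * \<Delta>) * ?q" using \<Delta>(1) by (intro mult_right_mono scale_bound_range) auto
            finally show ?thesis .
          qed
          have "cmod (word_scale xs) ^ (i + j) * cmod (R xs i j (branch xs z)) \<le>
              (2 * \<Delta> * ?q) ^ (i + j) * ((2 * \<Delta> * ?q) ^ (m - (i + j)) * NX f)"
          proof (rule mult_mono)
            show "cmod (word_scale xs) ^ (i + j) \<le> (2 * \<Delta> * ?q) ^ (i + j)" by (rule power_mono[OF sc]) simp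
            show "cmod (R xs i j (branch xs z)) \<le> (2 * \<Delta> * ?q) ^ (m - (i + j)) * NX f"
              by (rule order_trans[OF Rb[OF xs ijm bG] mult_right_mono[OF power_mono[OF d] N]]) simp
          qed (use \<Delta>(1) scale_bound_range(1)[of k] in auto)
          also have "\<dots> = (2 * \<Delta> * ?q) ^ m * NX f"
            using ijm by (simp add: mult.assoc[symmetric] power_add[symmetric])
          finally show "cmod (word_scale xs) ^ (i + j) * cmod (R xs i j (branch xs z)) \<le> (2 * \<Delta> * ?q) ^ m * NX f" .
        qed
        also have "\<dots> \<le> mass_const * r ^ Suc k * (coeff_bound * ((2 * \<Delta> * ?q) ^ m * NX f))"
          using coeff_bound_nonneg \<Delta>(1) scale_bound_range(1)[of k] N by (intro mult_right_mono mass_le z) auto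
        finally show "cmod (?V a b z) \<le> mass_const * r ^ Suc k * (coeff_bound * ((2 * \<Delta> * ?q) ^ m * NX f))" .
      qed
      also have "\<dots> = 2 ^ m * (mass_const * (coeff_bound * (2 * \<Delta> * ?q) ^ m)) * (r ^ Suc k * NX f)"
        by (simp only: ac_simps)
      also have "\<dots> \<le> 2 ^ m * (mass_const * (coeff_bound * (2 * \<Delta> * (inverse (rate\<^sup>2) * rate ^ Suc k)) ^ m)) * (r ^ Suc k * NX f)"
        using mass_const coeff_bound_nonneg \<Delta>(1) scale_bound_range(1)[of k] r_pos N
        by (intro mult_right_mono mult_left_mono power_mono) (auto simp: scale_bound_def)
      also have "\<dots> = (C - 1) * ((rate ^ m * r) ^ Suc k * NX f)"
        unfolding C_def power_mult_distrib power_mult[symmetric] by (simp only: ac_simps) simp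
      also have "\<dots> \<le> C * ((rate ^ m * r) ^ Suc k * NX f)"
        using rate r_pos N by (intro mult_right_mono) auto
      finally show "NX (\<lambda>z. (L ^^ Suc k) f z - K f z) \<le> C * (rate ^ m * r) ^ Suc k * NX f"
        by (simp only: mult.assoc)
    qed
    with comp show ?thesis by blast
  qed
  then have "\<exists>K. compact_op X NX K \<and> op_norm X NX (\<lambda>f z. (L ^^ k) f z - K f z) \<le> C * (rate ^ m * r) ^ k" if "k \<ge> 1" for k
    using that by (cases k) auto
  then show ?thesis using C by blast
qed

lemma ess_spec_rad_bound: "ess_spec_rad X NX L \<le> rate ^ m * r"
proof -
  obtain C where "C > 0" "\<forall>k\<ge>1. \<exists>K. compact_op X NX K \<and> op_norm X NX (\<lambda>f z. (L ^^ k) f z - K f z) \<le> C * (rate ^ m * r) ^ k"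
    using finite_rank_approximation by blast
  then show ?thesis
    using rate r_pos by (intro X.ess_spec_rad_le[OF Lam_bounded, of "rate ^ m * r" C]) auto
qed

section \<open>Verification of the spectral gap and its consequences\<close>

lemma spectral_gap_ell:
  "\<exists>C q v. spectral_gap X NX (2 ^ m) L r q C 1 v ell \<and> (\<forall>z\<in>closure H. Im (v z) = 0 \<and> Re (v z) > 0)"
proof -
  obtain C q where C: "C \<ge> 0" "0 < q" "q < 1" and
    dec: "\<And>g n. g \<in> X \<Longrightarrow> ell g = 0 \<Longrightarrow> NX ((L ^^ n) g) \<le> C * (q * r) ^ n * NX g"
    using norm_decay by blast
  obtain v where v: "v \<in> X" "\<And>z. z \<in> closure H \<Longrightarrow> Im (v z) = 0 \<and> Re (v z) > 0"
    "L v = (\<lambda>z. of_real r * v z)" "ell v = 1"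
    using eigenfunction by blast
  have "spectral_gap X NX (2 ^ m) L r q C 1 v ell"
  proof
    show "cmod (ell f) \<le> 1 * NX f" if "f \<in> X" for f
      using ell_bound[OF lipschitz_X[OF that] X_pointwise[OF that]] by simp
    show "ell (\<lambda>z. f z + g z) = ell f + ell g" if "f \<in> X" "g \<in> X" for f g
      by (rule ell_add[OF lipschitz_X[OF that(1)] lipschitz_X[OF that(2)]])
    show "ell (\<lambda>z. c * f z) = c * ell f" if "f \<in> X" for f c
      by (rule ell_cmult[OF lipschitz_X[OF that]])
  qed (use Lam_bounded r_pos C v dec ell_Lam in auto)
  then show ?thesis using v(2) by blast
qed

text \<open>By compactness u has a positive minimum on D, and averaging preserves this lower
  bound.\<close>

lemma ell_positive:
  assumes u: "u \<in> X" and pos: "\<And>z. z \<in> closure H \<Longrightarrow> Im (u z) = 0 \<and> Re (u z) > 0"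
  obtains t where "ell u = of_real t" "t > 0"
proof -
  have cont: "continuous_on D (\<lambda>x. Re (u x))"
    using u by (intro continuous_on_subset[OF _ D_closure] continuous_intros) (simp add: CmSpace_def)
  obtain x0 where x0: "x0 \<in> D" "\<And>x. x \<in> D \<Longrightarrow> Re (u x0) \<le> Re (u x)"
    using continuous_attains_inf[OF compact_cball _ cont] center(1) by blast
  have "u x = of_real (Re (u x)) \<and> Re (u x0) \<le> Re (u x) \<and> Re (u x) \<le> NX u" if x: "x \<in> D" for x
    using pos[of x] x0(2)[OF x] x D_closure X_pointwise[OF u, of x] complex_Re_le_cmod[of "u x"]
    by (auto simp: complex_eq_iff subset_eq simp del: mem_cball)
  from ell_real[OF lipschitz_X[OF u] this] obtain t where "ell u = of_real t" "Re (u x0) \<le> t" by metis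
  moreover have "Re (u x0) > 0" using pos[of x0] x0(1) D_closure by blast
  ultimately show ?thesis using that by force
qed

end

theorem theorem5p2:
  fixes \<gamma> s :: real and B H :: "complex set" and m :: nat
  assumes "\<gamma> \<ge> 1" and "finite B" and "B \<noteq> {}" and "\<forall>b\<in>B. Re b \<ge> \<gamma>"
    and "open H" and "bounded H" and "mildly_regular H" and "H \<subseteq> {z. Re z > 0}"
    and "{z. cmod (z - complex_of_real (1 / (2 * \<gamma>))) < 1 / (2 * \<gamma>)} \<subseteq> H"
    and "m \<ge> 1" and "s > 0"
  shows "let X = CmSpace H m; NX = Cm_norm H m; Y = CSpace H; NY = sup_norm H;
             \<Lambda> = Lam B s H; r = spec_rad X NX \<Lambda>; \<sigma> = spectrum_op X NX \<Lambda> in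
    r > 0 \<and> r = spec_rad Y NY \<Lambda> \<and>
    ess_spec_rad X NX \<Lambda> \<le> inverse ((\<gamma>\<^sup>2 + 1) ^ m) * r \<and>
    (\<exists>v\<in>X. (\<forall>z\<in>closure H. Im (v z) = 0 \<and> Re (v z) > 0) \<and>
        \<Lambda> v = (\<lambda>z. complex_of_real r * v z) \<and>
        (\<forall>u\<in>X. (\<forall>z\<in>closure H. Im (u z) = 0 \<and> Re (u z) > 0) \<longrightarrow>
           (\<exists>su::real. su > 0 \<and>
              (\<lambda>k. NX (\<lambda>z. complex_of_real ((1 / r) ^ k) * (\<Lambda> ^^ k) u z
                              - complex_of_real su * v z)) \<longlonglongrightarrow> 0))) \<and>
    (\<exists>r1 < r. \<forall>\<xi>\<in>\<sigma> - {complex_of_real r}. cmod \<xi> \<le> r1) \<and>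
    (\<exists>\<epsilon>>0. \<sigma> \<inter> ball (complex_of_real r) \<epsilon> = {complex_of_real r}) \<and>
    (\<exists>w\<in>X. w \<noteq> (\<lambda>z. 0) \<and>
        {f\<in>X. \<exists>k. ((\<lambda>g z. complex_of_real r * g z - \<Lambda> g z) ^^ k) f = (\<lambda>z. 0)}
          = {(\<lambda>z. c * w z) | c. True})"
proof -
  have disc: "ball (complex_of_real (1 / (2 * \<gamma>))) (1 / (2 * \<gamma>)) \<subseteq> H"
    using assms(9) by (auto simp: dist_norm norm_minus_commute subset_eq)
  interpret transfer \<gamma> s B H m
    by unfold_locales (use assms disc in auto)
  obtain C q v where sg: "spectral_gap X NX (2 ^ m) L r q C 1 v ell"
    and pos: "\<forall>z\<in>closure H. Im (v z) = 0 \<and> Re (v z) > 0"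
    using spectral_gap_ell by (elim exE conjE)
  interpret sg: spectral_gap X NX "2 ^ m" L r q C 1 v ell by (rule sg)
  \<comment> \<open>The limiting constant is the value of the functional at u, positive because u
    is.\<close>
  have lim: "\<exists>su::real. su > 0 \<and> (\<lambda>k. NX (\<lambda>z. of_real ((1 / r) ^ k) * (L ^^ k) u z - of_real su * v z)) \<longlonglongrightarrow> 0"
    if u: "u \<in> X" and upos: "\<forall>z\<in>closure H. Im (u z) = 0 \<and> Re (u z) > 0" for u
  proof -
    obtain t where "ell u = of_real t" "t > 0" using ell_positive[OF u] upos by metis
    then show ?thesis using sg.power_limit[OF u] by (intro exI[of _ t]) simp
  qed
  have "ess_spec_rad X NX L \<le> inverse ((\<gamma>\<^sup>2 + 1) ^ m) * r"
    using ess_spec_rad_bound by (simp add: rate_def power_inverse)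
  moreover have "\<exists>r1<r. \<forall>\<xi>\<in>spectrum_op X NX L - {of_real r}. cmod \<xi> \<le> r1"
    using sg.spectrum_bound sg.q r_pos by (intro exI[of _ "q * r"]) auto
  ultimately show ?thesis
    unfolding Let_def sg.spec_rad spec_rad_Y
    using r_pos sg.v pos lim sg.spectrum_isolated sg.eigenspace_simple sg.v_nonzero
    by (intro conjI bexI[of _ v]) auto
qed

end
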